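(* For a uniformly scaling measure $\mu$ generating an ergodic fractal distribution $P$ and $\pi\in\Pi_{d,k}$, it is possible that $\pi\mu$ is not exact dimensional, and it is possible that $\underline{\dim}\,\pi\mu>E_{P}(\pi)$. That is: (a) there exist $d,k$, a uniformly scaling measure $\mu$ on $\mathbb{R}^d$ generating an ergodic fractal distribution, and $\pi\in\Pi_{d,k}$, such that $\pi\mu$ is not exact dimensional; (b) there exist $d,k$, a uniformly scaling measure $\mu$ on $\mathbb{R}^d$ generating an ergodic fractal distribution $P$, and $\pi\in\Pi_{d,k}$, such that $\underline{\dim}\,\pi\mu>E_{P}(\pi)$.
   Context: $\mathbb{R}^d$ carries the sup-norm; $B_r(x)$ is the closed ball, $B_R=B_R(0)$, $B_1=[-1,1]^d$. $\mathcal{M}$ is the space of Radon measures on $\mathbb{R}^d$ with the weak topology (tested against continuous compactly supported functions). "Distribution" means a Borel probability measure on a space of measures. For $\mu(B_1)>0$ put $\mu^*=\frac{1}{\mu(B_1)}\mu$, $\mu^{\square}=\mu^*|_{B_1}$ (restriction), $\mathcal{M}^*=\{\mu:\mu(B_1)=1\}$, $\mathcal{M}^{\square}=\mathcal{P}(B_1)$; $P^{\square}$ is the push-forward of $P$ under $\mu\mapsto\mu^{\square}$. Let $T_x(y)=y-x$, $S_t(y)=e^t y$; maps act on measures by push-forward; $T_x^*\mu=(T_x\mu)^*$, $S_t^*\mu=(S_t\mu)^*$, $S^{\square}_t\mu=(S_t\mu)^{\square}$. $S^*=(S^*_t)_{t\in\mathbb{R}}$ acts on $\{\mu\in\mathcal{M}^*:0\in\operatorname{supp}\mu\}$;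 $S^*$-invariant distributions are understood to be concentrated on this set. Fractal distribution (FD): a probability distribution $P$ on $\mathcal{M}^*$ that is $S^*$-invariant and quasi-Palm, i.e. for every bounded open neighborhood $U$ of $0$, $P\sim\int\int_U\delta_{T_x^*\mu}\,d\mu(x)\,dP(\mu)$ ($\sim$: same null sets). EFD (ergodic fractal distribution): an $S^*$-ergodic FD. For $x\in\operatorname{supp}\mu$, $\langle\mu\rangle^{\square}_{x,T}=\frac1T\int_0^T\delta_{S_t^{\square}T_x\mu}\,dt\in\mathcal{P}(\mathcal{M}^{\square})$ (weak topology). $\mu$ is a uniformly scaling measure (USM) generating the FD $P$ if $\langle\mu\rangle^{\square}_{x,T}\to P^{\square}$ as $T\to\infty$ for $\mu$-a.e. $x$. Dimension: for a finite measure $\nu$, $\underline{D}_\nu(y)=\liminf_{r\searrow0}\frac{\log\nu(B_r(y))}{\log r}$ and $\underline{\dim}\,\nu=\operatorname{essinf}_{y\sim\nu}\underline{D}_\nu(y)$; $\nu$ is exact dimensional if for some $\alpha$, $\lim_{r\searrow0}\frac{\log\nu(B_r(y))}{\log r}=\alpha$ for $\nu$-a.e. $y$. For $\mu\in\mathcal{M}$, $\underline{\dim}\,\pi\mu=\lim_{R\to\infty}\underline{\dim}\,\pi(\mu|_{B_R})$. $\Pi_{d,k}$ is the space of linear maps $\mathbb{R}^d\to\mathbb{R}^k$, and $E_P(\pi)=\int\underline{\dim}\,\pi\nu\,dP(\nu)$. *)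

theory Defs
  imports "HOL-Probability.Probability"
begin

definition borel_of :: "'a topology \<Rightarrow> 'a measure" where
  "borel_of X = sigma (topspace X) {U. openin X U}"

text \<open>
  Used only for second-countable, locally compact Hausdorff spaces, where every Borel measure that
  is finite on compact sets is automatically regular.
\<close>

definition radon_measures :: "'a topology \<Rightarrow> 'a measure set" where
  "radon_measures X =
     {\<mu>. sets \<mu> = sets (borel_of X) \<and> (\<forall>K. compactin X K \<longrightarrow> emeasure \<mu> K < \<infinity>)}"

definition compactly_supported :: "'a topology \<Rightarrow> ('a \<Rightarrow> real) set" where
  "compactly_supported X =
     {f. continuous_map X euclideanreal f \<and>
         (\<exists>K. compactin X K \<and> (\<forall>x \<in> topspace X - K. f x = 0))}"

definition weak_topology :: "'a topology \<Rightarrow> 'a measure topology" where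
  "weak_topology X = topology_generated_by
     {{\<mu> \<in> radon_measures X. (\<integral>x. f x \<partial>\<mu>) \<in> V} | f V. f \<in> compactly_supported X \<and> open V}"

definition prob_topology :: "'a topology \<Rightarrow> 'a measure topology" where
  "prob_topology X = subtopology (weak_topology X) {\<mu>. prob_space \<mu>}"

definition supp :: "'a topology \<Rightarrow> 'a measure \<Rightarrow> 'a set" where
  "supp X \<mu> = {x \<in> topspace X. \<forall>U. openin X U \<and> x \<in> U \<longrightarrow> emeasure \<mu> U > 0}"

text \<open>
  The dimension is a natural number \<^term>\<open>d\<close>: points of $d$-space are the functions
  \<^typ>\<open>nat \<Rightarrow> real\<close> vanishing at all indices \<open>i \<ge> d\<close>, with the topology
  \<^term>\<open>Euclidean_space d\<close>.  Balls are closed sup-norm balls.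
\<close>

definition closed_ball :: "nat \<Rightarrow> (nat \<Rightarrow> real) \<Rightarrow> real \<Rightarrow> (nat \<Rightarrow> real) set" where
  "closed_ball d x r = {y \<in> topspace (Euclidean_space d). \<forall>i<d. \<bar>y i - x i\<bar> \<le> r}"

abbreviation origin :: "nat \<Rightarrow> real" where
  "origin \<equiv> (\<lambda>i. 0)"

abbreviation unit_ball :: "nat \<Rightarrow> (nat \<Rightarrow> real) set" where
  "unit_ball d \<equiv> closed_ball d origin 1"

definition translate :: "nat \<Rightarrow> (nat \<Rightarrow> real) \<Rightarrow> (nat \<Rightarrow> real) measure \<Rightarrow> (nat \<Rightarrow> real) measure" where
  "translate d x \<mu> = distr \<mu> (borel_of (Euclidean_space d)) (\<lambda>y i. y i - x i)"

definition dilate :: "nat \<Rightarrow> real \<Rightarrow> (nat \<Rightarrow> real) measure \<Rightarrow> (nat \<Rightarrow> real) measure" where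
  "dilate d t \<mu> = distr \<mu> (borel_of (Euclidean_space d)) (\<lambda>y i. exp t * y i)"

text \<open>
  The operations \<open>star\<close> and \<open>box\<close> are meaningful only if the unit ball has positive mass; otherwise
  \<open>star d \<mu>\<close> still gives it mass 0 and so never lies in \<open>star_measures d\<close>.
\<close>

definition star :: "nat \<Rightarrow> (nat \<Rightarrow> real) measure \<Rightarrow> (nat \<Rightarrow> real) measure" where
  "star d \<mu> = scale_measure (1 / emeasure \<mu> (unit_ball d)) \<mu>"

definition box :: "nat \<Rightarrow> (nat \<Rightarrow> real) measure \<Rightarrow> (nat \<Rightarrow> real) measure" where
  "box d \<mu> = restrict_space (star d \<mu>) (unit_ball d)"

definition star_measures :: "nat \<Rightarrow> (nat \<Rightarrow> real) measure set" where
  "star_measures d = {\<mu> \<in> radon_measures (Euclidean_space d). emeasure \<mu> (unit_ball d) = 1}"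

definition star_topology :: "nat \<Rightarrow> (nat \<Rightarrow> real) measure topology" where
  "star_topology d = subtopology (weak_topology (Euclidean_space d)) (star_measures d)"

definition box_topology :: "nat \<Rightarrow> (nat \<Rightarrow> real) measure topology" where
  "box_topology d = prob_topology (subtopology (Euclidean_space d) (unit_ball d))"

definition star_distribution :: "nat \<Rightarrow> (nat \<Rightarrow> real) measure measure \<Rightarrow> bool" where
  "star_distribution d P \<longleftrightarrow> sets P = sets (borel_of (star_topology d)) \<and> prob_space P"

definition flow_domain :: "nat \<Rightarrow> (nat \<Rightarrow> real) measure set" where
  "flow_domain d = {\<mu> \<in> star_measures d. origin \<in> supp (Euclidean_space d) \<mu>}"

definition scale_invariant :: "nat \<Rightarrow> (nat \<Rightarrow> real) measure measure \<Rightarrow> bool" where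
  "scale_invariant d P \<longleftrightarrow>
     (AE \<mu> in P. \<mu> \<in> flow_domain d) \<and>
     (\<forall>t. \<forall>A \<in> sets P. emeasure P {\<mu> \<in> flow_domain d. star d (dilate d t \<mu>) \<in> A} = emeasure P A)"

definition scale_ergodic :: "nat \<Rightarrow> (nat \<Rightarrow> real) measure measure \<Rightarrow> bool" where
  "scale_ergodic d P \<longleftrightarrow>
     scale_invariant d P \<and>
     (\<forall>A \<in> sets P. A \<subseteq> flow_domain d \<and>
        (\<forall>t. {\<mu> \<in> flow_domain d. star d (dilate d t \<mu>) \<in> A} = A) \<longrightarrow>
        emeasure P A = 0 \<or> emeasure P A = 1)"

text \<open>
  The double integral is the mass that the mixture
  $\int\int_U \delta_{T_x^*\mu}\,d\mu(x)\,dP(\mu)$ assigns to \<open>A\<close>.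
\<close>

definition quasi_Palm :: "nat \<Rightarrow> (nat \<Rightarrow> real) measure measure \<Rightarrow> bool" where
  "quasi_Palm d P \<longleftrightarrow>
     (\<forall>U R. openin (Euclidean_space d) U \<and> origin \<in> U \<and> U \<subseteq> closed_ball d origin R \<longrightarrow>
        (\<forall>A \<in> sets P. emeasure P A = 0 \<longleftrightarrow>
           (\<integral>\<^sup>+ \<mu>. (\<integral>\<^sup>+ x \<in> U. indicator A (star d (translate d x \<mu>)) \<partial>\<mu>) \<partial>P) = 0))"

definition fractal_distribution :: "nat \<Rightarrow> (nat \<Rightarrow> real) measure measure \<Rightarrow> bool" where
  "fractal_distribution d P \<longleftrightarrow> star_distribution d P \<and> scale_invariant d P \<and> quasi_Palm d P"

definition ergodic_fractal_distribution :: "nat \<Rightarrow> (nat \<Rightarrow> real) measure measure \<Rightarrow> bool" where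
  "ergodic_fractal_distribution d P \<longleftrightarrow> fractal_distribution d P \<and> scale_ergodic d P"

text \<open>
  The average $\frac1T\int_0^T\delta_{S_t^\Box T_x\mu}\,dt$ is the push-forward of the uniform
  distribution on $[0,T]$ under $t\mapsto S_t^\Box T_x\mu$.
\<close>

definition scenery ::
    "nat \<Rightarrow> (nat \<Rightarrow> real) measure \<Rightarrow> (nat \<Rightarrow> real) \<Rightarrow> real \<Rightarrow> (nat \<Rightarrow> real) measure measure" where
  "scenery d \<mu> x T =
     distr (uniform_measure lborel {0..T}) (borel_of (box_topology d))
       (\<lambda>t. box d (dilate d t (translate d x \<mu>)))"

definition box_distribution ::
    "nat \<Rightarrow> (nat \<Rightarrow> real) measure measure \<Rightarrow> (nat \<Rightarrow> real) measure measure" where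
  "box_distribution d P = distr P (borel_of (box_topology d)) (box d)"

text \<open>
  The zero measure is excluded: it would vacuously generate every distribution.
\<close>

definition uniformly_scaling ::
    "nat \<Rightarrow> (nat \<Rightarrow> real) measure \<Rightarrow> (nat \<Rightarrow> real) measure measure \<Rightarrow> bool" where
  "uniformly_scaling d \<mu> P \<longleftrightarrow>
     \<mu> \<in> radon_measures (Euclidean_space d) \<and> emeasure \<mu> (space \<mu>) > 0 \<and>
     fractal_distribution d P \<and>
     (AE x in \<mu>. x \<in> supp (Euclidean_space d) \<mu> \<longrightarrow>
        limitin (prob_topology (box_topology d)) (scenery d \<mu> x) (box_distribution d P) at_top)"

text \<open>
  For $0<r<1$, $\log 0/\log r$ is read as $+\infty$.
\<close>

definition dim_ratio :: "nat \<Rightarrow> (nat \<Rightarrow> real) measure \<Rightarrow> (nat \<Rightarrow> real) \<Rightarrow> real \<Rightarrow> ereal" where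
  "dim_ratio k \<nu> y r =
     (if measure \<nu> (closed_ball k y r) = 0 then \<infinity>
      else ereal (ln (measure \<nu> (closed_ball k y r)) / ln r))"

definition lower_local_dim :: "nat \<Rightarrow> (nat \<Rightarrow> real) measure \<Rightarrow> (nat \<Rightarrow> real) \<Rightarrow> ereal" where
  "lower_local_dim k \<nu> y = Liminf (at_right 0) (dim_ratio k \<nu> y)"

text \<open>
  The limit inferior along \<^term>\<open>ae_filter \<nu>\<close> is the essential infimum.
\<close>

definition lower_dim :: "nat \<Rightarrow> (nat \<Rightarrow> real) measure \<Rightarrow> ereal" where
  "lower_dim k \<nu> = Liminf (ae_filter \<nu>) (lower_local_dim k \<nu>)"

text \<open>
  As with \<^const>\<open>lower_dim\<close>, only meaningful for finite measures.
\<close>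

definition exact_dimensional :: "nat \<Rightarrow> (nat \<Rightarrow> real) measure \<Rightarrow> bool" where
  "exact_dimensional k \<nu> \<longleftrightarrow>
     (\<exists>\<alpha>::real. AE y in \<nu>. (dim_ratio k \<nu> y \<longlongrightarrow> ereal \<alpha>) (at_right 0))"

definition linear_maps :: "nat \<Rightarrow> nat \<Rightarrow> ((nat \<Rightarrow> real) \<Rightarrow> (nat \<Rightarrow> real)) set" where
  "linear_maps d k =
     {\<pi>. (\<forall>x \<in> topspace (Euclidean_space d). \<pi> x \<in> topspace (Euclidean_space k)) \<and>
         (\<forall>x \<in> topspace (Euclidean_space d). \<forall>y \<in> topspace (Euclidean_space d).
            \<pi> (\<lambda>i. x i + y i) = (\<lambda>i. \<pi> x i + \<pi> y i)) \<and>
         (\<forall>c. \<forall>x \<in> topspace (Euclidean_space d). \<pi> (\<lambda>i. c * x i) = (\<lambda>i. c * \<pi> x i))}"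

definition image_measure ::
    "nat \<Rightarrow> ((nat \<Rightarrow> real) \<Rightarrow> (nat \<Rightarrow> real)) \<Rightarrow> (nat \<Rightarrow> real) measure \<Rightarrow> (nat \<Rightarrow> real) measure" where
  "image_measure k \<pi> \<mu> = distr \<mu> (borel_of (Euclidean_space k)) \<pi>"

text \<open>
  \<open>image_measure k \<pi> \<mu>\<close> need not be locally finite if \<open>\<mu>\<close> is infinite, whence the exhaustion by
  balls.  The limit exists because the expression is non-increasing in \<open>R\<close>.
\<close>

definition image_lower_dim ::
    "nat \<Rightarrow> nat \<Rightarrow> ((nat \<Rightarrow> real) \<Rightarrow> (nat \<Rightarrow> real)) \<Rightarrow> (nat \<Rightarrow> real) measure \<Rightarrow> ereal" where
  "image_lower_dim d k \<pi> \<mu> =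
     Lim at_top (\<lambda>R::real.
       lower_dim k (image_measure k \<pi> (restrict_space \<mu> (closed_ball d origin R))))"

text \<open>
  The dimensions are non-negative, so \<^const>\<open>e2ennreal\<close> does not truncate.
\<close>

definition expected_dim ::
    "nat \<Rightarrow> nat \<Rightarrow> ((nat \<Rightarrow> real) \<Rightarrow> (nat \<Rightarrow> real)) \<Rightarrow> (nat \<Rightarrow> real) measure measure \<Rightarrow> ennreal" where
  "expected_dim d k \<pi> P = (\<integral>\<^sup>+ \<nu>. e2ennreal (image_lower_dim d k \<pi> \<nu>) \<partial>P)"

end

(*
  Let P be the point mass at normalised length on the vertical axis of the plane; it is an ergodic
  fractal distribution, and the horizontal projection \<pi> sends its only measure to an atom, so that
  E_P(\<pi>) = 0.  If g has derivative zero almost everywhere, the length measure lifted to the graph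
  {(g y, y)} looks, near almost every point, more and more like the vertical axis, so it is a
  uniformly scaling measure generating P.  Its projection is the image of Lebesgue measure under g.
  For g y = sum_n 16^-n floor(2^n y), the derivative vanishes at all points that are not too well
  approximated by dyadic rationals, whereas two points in different dyadic intervals of level n have
  values at distance at least 16^-n, so the image has lower dimension at least 1/8.  This is (b).
  Replacing g by zero on the negative axis adds an atom to the projection, which gives (a).
*)

theory Submission
  imports Defs
begin

section \<open>Borel sets and weak topologies\<close>

text \<open>P records only blow-ups: a horizontal increment that is o(h) over a vertical increment h
  is lost in the limit. The projection still sees it, and increments of order h^4 already prevent
  concentration. This fixes the constants. Term n of g has jumps 16^-n at spacing 2^-n, so g varies
  by order (2/16)^N = 8^-N inside a dyadic interval of level N. Almost every point is eventually
  farther than 4^-N from the dyadic points of level N, which makes difference quotients O(2^-N). The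
  gaps 16^-N would give dimension log 2 / log 16 = 1/4; claiming only 1/8 absorbs all multiplicative
  constants. The obstacle is measurability. Distributions live on the Borel sets of weak topologies,
  and push-forwards and preimages under the flow carry their meaning only once the maps into such
  spaces are known to be measurable, although normalising by the mass of a ball is not
  continuous.\<close>

lemma space_borel_of [simp]: "space (borel_of X) = topspace X"
  by (simp add: borel_of_def space_measure_of_conv)

lemma sets_borel_of: "sets (borel_of X) = sigma_sets (topspace X) {U. openin X U}"
  unfolding borel_of_def by (rule sets_measure_of) (auto dest: openin_subset)

lemma openin_sets_borel_of: "openin X U \<Longrightarrow> U \<in> sets (borel_of X)"
  by (auto simp: sets_borel_of)

lemma closedin_sets_borel_of: "closedin X C \<Longrightarrow> C \<in> sets (borel_of X)"
  using sets.compl_sets[OF openin_sets_borel_of, of X "topspace X - C"]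
  by (auto simp: closedin_def double_diff)

lemma measurable_borel_ofI:
  assumes "\<And>x. x \<in> space M \<Longrightarrow> f x \<in> topspace X"
    and "\<And>U. openin X U \<Longrightarrow> f -` U \<inter> space M \<in> sets M"
  shows "f \<in> measurable M (borel_of X)"
  unfolding borel_of_def
  by (rule measurable_measure_of) (use assms in \<open>auto dest: openin_subset\<close>)

lemma continuous_map_measurable:
  assumes "continuous_map X Y f" shows "f \<in> measurable (borel_of X) (borel_of Y)"
proof (rule measurable_borel_ofI)
  fix U assume "openin Y U"
  then have "openin X {x \<in> topspace X. f x \<in> U}"
    using assms by (simp add: continuous_map_def)
  moreover have "{x \<in> topspace X. f x \<in> U} = f -` U \<inter> space (borel_of X)"
    by auto
  ultimately show "f -` U \<inter> space (borel_of X) \<in> sets (borel_of X)"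
    by (metis openin_sets_borel_of)
qed (use assms in \<open>auto simp: continuous_map_def\<close>)

text \<open>Generating a sigma-algebra commutes with taking traces on \<open>S\<close>, and the open
  sets of the subspace are the traces of open sets.\<close>

lemma sets_borel_of_top_of_set:
  assumes "S \<in> sets borel"
  shows "sets (borel_of (top_of_set S)) = sets (restrict_space borel S)"
proof -
  have "sets (restrict_space borel S) = ((\<inter>) S) ` sigma_sets UNIV {U. open U}"
    by (simp add: sets_restrict_space borel_def)
  also have "\<dots> = sigma_sets S ((\<inter>) S ` {U. open U})"
    by (rule sigma_sets_Int) (use assms in \<open>auto simp: borel_def\<close>)
  also have "(\<inter>) S ` {U. open U} = {U. openin (top_of_set S) U}"
    by (auto simp: openin_open)
  finally show ?thesis by (simp add: sets_borel_of)
qed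

lemma borel_of_euclidean: "sets (borel_of euclidean) = sets borel"
  by (simp add: sets_borel_of borel_def)

lemma continuous_map_borel_measurable:
  fixes f :: "'a \<Rightarrow> real"
  assumes "continuous_map X euclideanreal f" shows "f \<in> borel_measurable (borel_of X)"
  using continuous_map_measurable[OF assms] measurable_cong_sets[OF refl borel_of_euclidean] by blast

text \<open>Presents d-space as a subspace of a function type, so that the type-class notions
  \<open>compact\<close>, \<open>continuous_on\<close> and \<open>borel\<close> become available for
  it.\<close>

lemma Euclidean_space_top_of_set: "Euclidean_space d = top_of_set (topspace (Euclidean_space d))"
  by (simp add: Euclidean_space_def euclidean_product_topology)

lemma closed_topspace_Euclidean_space: "closed (topspace (Euclidean_space d))"
  using closedin_Euclidean_space_iff by blast

lemma sets_borel_of_Euclidean_space: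
  "sets (borel_of (Euclidean_space d)) = sets (restrict_space borel (topspace (Euclidean_space d)))"
  by (metis Euclidean_space_top_of_set borel_closed closed_topspace_Euclidean_space sets_borel_of_top_of_set)

lemma measurable_borel_of_Euclidean_space:
  assumes "\<And>x i. x \<in> space M \<Longrightarrow> i \<ge> d \<Longrightarrow> f x i = 0"
    and "\<And>i. i < d \<Longrightarrow> (\<lambda>x. f x i) \<in> borel_measurable M"
  shows "f \<in> measurable M (borel_of (Euclidean_space d))"
proof -
  have "(\<lambda>x. f x i) \<in> borel_measurable M" for i
  proof (cases "i < d")
    case False
    then have "(\<lambda>x. f x i) \<in> borel_measurable M \<longleftrightarrow> (\<lambda>x. 0 :: real) \<in> borel_measurable M"
      using assms(1) by (intro measurable_cong) auto
    then show ?thesis by simp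
  qed (use assms in auto)
  then have "f \<in> borel_measurable M"
    by (rule measurable_coordinatewise_then_product)
  then have "f \<in> measurable M (restrict_space borel (topspace (Euclidean_space d)))"
    using assms(1) by (intro measurable_restrict_space2) (auto simp: topspace_Euclidean_space)
  then show ?thesis
    using measurable_cong_sets[OF refl sets_borel_of_Euclidean_space] by blast
qed

lemma coordinate_measurable:
  "(\<lambda>x. x i) \<in> borel_measurable (borel_of (Euclidean_space d))"
  unfolding measurable_cong_sets[OF sets_borel_of_Euclidean_space refl]
  by (intro measurable_restrict_space1 borel_measurable_continuous_onI continuous_on_product_coordinates)

lemma compactin_Euclidean_space:
  "compactin (Euclidean_space d) K \<longleftrightarrow> compact K \<and> K \<subseteq> topspace (Euclidean_space d)"
  using Euclidean_space_top_of_set[of d] compactin_subtopology[of euclidean "topspace (Euclidean_space d)" K]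
  by (metis compactin_euclidean_iff)

lemma continuous_map_Euclidean_space_iff:
  fixes f :: "_ \<Rightarrow> 'b::topological_space"
  shows "continuous_map (Euclidean_space d) euclidean f \<longleftrightarrow> continuous_on (topspace (Euclidean_space d)) f"
  by (metis Euclidean_space_top_of_set continuous_map_iff_continuous)

lemma compact_closed_ball: "compact (closed_ball d x r)"
proof -
  \<comment> \<open>The ball is a full product, with intervals in the first \<open>d\<close> factors
    and the single point 0 in all later ones, so Tychonoff's theorem applies.\<close>
  define S where "S i = (if i < d then {x i - r..x i + r} else {0})" for i
  have "compactin (product_topology (\<lambda>i. euclideanreal) UNIV) (PiE UNIV S)"
    by (auto simp: compactin_PiE S_def)
  then have "compact (PiE UNIV S)"
    by (simp add: euclidean_product_topology)
  moreover have "y \<in> closed_ball d x r \<longleftrightarrow> y \<in> PiE UNIV S" for y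
  proof -
    have "y i \<in> S i \<longleftrightarrow> (if i < d then \<bar>y i - x i\<bar> \<le> r else y i = 0)" for i
      by (auto simp: S_def)
    then have "y \<in> PiE UNIV S \<longleftrightarrow> (\<forall>i. if i < d then \<bar>y i - x i\<bar> \<le> r else y i = 0)"
      by (simp add: PiE_def Pi_def)
    also have "\<dots> \<longleftrightarrow> (\<forall>i\<ge>d. y i = 0) \<and> (\<forall>i<d. \<bar>y i - x i\<bar> \<le> r)"
      by (metis leD not_le_imp_less)
    finally show ?thesis
      by (simp add: closed_ball_def topspace_Euclidean_space)
  qed
  ultimately show ?thesis by (metis subsetI subset_antisym)
qed

lemma closed_ball_subset: "closed_ball d x r \<subseteq> topspace (Euclidean_space d)"
  by (auto simp: closed_ball_def)

lemma compactin_closed_ball: "compactin (Euclidean_space d) (closed_ball d x r)"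
  by (simp add: compactin_Euclidean_space compact_closed_ball closed_ball_subset)

lemma compactin_sets_borel_of:
  "Hausdorff_space X \<Longrightarrow> compactin X K \<Longrightarrow> K \<in> sets (borel_of X)"
  by (simp add: closedin_sets_borel_of compactin_imp_closedin)

lemma closed_ball_sets [measurable, simp]: "closed_ball d x r \<in> sets (borel_of (Euclidean_space d))"
  by (simp add: compactin_sets_borel_of Hausdorff_Euclidean_space compactin_closed_ball)

text \<open>A test function is bounded on a compact set of finite mass and vanishes
  elsewhere.\<close>

lemma compactly_supported_integrable:
  assumes "Hausdorff_space X" "\<mu> \<in> radon_measures X" "f \<in> compactly_supported X"
  shows "integrable \<mu> f"
proof -
  obtain K where K: "compactin X K" "\<And>x. x \<in> topspace X - K \<Longrightarrow> f x = 0"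
    and f: "continuous_map X euclideanreal f"
    using assms(3) by (auto simp: compactly_supported_def)
  have sets: "sets \<mu> = sets (borel_of X)" and fin: "emeasure \<mu> K < \<infinity>"
    using assms(2) K by (auto simp: radon_measures_def)
  have sp: "space \<mu> = topspace X" using sets_eq_imp_space_eq[OF sets] by simp
  have "compact (f ` K)" using image_compactin[OF K(1) f] by simp
  then obtain B where B: "\<And>x. x \<in> K \<Longrightarrow> norm (f x) \<le> B"
    using bounded_iff compact_imp_bounded by (metis imageI)
  show ?thesis
  proof (rule integrableI_bounded_set)
    show "K \<in> sets \<mu>" using sets K assms(1) compactin_sets_borel_of by auto
    show "f \<in> borel_measurable \<mu>"
      using continuous_map_borel_measurable[OF f] measurable_cong_sets[OF sets refl] by blast
    show "emeasure \<mu> K < \<infinity>" by fact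
    show "AE x in \<mu>. x \<in> K \<longrightarrow> norm (f x) \<le> B" using B by auto
    show "AE x in \<mu>. x \<notin> K \<longrightarrow> f x = 0" using K(2) sp by (intro AE_I2) auto
  qed
qed

section \<open>The weak topology and convergence in it\<close>

lemma topspace_weak_topology [simp]: "topspace (weak_topology X) = radon_measures X"
proof -
  \<comment> \<open>The zero test function with \<open>V = UNIV\<close> puts the whole space into
    the subbase.\<close>
  have "(\<lambda>_. 0) \<in> compactly_supported X"
    unfolding compactly_supported_def using compactin_empty[of X] by force
  then have "radon_measures X \<in> {{\<mu> \<in> radon_measures X. (\<integral>x. f x \<partial>\<mu>) \<in> V} | f V. f \<in> compactly_supported X \<and> open V}"
    by (intro CollectI exI[of _ "\<lambda>_. 0"] exI[of _ UNIV]) auto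
  then show ?thesis by (auto simp: weak_topology_def)
qed

text \<open>Reduces the later neighbourhood arguments (limits, countable base, joint continuity) to
  a single test function.\<close>

lemma openin_weak_topology_induct [consumes 1, case_names Basis Int UN]:
  assumes "openin (weak_topology X) U"
    and basis: "\<And>f V. f \<in> compactly_supported X \<Longrightarrow> open V \<Longrightarrow> P {\<mu> \<in> radon_measures X. (\<integral>x. f x \<partial>\<mu>) \<in> V}"
    and int: "\<And>A B. openin (weak_topology X) A \<Longrightarrow> openin (weak_topology X) B \<Longrightarrow> P A \<Longrightarrow> P B \<Longrightarrow> P (A \<inter> B)"
    and union: "\<And>\<K>. (\<And>K. K \<in> \<K> \<Longrightarrow> openin (weak_topology X) K) \<Longrightarrow> (\<And>K. K \<in> \<K> \<Longrightarrow> P K) \<Longrightarrow> P (\<Union>\<K>)"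
  shows "P U"
proof -
  have "generate_topology_on {{\<mu> \<in> radon_measures X. (\<integral>x. f x \<partial>\<mu>) \<in> V} | f V. f \<in> compactly_supported X \<and> open V} U"
    using assms(1) by (simp add: weak_topology_def openin_topology_generated_by_iff)
  then show ?thesis
  proof (induction rule: generate_topology_on.induct)
    case Empty show ?case using union[of "{}"] by simp
  next
    case (Int a b) then show ?case
      by (intro int) (simp_all add: weak_topology_def openin_topology_generated_by_iff)
  next
    case (UN K) then show ?case
      by (intro union) (simp_all add: weak_topology_def openin_topology_generated_by_iff)
  next
    case (Basis s) then show ?case using basis by blast
  qed
qed

lemma openin_weak_topology_basis:
  assumes "f \<in> compactly_supported X" "open V"
  shows "openin (weak_topology X) {\<mu> \<in> radon_measures X. (\<integral>x. f x \<partial>\<mu>) \<in> V}"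
  unfolding weak_topology_def using assms by (intro topology_generated_by_Basis) blast

lemma continuous_map_weak_integral:
  assumes "f \<in> compactly_supported X"
  shows "continuous_map (weak_topology X) euclideanreal (\<lambda>\<mu>. \<integral>x. f x \<partial>\<mu>)"
  unfolding continuous_map_def using openin_weak_topology_basis[OF assms] by auto

text \<open>On a subbasic set the claim is convergence of one integral; eventual membership passes
  to binary intersections and to unions.\<close>

lemma limitin_prob_topologyI:
  assumes l: "l \<in> radon_measures X" "prob_space l"
    and m: "eventually (\<lambda>t. m t \<in> radon_measures X \<and> prob_space (m t)) F"
    and lim: "\<And>f. f \<in> compactly_supported X \<Longrightarrow> ((\<lambda>t. \<integral>x. f x \<partial>m t) \<longlongrightarrow> (\<integral>x. f x \<partial>l)) F"
  shows "limitin (prob_topology X) m l F"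
proof -
  have *: "l \<in> U \<Longrightarrow> \<forall>\<^sub>F t in F. m t \<in> U" if "openin (weak_topology X) U" for U
    using that
  proof (induction rule: openin_weak_topology_induct)
    case (Basis f V)
    have "\<forall>\<^sub>F t in F. (\<integral>x. f x \<partial>m t) \<in> V"
      using topological_tendstoD[OF lim[OF Basis(1)] Basis(2)] Basis(3) by simp
    with m show ?case by eventually_elim auto
  next
    case (Int A B) then show ?case by (auto intro: eventually_conj)
  next
    case (UN \<K>)
    then obtain K where "K \<in> \<K>" "l \<in> K" by auto
    then have "\<forall>\<^sub>F t in F. m t \<in> K" using UN by auto
    then show ?case by eventually_elim (use \<open>K \<in> \<K>\<close> in auto)
  qed
  show ?thesis
    unfolding limitin_def prob_topology_def
  proof (intro conjI allI impI)
    fix U assume "openin (subtopology (weak_topology X) {\<mu>. prob_space \<mu>}) U \<and> l \<in> U"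
    then obtain W where W: "openin (weak_topology X) W" "U = W \<inter> {\<mu>. prob_space \<mu>}" "l \<in> U"
      by (auto simp: openin_subtopology)
    show "\<forall>\<^sub>F t in F. m t \<in> U"
      using *[OF W(1)] m W by (auto elim: eventually_elim2)
  qed (use l in auto)
qed

section \<open>Measurability into the space of probability measures on a compact set\<close>

text \<open>
  The Borel sets of a weak topology are generated by all its open sets, not just by the subbasic ones.
  A countable dense set of test functions makes the topology on the probability measures second
  countable, which closes the gap.
\<close>

datatype poly_expr =
  Rat rat | Coord nat | Plus poly_expr poly_expr | Times poly_expr poly_expr

instance poly_expr :: countable
  by countable_datatype

text \<open>Rational polynomials are kept as syntax because the datatype is countable.\<close>

primrec poly_eval :: "poly_expr \<Rightarrow> (nat \<Rightarrow> real) \<Rightarrow> real" where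
  "poly_eval (Rat c) x = of_rat c"
| "poly_eval (Coord i) x = x i"
| "poly_eval (Plus p q) x = poly_eval p x + poly_eval q x"
| "poly_eval (Times p q) x = poly_eval p x * poly_eval q x"

lemma continuous_on_poly_eval: "continuous_on S (poly_eval p)"
proof (induction p)
  case (Coord i)
  then show ?case
    by (simp add: continuous_on_subset[OF continuous_on_product_coordinates])
qed (auto intro!: continuous_intros)

text \<open>Rational polynomials are not closed under real scalars, so Stone-Weierstrass is applied
  to the class \<open>P\<close> of continuous functions that they approximate uniformly. This class
  is an algebra containing the real constants and the coordinates, and approximating twice costs
  nothing.\<close>

lemma poly_expr_dense:
  assumes K: "compact K" and "continuous_on K f" "0 < e"
  shows "\<exists>p. \<forall>x\<in>K. \<bar>f x - poly_eval p x\<bar> < e"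
proof -
  define P where "P f \<longleftrightarrow> continuous_on K f \<and> (\<forall>e>0. \<exists>p. \<forall>x\<in>K. \<bar>f x - poly_eval p x\<bar> < e)" for f
  have poly: "P (poly_eval p)" for p
    unfolding P_def using continuous_on_poly_eval by (intro conjI allI impI exI[of _ p]) auto
  have "\<exists>g. P g \<and> (\<forall>x\<in>K. \<bar>f x - g x\<bar> < e/2)"
  proof (rule Stone_Weierstrass_HOL[OF K])
    fix c :: real
    have "\<exists>p. \<forall>x\<in>K. \<bar>c - poly_eval p x\<bar> < e" if "e > 0" for e
    proof -
      have "c - e < c" using that by simp
      from of_rat_dense[OF this] obtain r where "c - e < of_rat r" "of_rat r < c"
        by blast
      then show ?thesis by (intro exI[of _ "Rat r"]) auto
    qed
    then show "P (\<lambda>x. c)" by (simp add: P_def)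
  next
    fix f g assume "P f \<and> P g"
    then have f: "P f" and g: "P g" by auto
    have "\<exists>p. \<forall>x\<in>K. \<bar>f x + g x - poly_eval p x\<bar> < e" if "e > 0" for e
    proof -
      have "e/2 > 0" using that by simp
      then obtain p q where "\<forall>x\<in>K. \<bar>f x - poly_eval p x\<bar> < e/2" "\<forall>x\<in>K. \<bar>g x - poly_eval q x\<bar> < e/2"
        using f g unfolding P_def by meson
      then have close: "\<bar>f x - poly_eval p x\<bar> < e/2" "\<bar>g x - poly_eval q x\<bar> < e/2" if "x \<in> K" for x
        using that by auto
      have "\<bar>f x + g x - poly_eval (Plus p q) x\<bar> < e" if "x \<in> K" for x
        using close[OF that] by (simp, linarith)
      then show ?thesis by blast
    qed
    then show "P (\<lambda>x. f x + g x)" using f g by (auto simp: P_def intro: continuous_intros)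
    have "bounded (f ` K)" "bounded (g ` K)"
      using f g K by (auto simp: P_def intro!: compact_imp_bounded compact_continuous_image)
    then obtain B1 B2 where "\<forall>x\<in>K. \<bar>f x\<bar> \<le> B1" "\<forall>x\<in>K. \<bar>g x\<bar> \<le> B2"
      unfolding bounded_iff by (metis imageI real_norm_def)
    then obtain B where B: "\<And>x. x \<in> K \<Longrightarrow> \<bar>f x\<bar> \<le> B" "\<And>x. x \<in> K \<Longrightarrow> \<bar>g x\<bar> \<le> B" "B \<ge> 0"
      by (metis abs_ge_zero max.coboundedI1 max.coboundedI2 max.cobounded2)
    have "\<exists>p. \<forall>x\<in>K. \<bar>f x * g x - poly_eval p x\<bar> < e" if "e > 0" for e
    proof -
      \<comment> \<open>The product error is at most \<open>(2 * B + 1) * \<delta>\<close>; the cap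
        1 is what bounds \<open>poly_eval q x\<close> by \<open>B + 1\<close>.\<close>
      define \<delta> where "\<delta> = min 1 (e / (2 * (2 * B + 1)))"
      have \<delta>: "0 < \<delta>" "\<delta> \<le> 1" "(2 * B + 1) * \<delta> \<le> e/2"
      proof -
        have "(2 * B + 1) * \<delta> \<le> (2 * B + 1) * (e / (2 * (2 * B + 1)))"
          using B(3) by (intro mult_left_mono) (auto simp: \<delta>_def)
        also have "\<dots> = e/2" using B(3) by (simp add: field_simps)
        finally show "(2 * B + 1) * \<delta> \<le> e/2" .
      qed (use that B(3) in \<open>auto simp: \<delta>_def\<close>)
      obtain p q where pq: "\<forall>x\<in>K. \<bar>f x - poly_eval p x\<bar> < \<delta>" "\<forall>x\<in>K. \<bar>g x - poly_eval q x\<bar> < \<delta>"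
        using f g \<delta>(1) unfolding P_def by meson
      have "\<bar>f x * g x - poly_eval (Times p q) x\<bar> < e" if x: "x \<in> K" for x
      proof -
        have "f x * g x - poly_eval (Times p q) x
            = f x * (g x - poly_eval q x) + poly_eval q x * (f x - poly_eval p x)"
          by (simp add: algebra_simps)
        also have "\<bar>\<dots>\<bar> \<le> \<bar>f x\<bar> * \<bar>g x - poly_eval q x\<bar> + \<bar>poly_eval q x\<bar> * \<bar>f x - poly_eval p x\<bar>"
          by (metis abs_mult abs_triangle_ineq)
        also have "\<dots> \<le> B * \<delta> + (B + 1) * \<delta>"
        proof (intro add_mono mult_mono)
          have *: "\<bar>f x - poly_eval p x\<bar> < \<delta>" "\<bar>g x - poly_eval q x\<bar> < \<delta>" "\<bar>g x\<bar> \<le> B"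
            using pq x B by auto
          then show "\<bar>g x - poly_eval q x\<bar> \<le> \<delta>" "\<bar>f x - poly_eval p x\<bar> \<le> \<delta>" by auto
          show "\<bar>poly_eval q x\<bar> \<le> B + 1" using * \<delta> by linarith
        qed (use B x in auto)
        also have "\<dots> = (2 * B + 1) * \<delta>" by (simp add: algebra_simps)
        finally show ?thesis using \<delta>(3) \<open>e > 0\<close> by linarith
      qed
      then show ?thesis by blast
    qed
    then show "P (\<lambda>x. f x * g x)" using f g by (auto simp: P_def intro: continuous_intros)
  next
    fix x y :: "nat \<Rightarrow> real" assume "x \<in> K \<and> y \<in> K \<and> x \<noteq> y"
    then obtain i where "x i \<noteq> y i" by auto
    then show "\<exists>f. P f \<and> f x \<noteq> f y"
      using poly[of "Coord i"] by (intro exI[of _ "poly_eval (Coord i)"]) auto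
  qed (use assms in \<open>auto simp: P_def\<close>)
  then obtain g p where "\<forall>x\<in>K. \<bar>f x - g x\<bar> < e/2" "\<forall>x\<in>K. \<bar>g x - poly_eval p x\<bar> < e/2"
    unfolding P_def using \<open>0 < e\<close> by (meson half_gt_zero)
  then have close: "\<bar>f x - g x\<bar> < e/2" "\<bar>g x - poly_eval p x\<bar> < e/2" if "x \<in> K" for x
    using that by auto
  have "\<bar>f x - poly_eval p x\<bar> < e" if "x \<in> K" for x
    using close[OF that] by linarith
  then show ?thesis by blast
qed

lemma compactly_supported_compact:
  fixes f :: "'a::topological_space \<Rightarrow> real"
  assumes "compact K"
  shows "f \<in> compactly_supported (top_of_set K) \<longleftrightarrow> continuous_on K f"
proof -
  have "compactin (top_of_set K) K" using assms by (simp add: compactin_subtopology)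
  then have "\<exists>C. compactin (top_of_set K) C \<and> (\<forall>x \<in> topspace (top_of_set K) - C. f x = 0)"
    by (intro exI[of _ K]) auto
  then show ?thesis by (simp add: compactly_supported_def)
qed

lemma prob_space_integral_close:
  assumes "prob_space M" "integrable M f" "integrable M g" "\<And>x. x \<in> space M \<Longrightarrow> \<bar>f x - g x\<bar> \<le> (e::real)"
  shows "\<bar>(\<integral>x. f x \<partial>M) - (\<integral>x. g x \<partial>M)\<bar> \<le> e"
proof -
  interpret prob_space M by fact
  have fg: "integrable M (\<lambda>x. f x - g x)" using assms by simp
  have "(\<integral>x. f x - g x \<partial>M) \<le> e"
    using assms(4) by (intro integral_le_const[OF fg] AE_I2) (simp add: abs_le_iff)
  moreover have "(\<integral>x. f x - g x \<partial>M) \<ge> - e"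
    using assms(4) by (intro integral_ge_const[OF fg] AE_I2) (smt (verit) abs_le_iff)
  moreover have "(\<integral>x. f x - g x \<partial>M) = (\<integral>x. f x \<partial>M) - (\<integral>x. g x \<partial>M)"
    using assms by simp
  ultimately show ?thesis by linarith
qed

text \<open>Every open set is a countable union of the sets \<open>B L\<close>, whose preimages are
  cut out by finitely many integral conditions. Compactness of \<open>K\<close> makes every
  continuous function on it a test function.\<close>

lemma measurable_prob_topologyI:
  fixes K :: "(nat \<Rightarrow> real) set"
  assumes K: "compact K"
    and F: "\<And>x. x \<in> space M \<Longrightarrow> F x \<in> radon_measures (top_of_set K)" "\<And>x. x \<in> space M \<Longrightarrow> prob_space (F x)"
    and meas: "\<And>f :: _ \<Rightarrow> real. continuous_on K f \<Longrightarrow> (\<lambda>x. \<integral>y. f y \<partial>F x) \<in> borel_measurable M"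
  shows "F \<in> measurable M (borel_of (prob_topology (top_of_set K)))"
proof (rule measurable_borel_ofI)
  show "F x \<in> topspace (prob_topology (top_of_set K))" if "x \<in> space M" for x
    using F that by (simp add: prob_topology_def)
  \<comment> \<open>A basic set imposes finitely many strict rational bounds on integrals of
    rational polynomials; the lists describing them form a countable type.\<close>
  define B where "B L = {\<mu> \<in> radon_measures (top_of_set K). prob_space \<mu> \<and>
      (\<forall>(p, a, b) \<in> set L. (\<integral>x. poly_eval p x \<partial>\<mu>) \<in> {of_rat a <..< of_rat b})}"
    for L :: "(poly_expr \<times> rat \<times> rat) list"
  have int: "integrable \<nu> f" if "\<nu> \<in> radon_measures (top_of_set K)" "continuous_on K f" for \<nu> and f :: "_ \<Rightarrow> real"
    using that K by (intro compactly_supported_integrable[of "top_of_set K"])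
      (auto simp: compactly_supported_compact Hausdorff_space_subtopology)
  have base: "\<mu> \<in> U \<Longrightarrow> prob_space \<mu> \<Longrightarrow> \<exists>L. \<mu> \<in> B L \<and> B L \<subseteq> U"
    if "openin (weak_topology (top_of_set K)) U" for U \<mu>
    using that
  proof (induction rule: openin_weak_topology_induct)
    case (Basis f V)
    then have f: "continuous_on K f" and \<mu>: "\<mu> \<in> radon_measures (top_of_set K)"
      and "(\<integral>x. f x \<partial>\<mu>) \<in> V"
      using K by (auto simp: compactly_supported_compact)
    then obtain e where e: "e > 0" "ball (\<integral>x. f x \<partial>\<mu>) e \<subseteq> V"
      using Basis(2) openE by blast
    obtain p where p: "\<forall>x\<in>K. \<bar>f x - poly_eval p x\<bar> < e/4"
      using poly_expr_dense[OF K f, of "e/4"] e by auto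
    have close: "\<bar>(\<integral>x. f x \<partial>\<nu>) - (\<integral>x. poly_eval p x \<partial>\<nu>)\<bar> \<le> e/4"
      if \<nu>: "\<nu> \<in> radon_measures (top_of_set K)" "prob_space \<nu>" for \<nu>
    proof -
      have "space \<nu> = K"
        using \<nu> sets_eq_imp_space_eq[of \<nu> "borel_of (top_of_set K)"] by (auto simp: radon_measures_def)
      then show ?thesis using \<nu> f p
        by (intro prob_space_integral_close int continuous_on_poly_eval) (auto intro: less_imp_le)
    qed
    let ?I = "\<integral>x. poly_eval p x \<partial>\<mu>"
    \<comment> \<open>Replacing \<open>f\<close> by \<open>p\<close> costs e/4 under each of the two
      measures, and the rational window keeps the integrals of \<open>p\<close> within e/4 of each
      other: less than e in total.\<close>
    have I: "?I - e/4 < ?I" "?I < ?I + e/4" using e by auto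
    from of_rat_dense[OF I(1)] obtain a where a: "?I - e/4 < of_rat a" "of_rat a < ?I" by blast
    from of_rat_dense[OF I(2)] obtain b where b: "?I < of_rat b" "of_rat b < ?I + e/4" by blast
    have "(\<integral>x. f x \<partial>\<nu>) \<in> V" if \<nu>: "\<nu> \<in> B [(p, a, b)]" for \<nu>
    proof -
      have "\<bar>(\<integral>x. f x \<partial>\<nu>) - (\<integral>x. poly_eval p x \<partial>\<nu>)\<bar> \<le> e/4"
        "of_rat a < (\<integral>x. poly_eval p x \<partial>\<nu>)" "(\<integral>x. poly_eval p x \<partial>\<nu>) < of_rat b"
        using close \<nu> by (auto simp: B_def)
      then have "\<bar>(\<integral>x. f x \<partial>\<nu>) - (\<integral>x. f x \<partial>\<mu>)\<bar> < e"
        using close[OF \<mu> Basis(4)] a b e(1) by linarith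
      then show ?thesis using e(2) by (auto simp: dist_real_def abs_minus_commute)
    qed
    then show ?case using \<mu> Basis(4) a b
      by (intro exI[of _ "[(p, a, b)]"]) (auto simp: B_def)
  next
    case (Int U V)
    then obtain L1 L2 where "\<mu> \<in> B L1" "B L1 \<subseteq> U" "\<mu> \<in> B L2" "B L2 \<subseteq> V" by blast
    moreover have "B (L1 @ L2) = B L1 \<inter> B L2" by (auto simp: B_def ball_Un)
    ultimately show ?case by (intro exI[of _ "L1 @ L2"]) auto
  next
    case (UN \<K>) then show ?case by (meson UnionE Union_upper subset_trans)
  qed
  fix U assume "openin (prob_topology (top_of_set K)) U"
  then obtain W where W: "openin (weak_topology (top_of_set K)) W" "U = W \<inter> {\<mu>. prob_space \<mu>}"
    by (auto simp: prob_topology_def openin_subtopology)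
  have "F -` U \<inter> space M = (\<Union>L\<in>{L. B L \<subseteq> U}. F -` B L \<inter> space M)"
  proof (intro equalityI subsetI)
    fix x assume x: "x \<in> F -` U \<inter> space M"
    then obtain L where "F x \<in> B L" "B L \<subseteq> W" using base[OF W(1), of "F x"] W(2) by auto
    then show "x \<in> (\<Union>L\<in>{L. B L \<subseteq> U}. F -` B L \<inter> space M)"
      using W(2) x by (auto simp: B_def)
  qed auto
  also have "\<dots> \<in> sets M"
  proof (intro sets.countable_UN'' countableI_type)
    fix L
    have "F -` B L \<inter> space M = {x \<in> space M. \<forall>c \<in> set L.
        of_rat (fst (snd c)) < (\<integral>y. poly_eval (fst c) y \<partial>F x) \<and> (\<integral>y. poly_eval (fst c) y \<partial>F x) < of_rat (snd (snd c))}"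
      using F by (auto simp: B_def split_beta)
    also have "\<dots> \<in> sets M"
      using meas[OF continuous_on_poly_eval] by measurable
    finally show "F -` B L \<inter> space M \<in> sets M" .
  qed
  finally show "F -` U \<inter> space M \<in> sets M" .
qed

section \<open>Radon measures and compactly supported functions\<close>

lemma continuous_on_coordinate [continuous_intros]: "continuous_on S (\<lambda>x::nat \<Rightarrow> real. x i)"
  by (rule continuous_on_subset[OF continuous_on_product_coordinates]) simp

text \<open>A continuous bump: 1 on the ball of radius \<open>R\<close> and 0 in d-space outside
  radius \<open>R + 1\<close>. The sum avoids a maximum over a possibly empty set of
  coordinates.\<close>

definition cutoff :: "nat \<Rightarrow> real \<Rightarrow> (nat \<Rightarrow> real) \<Rightarrow> real" where
  "cutoff d R x = max 0 (1 - (\<Sum>i<d. max 0 (\<bar>x i\<bar> - R)))"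

lemma continuous_on_cutoff [continuous_intros]: "continuous_on S (cutoff d R)"
  unfolding cutoff_def by (intro continuous_intros)

lemma cutoff_nonneg: "cutoff d R x \<ge> 0"
  by (simp add: cutoff_def)

lemma cutoff_eq_1: "x \<in> closed_ball d origin R \<Longrightarrow> cutoff d R x = 1"
  by (simp add: cutoff_def closed_ball_def)

lemma cutoff_eq_0:
  assumes "x \<in> topspace (Euclidean_space d) - closed_ball d origin (R + 1)"
  shows "cutoff d R x = 0"
proof -
  obtain j where j: "j < d" "\<bar>x j\<bar> > R + 1"
    using assms by (auto simp: closed_ball_def)
  have "max 0 (\<bar>x j\<bar> - R) \<le> (\<Sum>i<d. max 0 (\<bar>x i\<bar> - R))"
    using j by (intro member_le_sum) auto
  then show ?thesis using j by (simp add: cutoff_def)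
qed

lemma compactly_supported_Euclidean_spaceI:
  assumes "continuous_on (topspace (Euclidean_space d)) f"
    and "\<And>x. x \<in> topspace (Euclidean_space d) - closed_ball d origin R \<Longrightarrow> f x = 0"
  shows "f \<in> compactly_supported (Euclidean_space d)"
  unfolding compactly_supported_def
  using assms compactin_closed_ball[of d origin R] continuous_map_Euclidean_space_iff by blast

lemma bounded_in_closed_ball:
  assumes "compact C" "C \<subseteq> topspace (Euclidean_space d)"
  shows "\<exists>R. C \<subseteq> closed_ball d origin R"
proof -
  have "compact ((\<lambda>x. \<Sum>i<d. \<bar>x i\<bar>) ` C)"
    by (intro compact_continuous_image assms(1) continuous_intros)
  then have "bounded ((\<lambda>x. \<Sum>i<d. \<bar>x i\<bar>) ` C)"
    by (rule compact_imp_bounded)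
  then obtain R where R: "\<And>x. x \<in> C \<Longrightarrow> norm (\<Sum>i<d. \<bar>x i\<bar>) \<le> R"
    unfolding bounded_iff by blast
  have "\<bar>x i\<bar> \<le> R" if "x \<in> C" "i < d" for x i
  proof -
    have "\<bar>x i\<bar> \<le> (\<Sum>i<d. \<bar>x i\<bar>)" using that by (intro member_le_sum) auto
    then show ?thesis using R[OF that(1)] by (simp add: sum_nonneg)
  qed
  then show ?thesis using assms(2) by (intro exI[of _ R]) (auto simp: closed_ball_def)
qed

lemma Union_closed_ball: "(\<Union>n. closed_ball d origin (real n)) = topspace (Euclidean_space d)"
proof -
  have "\<exists>n. x \<in> closed_ball d origin (real n)" if x: "x \<in> topspace (Euclidean_space d)" for x
  proof -
    obtain R where R: "x \<in> closed_ball d origin R"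
      using bounded_in_closed_ball[of "{x}" d] x by auto
    obtain n where "R \<le> real n" using real_arch_simple by blast
    then show ?thesis using R by (intro exI[of _ n]) (force simp: closed_ball_def)
  qed
  then show ?thesis by (auto simp: closed_ball_def)
qed

text \<open>Clamped distances to \<open>C\<close> decrease to its indicator, and a cutoff that
  equals 1 on \<open>C\<close> gives them compact support. The bound by \<open>\<phi> 0\<close>
  later serves dominated convergence.\<close>

lemma compact_indicator_limit:
  assumes "compact C" "C \<subseteq> closed_ball d origin (R0 - 1)"
  shows "\<exists>\<phi> :: nat \<Rightarrow> _ \<Rightarrow> real. \<forall>n. (continuous_on UNIV (\<phi> n) \<and> (\<forall>x. 0 \<le> \<phi> n x \<and> \<phi> n x \<le> \<phi> 0 x)) \<and>
      (\<forall>x \<in> topspace (Euclidean_space d) - closed_ball d origin R0. \<phi> n x = 0) \<and>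
      (\<forall>x. (\<lambda>n. \<phi> n x) \<longlonglongrightarrow> indicator C x)"
\<comment> \<open>The distance to the empty set is 0 by convention, so the functions below would not
  tend to its indicator.\<close>
proof (cases "C = {}")
  case True then show ?thesis by (intro exI[of _ "\<lambda>_ _. 0"]) auto
next
  case False
  define \<phi> where "\<phi> n x = max 0 (1 - real n * infdist x C) * cutoff d (R0 - 1) x" for n x
  have lim: "(\<lambda>n. \<phi> n x) \<longlonglongrightarrow> indicator C x" for x
  proof (cases "x \<in> C")
    case True
    then show ?thesis using assms(2) by (auto simp: \<phi>_def cutoff_eq_1)
  next
    case False
    have pos: "infdist x C > 0"
      using False \<open>C \<noteq> {}\<close> assms(1) by (simp add: infdist_pos_not_in_closed compact_imp_closed)
    then obtain N where "real N * infdist x C > 1" using reals_Archimedean3 by blast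
    then have "\<phi> n x = 0" if "n \<ge> N" for n
    proof -
      have "real N * infdist x C \<le> real n * infdist x C" using that pos by simp
      with \<open>real N * infdist x C > 1\<close> show ?thesis by (simp add: \<phi>_def)
    qed
    then have "\<forall>\<^sub>F n in sequentially. \<phi> n x = 0" using eventually_sequentially by blast
    then show ?thesis using False by (simp add: tendsto_eventually)
  qed
  have "continuous_on UNIV (\<phi> n)" for n
    unfolding \<phi>_def by (intro continuous_intros)
  moreover have "0 \<le> \<phi> n x \<and> \<phi> n x \<le> \<phi> 0 x" for n x
    using infdist_nonneg[of x C] cutoff_nonneg[of d "R0 - 1" x]
    by (auto simp: \<phi>_def max_def intro!: mult_left_le_one_le)
  moreover have "\<phi> n x = 0" if "x \<in> topspace (Euclidean_space d) - closed_ball d origin R0" for n x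
    using cutoff_eq_0[of x d "R0 - 1"] that by (simp add: \<phi>_def)
  ultimately show ?thesis using lim by (intro exI[of _ \<phi>]) auto
qed

lemma radon_sets: "\<mu> \<in> radon_measures X \<Longrightarrow> sets \<mu> = sets (borel_of X)"
  by (simp add: radon_measures_def)

lemma radon_space: "\<mu> \<in> radon_measures X \<Longrightarrow> space \<mu> = topspace X"
  using sets_eq_imp_space_eq[of \<mu> "borel_of X"] by (simp add: radon_measures_def)

lemma radon_compact_finite: "\<mu> \<in> radon_measures X \<Longrightarrow> compactin X K \<Longrightarrow> emeasure \<mu> K < \<infinity>"
  by (simp add: radon_measures_def)

text \<open>The approximating test functions depend on \<open>C\<close> and \<open>g\<close> only.
  One sequence thus serves all Radon measures, which yields both measurability in the measure and
  uniqueness.\<close>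

lemma integral_over_compact_limit:
  fixes g :: "_ \<Rightarrow> real"
  assumes C: "compact C" "C \<subseteq> topspace (Euclidean_space d)"
    and g: "continuous_on (topspace (Euclidean_space d)) g"
  shows "\<exists>\<psi>. (\<forall>n::nat. \<psi> n \<in> compactly_supported (Euclidean_space d)) \<and>
      (\<forall>\<mu> \<in> radon_measures (Euclidean_space d). (\<lambda>n. \<integral>x. \<psi> n x \<partial>\<mu>) \<longlonglongrightarrow> (\<integral>x. indicator C x * g x \<partial>\<mu>))"
proof -
  obtain R where R: "C \<subseteq> closed_ball d origin R" using bounded_in_closed_ball[OF C] by blast
  have "C \<subseteq> closed_ball d origin (R + 1 - 1)" using R by simp
  from compact_indicator_limit[OF C(1) this] obtain \<phi> :: "nat \<Rightarrow> _ \<Rightarrow> real" where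
    *: "\<forall>n::nat. (continuous_on UNIV (\<phi> n) \<and> (\<forall>x. 0 \<le> \<phi> n x \<and> \<phi> n x \<le> \<phi> 0 x)) \<and>
      (\<forall>x \<in> topspace (Euclidean_space d) - closed_ball d origin (R + 1). \<phi> n x = 0) \<and>
      (\<forall>x. (\<lambda>n. \<phi> n x) \<longlonglongrightarrow> indicator C x)" by (elim exE)
  then have \<phi>: "continuous_on UNIV (\<phi> n)" "\<And>x. 0 \<le> \<phi> n x" "\<And>x. \<phi> n x \<le> \<phi> 0 x"
      "\<And>x. x \<in> topspace (Euclidean_space d) - closed_ball d origin (R + 1) \<Longrightarrow> \<phi> n x = 0"
      "\<And>x. (\<lambda>n. \<phi> n x) \<longlonglongrightarrow> indicator C x" for n
    by simp_all
  have cs: "(\<lambda>x. \<phi> n x * h x) \<in> compactly_supported (Euclidean_space d)"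
    if "continuous_on (topspace (Euclidean_space d)) h" for n and h :: "_ \<Rightarrow> real"
    using \<phi>(4) that by (intro compactly_supported_Euclidean_spaceI[of _ _ "R + 1"] continuous_intros
        continuous_on_subset[OF \<phi>(1)]) auto
  have "(\<lambda>n. \<integral>x. \<phi> n x * g x \<partial>\<mu>) \<longlonglongrightarrow> (\<integral>x. indicator C x * g x \<partial>\<mu>)"
    if \<mu>: "\<mu> \<in> radon_measures (Euclidean_space d)" for \<mu>
  proof (rule integral_dominated_convergence)
    have int: "integrable \<mu> (\<lambda>x. \<phi> n x * h x)"
      if "continuous_on (topspace (Euclidean_space d)) h" for n and h :: "_ \<Rightarrow> real"
      using compactly_supported_integrable[OF Hausdorff_Euclidean_space \<mu> cs[OF that]] .
    show "integrable \<mu> (\<lambda>x. \<phi> 0 x * \<bar>g x\<bar>)" using g by (intro int continuous_intros)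
    show "(\<lambda>x. \<phi> n x * g x) \<in> borel_measurable \<mu>" for n
      using int[OF g] by (rule borel_measurable_integrable)
    show "(\<lambda>x. indicator C x * g x) \<in> borel_measurable \<mu>"
    proof (rule borel_measurable_times)
      show "(indicator C :: _ \<Rightarrow> real) \<in> borel_measurable \<mu>"
        using C radon_sets[OF \<mu>] by (intro borel_measurable_indicator)
          (simp add: compactin_sets_borel_of[OF Hausdorff_Euclidean_space] compactin_Euclidean_space)
      show "g \<in> borel_measurable \<mu>"
        unfolding measurable_cong_sets[OF radon_sets[OF \<mu>] refl]
        by (intro continuous_map_borel_measurable) (simp add: continuous_map_Euclidean_space_iff g)
    qed
    show "AE x in \<mu>. (\<lambda>n. \<phi> n x * g x) \<longlonglongrightarrow> indicator C x * g x"
      by (intro AE_I2 tendsto_intros \<phi>(5))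
    show "AE x in \<mu>. norm (\<phi> n x * g x) \<le> \<phi> 0 x * \<bar>g x\<bar>" for n
      using \<phi>(2,3) by (intro AE_I2) (simp add: abs_mult mult_right_mono)
  qed
  then show ?thesis using cs[OF g] by (intro exI[of _ "\<lambda>n x. \<phi> n x * g x"]) blast
qed

lemma topspace_star_topology [simp]: "topspace (star_topology d) = star_measures d"
  by (auto simp: star_topology_def star_measures_def)

lemma measurable_star_integral_compactly_supported:
  assumes "f \<in> compactly_supported (Euclidean_space d)"
  shows "(\<lambda>\<mu>. \<integral>x. f x \<partial>\<mu>) \<in> borel_measurable (borel_of (star_topology d))"
  unfolding star_topology_def
  by (intro continuous_map_borel_measurable continuous_map_from_subtopology continuous_map_weak_integral assms)

text \<open>Integration over a compact set is in general not weakly continuous, but it is a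
  pointwise limit of continuous functionals.\<close>

lemma measurable_star_integral_compact:
  fixes g :: "_ \<Rightarrow> real"
  assumes "compact C" "C \<subseteq> topspace (Euclidean_space d)"
    and "continuous_on (topspace (Euclidean_space d)) g"
  shows "(\<lambda>\<mu>. \<integral>x. indicator C x * g x \<partial>\<mu>) \<in> borel_measurable (borel_of (star_topology d))"
proof -
  obtain \<psi> where \<psi>: "\<And>n::nat. \<psi> n \<in> compactly_supported (Euclidean_space d)"
    "\<And>\<mu>. \<mu> \<in> radon_measures (Euclidean_space d) \<Longrightarrow>
        (\<lambda>n. \<integral>x. \<psi> n x \<partial>\<mu>) \<longlonglongrightarrow> (\<integral>x. indicator C x * g x \<partial>\<mu>)"
    using integral_over_compact_limit[OF assms] by blast
  show ?thesis
  proof (rule borel_measurable_LIMSEQ_real)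
    show "(\<lambda>n. \<integral>x. \<psi> n x \<partial>\<mu>) \<longlonglongrightarrow> (\<integral>x. indicator C x * g x \<partial>\<mu>)"
      if "\<mu> \<in> space (borel_of (star_topology d))" for \<mu>
      using that by (intro \<psi>(2)) (simp add: star_measures_def)
  qed (intro measurable_star_integral_compactly_supported \<psi>(1))
qed

text \<open>Compact sets are stable under intersection and generate the Borel sets, since a closed
  set is a countable union of compact pieces; their masses are limits of integrals of test
  functions.\<close>

lemma radon_measure_eqI:
  assumes \<mu>: "\<mu> \<in> radon_measures (Euclidean_space d)" and \<nu>: "\<nu> \<in> radon_measures (Euclidean_space d)"
    and eq: "\<And>f. f \<in> compactly_supported (Euclidean_space d) \<Longrightarrow> (\<integral>x. f x \<partial>\<mu>) = (\<integral>x. f x \<partial>\<nu>)"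
  shows "\<mu> = \<nu>"
proof (rule measure_eqI_generator_eq[where E="{C. compactin (Euclidean_space d) C}"
      and \<Omega>="topspace (Euclidean_space d)" and A="\<lambda>n. closed_ball d origin (real n)"])
  let ?S = "sigma_sets (topspace (Euclidean_space d)) {C. compactin (Euclidean_space d) C}"
  have gen: "sets (borel_of (Euclidean_space d)) = ?S"
  proof
    have "U \<in> ?S" if U: "openin (Euclidean_space d) U" for U
    proof -
      let ?F = "topspace (Euclidean_space d) - U"
      have F: "closedin (Euclidean_space d) ?F" using U by blast
      have "?F \<inter> closed_ball d origin (real n) \<in> ?S" for n
        using closed_Int_compactin[OF F compactin_closed_ball] by auto
      then have "(\<Union>n. ?F \<inter> closed_ball d origin (real n)) \<in> ?S" by (rule sigma_sets.Union)
      moreover have "(\<Union>n. ?F \<inter> closed_ball d origin (real n)) = ?F"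
        using Union_closed_ball[of d] by blast
      ultimately have "topspace (Euclidean_space d) - ?F \<in> ?S" by (metis sigma_sets.Compl)
      then show ?thesis using openin_subset[OF U] by (simp add: double_diff)
    qed
    then show "sets (borel_of (Euclidean_space d)) \<subseteq> ?S"
      unfolding sets_borel_of by (intro sigma_sets_mono) auto
    show "?S \<subseteq> sets (borel_of (Euclidean_space d))"
      using compactin_sets_borel_of[OF Hausdorff_Euclidean_space]
      by (intro sets.sigma_sets_subset') (auto simp: sets.top[of "borel_of (Euclidean_space d)", simplified])
  qed
  show "sets \<mu> = ?S" "sets \<nu> = ?S" using gen radon_sets \<mu> \<nu> by auto
  show "Int_stable {C. compactin (Euclidean_space d) C}"
    by (auto simp: Int_stable_def compactin_Euclidean_space intro!: compact_Int)
  show "{C. compactin (Euclidean_space d) C} \<subseteq> Pow (topspace (Euclidean_space d))"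
    by (auto simp: compactin_def)
  show "range (\<lambda>n. closed_ball d origin (real n)) \<subseteq> {C. compactin (Euclidean_space d) C}"
    by (auto simp: compactin_closed_ball)
  show "emeasure \<mu> (closed_ball d origin (real i)) \<noteq> \<infinity>" for i
    using radon_compact_finite[OF \<mu> compactin_closed_ball] by (metis less_irrefl)
  show "(\<Union>i. closed_ball d origin (real i)) = topspace (Euclidean_space d)"
    by (rule Union_closed_ball)
  fix C assume "C \<in> {C. compactin (Euclidean_space d) C}"
  then have C: "compactin (Euclidean_space d) C" by simp
  obtain \<psi> where \<psi>: "\<And>n::nat. \<psi> n \<in> compactly_supported (Euclidean_space d)"
    "\<And>\<mu>. \<mu> \<in> radon_measures (Euclidean_space d) \<Longrightarrow>
        (\<lambda>n. \<integral>x. \<psi> n x \<partial>\<mu>) \<longlonglongrightarrow> (\<integral>x. indicator C x * (\<lambda>_. 1) x \<partial>\<mu>)"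
    using integral_over_compact_limit[of C d "\<lambda>_. 1"] C by (auto simp: compactin_Euclidean_space)
  have "(\<integral>x. indicator C x * (\<lambda>_. 1 :: real) x \<partial>\<mu>) = (\<integral>x. indicator C x * (\<lambda>_. 1) x \<partial>\<nu>)"
    using LIMSEQ_unique[OF \<psi>(2)[OF \<mu>, unfolded eq[OF \<psi>(1)]] \<psi>(2)[OF \<nu>]] .
  moreover have "C \<subseteq> space \<mu>" "C \<subseteq> space \<nu>"
    using C \<mu> \<nu> by (auto simp: radon_space compactin_Euclidean_space)
  ultimately have "measure \<mu> C = measure \<nu> C"
    by (simp add: Int_absorb2)
  moreover have "emeasure \<mu> C \<noteq> \<infinity>" "emeasure \<nu> C \<noteq> \<infinity>"
    using radon_compact_finite[OF _ C] \<mu> \<nu> by (simp_all add: less_top)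
  ultimately show "emeasure \<mu> C = emeasure \<nu> C"
    by (simp add: emeasure_eq_ennreal_measure)
qed

text \<open>Test functions separate Radon measures, so the complement of a point is a union of
  subbasic open sets. This lets a point mass on the space of measures be tested on the singleton
  itself.\<close>

lemma singleton_sets_star:
  assumes "\<nu> \<in> star_measures d" shows "{\<nu>} \<in> sets (borel_of (star_topology d))"
proof (rule closedin_sets_borel_of)
  have \<nu>: "\<nu> \<in> radon_measures (Euclidean_space d)" using assms by (simp add: star_measures_def)
  let ?U = "\<lambda>f. {\<mu> \<in> radon_measures (Euclidean_space d). (\<integral>x. f x \<partial>\<mu>) \<in> - {\<integral>x. f x \<partial>\<nu>}}"
  have "openin (weak_topology (Euclidean_space d)) (\<Union>f \<in> compactly_supported (Euclidean_space d). ?U f)"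
    by (intro openin_Union) (auto intro!: openin_weak_topology_basis simp del: Compl_iff)
  moreover have "star_measures d - {\<nu>} = (\<Union>f \<in> compactly_supported (Euclidean_space d). ?U f) \<inter> star_measures d"
    using radon_measure_eqI[OF _ \<nu>] by (auto simp: star_measures_def)
  ultimately show "closedin (star_topology d) {\<nu>}"
    using assms unfolding closedin_def topspace_star_topology by (auto simp: star_topology_def openin_subtopology)
qed

section \<open>The scaling flow\<close>

text \<open>The support condition runs over all neighbourhoods of the origin; tent functions of
  shrinking width reduce it to countably many positive integrals.\<close>

lemma flow_domain_sets: "flow_domain d \<in> sets (borel_of (star_topology d))"
proof -
  \<comment> \<open>The tent uses the metric of the function type; compact support comes from the
    cutoff factor.\<close>
  define v where "v n x = max 0 (1 / real (Suc n) - dist x origin) * cutoff d 1 x" for n and x :: "nat \<Rightarrow> real"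
  have cont: "continuous_on S (v n)" for n S
    unfolding v_def by (intro continuous_intros)
  have v: "v n \<in> compactly_supported (Euclidean_space d)" for n
    using cutoff_eq_0[of _ d 1]
    by (intro compactly_supported_Euclidean_spaceI[of _ _ 2] cont) (simp add: v_def)
  have v_nonneg: "v n x \<ge> 0" for n x
    by (simp add: v_def cutoff_nonneg)
  have "origin \<in> closed_ball d origin 1" by (simp add: closed_ball_def topspace_Euclidean_space)
  then have v_pos: "v n origin > 0" for n
    by (simp add: v_def cutoff_eq_1)
  have "origin \<in> supp (Euclidean_space d) \<mu> \<longleftrightarrow> (\<forall>n. 0 < (\<integral>x. v n x \<partial>\<mu>))"
    if "\<mu> \<in> star_measures d" for \<mu>
  proof
    have \<mu>: "\<mu> \<in> radon_measures (Euclidean_space d)" using that by (simp add: star_measures_def)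
    have int: "integrable \<mu> (v n)" for n
      by (rule compactly_supported_integrable[OF Hausdorff_Euclidean_space \<mu> v])
    {
      assume supp: "origin \<in> supp (Euclidean_space d) \<mu>"
      show "\<forall>n. 0 < (\<integral>x. v n x \<partial>\<mu>)"
      proof (rule allI, rule ccontr)
        fix n assume "\<not> 0 < (\<integral>x. v n x \<partial>\<mu>)"
        then have "(\<integral>x. v n x \<partial>\<mu>) = 0"
          by (meson Bochner_Integration.integral_nonneg less_le not_less v_nonneg order_antisym)
        then have ae: "AE x in \<mu>. v n x = 0"
          by (subst (asm) integral_nonneg_eq_0_iff_AE[OF int]) (auto simp: v_nonneg)
        let ?U = "{x \<in> topspace (Euclidean_space d). v n x \<in> {0<..}}"
        have "continuous_map (Euclidean_space d) euclideanreal (v n)"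
          by (simp add: continuous_map_Euclidean_space_iff cont)
        then have U: "openin (Euclidean_space d) ?U"
          by (rule openin_continuous_map_preimage) simp
        have "emeasure \<mu> {x \<in> space \<mu>. v n x \<in> {0<..}} = 0"
        proof (rule emeasure_eq_0_AE)
          show "AE x in \<mu>. \<not> v n x \<in> {0<..}"
            using ae by eventually_elim simp
        qed
        then have "emeasure \<mu> ?U = 0" using radon_space[OF \<mu>] by simp
        moreover have "origin \<in> ?U" by (simp add: v_pos topspace_Euclidean_space)
        ultimately show False using supp U by (auto simp: supp_def)
      qed
    next
      assume pos: "\<forall>n. 0 < (\<integral>x. v n x \<partial>\<mu>)"
      show "origin \<in> supp (Euclidean_space d) \<mu>"
        unfolding supp_def
      proof (intro CollectI conjI allI impI)
        fix U assume U: "openin (Euclidean_space d) U \<and> origin \<in> U"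
        then obtain W where W: "open W" "U = topspace (Euclidean_space d) \<inter> W"
          using Euclidean_space_top_of_set[of d] by (metis openin_open)
        then obtain e where e: "e > 0" "ball origin e \<subseteq> W" using U open_contains_ball by blast
        \<comment> \<open>A tent narrower than a ball inside \<open>U\<close> vanishes off
          \<open>U\<close>, so its integral would be 0 if \<open>U\<close> were null.\<close>
        obtain n where n: "1 / real (Suc n) < e" using e(1) nat_approx_posE by blast
        show "emeasure \<mu> U > 0"
        proof (rule ccontr)
          assume "\<not> emeasure \<mu> U > 0"
          moreover have Us: "U \<in> sets \<mu>" using U openin_sets_borel_of radon_sets[OF \<mu>] by auto
          ultimately have "U \<in> null_sets \<mu>" by (auto simp: null_sets_def not_less)
          then have "AE x in \<mu>. x \<notin> U" by (rule AE_not_in)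
          moreover have "v n x = 0" if "x \<in> space \<mu>" "x \<notin> U" for x
          proof -
            have "x \<notin> ball origin e" using that e W radon_space[OF \<mu>] by auto
            then show ?thesis using n by (simp add: v_def dist_commute)
          qed
          ultimately have "AE x in \<mu>. v n x = 0" by (auto elim: AE_mp)
          then have "(\<integral>x. v n x \<partial>\<mu>) = 0" by (rule integral_eq_zero_AE)
          with pos show False by (metis less_irrefl)
        qed
      qed (simp add: topspace_Euclidean_space)
    }
  qed
  then have "flow_domain d = {\<mu> \<in> space (borel_of (star_topology d)). \<forall>n. 0 < (\<integral>x. v n x \<partial>\<mu>)}"
    by (auto simp: flow_domain_def)
  also have "\<dots> \<in> sets (borel_of (star_topology d))"
    using measurable_star_integral_compactly_supported[OF v] by measurable
  finally show ?thesis .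
qed

section \<open>Normalised dilations as measurable maps\<close>

lemma scale_measure_eq_density: "scale_measure c M = density M (\<lambda>_. c)"
  by (rule measure_eqI) (simp_all add: emeasure_density nn_integral_cmult_indicator)

lemma integral_scale_measure:
  fixes f :: "_ \<Rightarrow> real"
  assumes "f \<in> borel_measurable M" "c \<ge> 0"
  shows "(\<integral>x. f x \<partial>scale_measure (ennreal c) M) = c * (\<integral>x. f x \<partial>M)"
  using assms by (simp add: scale_measure_eq_density integral_density)

lemma dilation_measurable:
  "(\<lambda>y i. exp t * y i) \<in> measurable (borel_of (Euclidean_space d)) (borel_of (Euclidean_space d))"
  by (rule measurable_borel_of_Euclidean_space)
    (auto simp: topspace_Euclidean_space intro!: borel_measurable_times coordinate_measurable)

lemma translation_measurable:
  assumes "x \<in> topspace (Euclidean_space d)"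
  shows "(\<lambda>y i. y i - x i) \<in> measurable (borel_of (Euclidean_space d)) (borel_of (Euclidean_space d))"
  using assms by (intro measurable_borel_of_Euclidean_space)
    (auto simp: topspace_Euclidean_space intro!: borel_measurable_diff coordinate_measurable)

lemma sets_dilate [simp]: "sets (dilate d t \<mu>) = sets (borel_of (Euclidean_space d))"
  by (simp add: dilate_def)

lemma sets_translate [simp]: "sets (translate d x \<mu>) = sets (borel_of (Euclidean_space d))"
  by (simp add: translate_def)

lemma emeasure_dilate_closed_ball:
  assumes "sets \<mu> = sets (borel_of (Euclidean_space d))"
  shows "emeasure (dilate d t \<mu>) (closed_ball d origin r) = emeasure \<mu> (closed_ball d origin (exp (- t) * r))"
proof -
  have m: "(\<lambda>y i. exp t * y i) \<in> measurable \<mu> (borel_of (Euclidean_space d))"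
    using dilation_measurable measurable_cong_sets[OF assms refl] by blast
  have "(\<lambda>y i. exp t * y i) -` closed_ball d origin r \<inter> space \<mu> = closed_ball d origin (exp (- t) * r)"
    using sets_eq_imp_space_eq[OF assms]
    by (auto simp: closed_ball_def topspace_Euclidean_space abs_mult exp_minus field_simps)
  then show ?thesis unfolding dilate_def by (subst emeasure_distr[OF m]) auto
qed

lemma radon_dilate:
  assumes "\<mu> \<in> radon_measures (Euclidean_space d)"
  shows "dilate d t \<mu> \<in> radon_measures (Euclidean_space d)"
  unfolding radon_measures_def
proof (intro CollectI conjI allI impI)
  fix K assume "compactin (Euclidean_space d) K"
  then have "compact K" "K \<subseteq> topspace (Euclidean_space d)"
    by (simp_all add: compactin_Euclidean_space)
  from bounded_in_closed_ball[OF this] obtain R where R: "K \<subseteq> closed_ball d origin R" ..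
  have "emeasure (dilate d t \<mu>) K \<le> emeasure (dilate d t \<mu>) (closed_ball d origin R)"
    using R by (intro emeasure_mono) auto
  also have "\<dots> < \<infinity>"
    unfolding emeasure_dilate_closed_ball[OF radon_sets[OF assms]]
    by (rule radon_compact_finite[OF assms compactin_closed_ball])
  finally show "emeasure (dilate d t \<mu>) K < \<infinity>" .
qed simp

lemma radon_scale_measure:
  assumes "\<mu> \<in> radon_measures X" "c < \<infinity>"
  shows "scale_measure c \<mu> \<in> radon_measures X"
  using assms by (auto simp: radon_measures_def ennreal_mult_less_top)

lemma integral_dilate:
  fixes f :: "_ \<Rightarrow> real"
  assumes \<mu>: "sets \<mu> = sets (borel_of (Euclidean_space d))" and f: "f \<in> borel_measurable (borel_of (Euclidean_space d))"
  shows "(\<integral>x. f x \<partial>dilate d t \<mu>) = (\<integral>x. f (\<lambda>i. exp t * x i) \<partial>\<mu>)"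
  unfolding dilate_def
  using dilation_measurable measurable_cong_sets[OF \<mu> refl] f by (intro integral_distr) blast

lemma compactly_supported_borel_measurable:
  "f \<in> compactly_supported X \<Longrightarrow> f \<in> borel_measurable (borel_of X)"
  by (auto simp: compactly_supported_def intro: continuous_map_borel_measurable)

lemma compactly_supported_dilation:
  assumes "f \<in> compactly_supported (Euclidean_space d)"
  shows "(\<lambda>x. f (\<lambda>i. exp t * x i)) \<in> compactly_supported (Euclidean_space d)"
proof -
  obtain K where K: "compact K" "K \<subseteq> topspace (Euclidean_space d)"
      "\<And>x. x \<in> topspace (Euclidean_space d) - K \<Longrightarrow> f x = 0"
    and f: "continuous_on (topspace (Euclidean_space d)) f"
    using assms
    unfolding compactly_supported_def compactin_Euclidean_space continuous_map_Euclidean_space_iff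
    by blast
  from bounded_in_closed_ball[OF K(1,2)] obtain R where R: "K \<subseteq> closed_ball d origin R" ..
  show ?thesis
  proof (rule compactly_supported_Euclidean_spaceI)
    show "continuous_on (topspace (Euclidean_space d)) (\<lambda>x. f (\<lambda>i. exp t * x i))"
      by (rule continuous_on_compose2[OF f])
        (auto simp: topspace_Euclidean_space intro!: continuous_intros continuous_on_coordinatewise_then_product)
    fix x assume x: "x \<in> topspace (Euclidean_space d) - closed_ball d origin (exp (- t) * R)"
    then have "(\<lambda>i. exp t * x i) \<in> topspace (Euclidean_space d) - closed_ball d origin R"
      by (auto simp: closed_ball_def topspace_Euclidean_space abs_mult exp_minus field_simps)
    then show "f (\<lambda>i. exp t * x i) = 0" using K(3) R by blast
  qed
qed

text \<open>
  The normalised dilation is not continuous, as the mass of the unit ball is only semicontinuous.  It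
  is continuous as a function of the measure and the normalising constant together; since the
  constant ranges over a second countable space, measurability of the constant suffices.
\<close>

lemma weak_open_scale_dilate:
  assumes "openin (weak_topology (Euclidean_space d)) W"
  shows "\<mu> \<in> radon_measures (Euclidean_space d) \<Longrightarrow> c > 0 \<Longrightarrow> scale_measure (ennreal c) (dilate d t \<mu>) \<in> W \<Longrightarrow>
    \<exists>a b G. 0 \<le> a \<and> of_rat a < c \<and> c < of_rat b \<and> openin (weak_topology (Euclidean_space d)) G \<and> \<mu> \<in> G \<and>
      (\<forall>\<nu>\<in>G. \<forall>s. of_rat a < s \<longrightarrow> s < of_rat b \<longrightarrow> scale_measure (ennreal s) (dilate d t \<nu>) \<in> W)"
  using assms
proof (induction rule: openin_weak_topology_induct)
  case (Basis f V)
  let ?g = "\<lambda>x. f (\<lambda>i. exp t * x i)"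
  have eq: "(\<integral>x. f x \<partial>scale_measure (ennreal s) (dilate d t \<nu>)) = s * (\<integral>x. ?g x \<partial>\<nu>)"
    if "\<nu> \<in> radon_measures (Euclidean_space d)" "s > 0" for \<nu> s
    using that compactly_supported_borel_measurable[OF Basis(1)]
    by (subst integral_scale_measure) (auto simp: integral_dilate radon_sets measurable_cong_sets[OF sets_dilate refl])
  let ?u = "\<integral>x. ?g x \<partial>\<mu>"
  \<comment> \<open>Multiplication is jointly continuous, so constants near \<open>c\<close> and
    integrals near that of \<open>\<mu>\<close> may vary independently.\<close>
  have "open ((\<lambda>p::real \<times> real. fst p * snd p) -` V)"
    by (rule open_vimage[OF Basis(2)]) (intro continuous_intros)
  moreover have "(c, ?u) \<in> (\<lambda>p. fst p * snd p) -` V"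
    using Basis(5) eq[OF Basis(3,4)] by simp
  ultimately obtain A B where AB: "open A" "open B" "c \<in> A" "?u \<in> B" "A \<times> B \<subseteq> (\<lambda>p. fst p * snd p) -` V"
    by (auto elim!: open_prod_elim)
  obtain e where e: "e > 0" "ball c e \<subseteq> A" using AB open_contains_ball by blast
  have "max 0 (c - e) < c" using e Basis(4) by simp
  from of_rat_dense[OF this] obtain a where a: "max 0 (c - e) < of_rat a" "of_rat a < c" by blast
  have "c < c + e" using e by simp
  from of_rat_dense[OF this] obtain b where b: "c < of_rat b" "of_rat b < c + e" by blast
  let ?G = "{\<nu> \<in> radon_measures (Euclidean_space d). (\<integral>x. ?g x \<partial>\<nu>) \<in> B}"
  have "openin (weak_topology (Euclidean_space d)) ?G"
    by (intro openin_weak_topology_basis compactly_supported_dilation Basis AB)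
  moreover have "scale_measure (ennreal s) (dilate d t \<nu>) \<in> {\<mu> \<in> radon_measures (Euclidean_space d). (\<integral>x. f x \<partial>\<mu>) \<in> V}"
    if "\<nu> \<in> ?G" "of_rat a < s" "s < of_rat b" for \<nu> s
  proof -
    have "(0::real) < of_rat a" "c - e < of_rat a" using a(1) by linarith+
    then have "s > 0" "\<bar>c - s\<bar> < e" using that(2,3) a b by linarith+
    then have "s \<in> ball c e" by (simp add: dist_real_def)
    then have "(s, \<integral>x. ?g x \<partial>\<nu>) \<in> A \<times> B" using that(1) e(2) by blast
    then have "s * (\<integral>x. ?g x \<partial>\<nu>) \<in> V" using AB(5) by (auto dest: subsetD)
    then show ?thesis using that \<open>s > 0\<close> eq by (simp add: radon_scale_measure radon_dilate)
  qed
  moreover have "0 \<le> a" using a(1) by (simp add: zero_less_of_rat_iff less_imp_le)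
  ultimately show ?case using a b AB(4) Basis(3)
    by - (rule exI[of _ a], rule exI[of _ b], rule exI[of _ ?G], auto)
next
  case (Int U V)
  have "scale_measure (ennreal c) (dilate d t \<mu>) \<in> U" "scale_measure (ennreal c) (dilate d t \<mu>) \<in> V"
    using Int.prems by auto
  obtain a b G where 1: "0 \<le> a" "of_rat a < c" "c < of_rat b" "openin (weak_topology (Euclidean_space d)) G" "\<mu> \<in> G"
    "\<And>\<nu> s. \<nu>\<in>G \<Longrightarrow> of_rat a < s \<Longrightarrow> s < of_rat b \<Longrightarrow> scale_measure (ennreal s) (dilate d t \<nu>) \<in> U"
    using Int.IH(1)[OF Int.prems(1,2) \<open>_ \<in> U\<close>] by blast
  obtain a' b' G' where 2: "0 \<le> a'" "of_rat a' < c" "c < of_rat b'" "openin (weak_topology (Euclidean_space d)) G'" "\<mu> \<in> G'"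
    "\<And>\<nu> s. \<nu>\<in>G' \<Longrightarrow> of_rat a' < s \<Longrightarrow> s < of_rat b' \<Longrightarrow> scale_measure (ennreal s) (dilate d t \<nu>) \<in> V"
    using Int.IH(2)[OF Int.prems(1,2) \<open>_ \<in> V\<close>] by blast
  have le: "(of_rat a::real) \<le> of_rat (max a a')" "(of_rat a'::real) \<le> of_rat (max a a')"
      "(of_rat (min b b')::real) \<le> of_rat b" "(of_rat (min b b')::real) \<le> of_rat b'"
    by (simp_all add: of_rat_less_eq)
  show ?case
  proof (rule exI[of _ "max a a'"], rule exI[of _ "min b b'"], rule exI[of _ "G \<inter> G'"],
      intro conjI ballI allI impI)
    show "of_rat (max a a') < c" "c < of_rat (min b b')" using 1 2 by (auto simp: max_def min_def)
    show "scale_measure (ennreal s) (dilate d t \<nu>) \<in> U \<inter> V"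
      if "\<nu> \<in> G \<inter> G'" "of_rat (max a a') < s" "s < of_rat (min b b')" for \<nu> s
    proof
      have "of_rat a < s" "of_rat a' < s" "s < of_rat b" "s < of_rat b'"
        using le that(2,3) by linarith+
      then show "scale_measure (ennreal s) (dilate d t \<nu>) \<in> U" "scale_measure (ennreal s) (dilate d t \<nu>) \<in> V"
        using 1(6) 2(6) that(1) by auto
    qed
  qed (use 1 2 in auto)
next
  case (UN \<K>)
  then obtain K where K: "K \<in> \<K>" "scale_measure (ennreal c) (dilate d t \<mu>) \<in> K" by blast
  show ?case using UN.IH[OF K(1) UN.prems(1,2) K(2)] K(1) by (meson UnionI)
qed

lemma radon_measure_finite_closed_ball:
  "\<mu> \<in> radon_measures (Euclidean_space d) \<Longrightarrow> emeasure \<mu> (closed_ball d x r) < \<infinity>"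
  by (rule radon_compact_finite[OF _ compactin_closed_ball])

lemma star_eq_scale_measure:
  assumes "\<mu> \<in> radon_measures (Euclidean_space d)" "emeasure \<mu> (unit_ball d) > 0"
  shows "star d \<mu> = scale_measure (ennreal (1 / measure \<mu> (unit_ball d))) \<mu>"
    and "measure \<mu> (unit_ball d) > 0" and "star d \<mu> \<in> star_measures d"
proof -
  have fin: "emeasure \<mu> (unit_ball d) = ennreal (measure \<mu> (unit_ball d))"
    using radon_measure_finite_closed_ball[OF assms(1), of origin 1]
    by (simp add: emeasure_eq_ennreal_measure less_top)
  then show pos: "measure \<mu> (unit_ball d) > 0" using assms(2) by simp
  have "1 / emeasure \<mu> (unit_ball d) = ennreal (1 / measure \<mu> (unit_ball d))"
    using divide_ennreal[of 1 "measure \<mu> (unit_ball d)"] pos by (simp add: fin)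
  then show "star d \<mu> = scale_measure (ennreal (1 / measure \<mu> (unit_ball d))) \<mu>"
    by (simp add: star_def)
  then show "star d \<mu> \<in> star_measures d"
    using pos assms(1) fin by (auto simp: star_measures_def radon_scale_measure ennreal_mult[symmetric])
qed

text \<open>The support condition speaks of open sets, so an open box around \<open>x\<close> is
  placed inside the closed ball.\<close>

lemma supp_closed_ball_pos:
  assumes "\<mu> \<in> radon_measures (Euclidean_space d)" "x \<in> supp (Euclidean_space d) \<mu>" "r > 0"
  shows "emeasure \<mu> (closed_ball d x r) > 0"
proof -
  let ?U = "\<lambda>i. {y \<in> topspace (Euclidean_space d). y i \<in> {x i - r<..<x i + r}}"
  have "openin (Euclidean_space d) (?U i)" for i
    by (rule openin_continuous_map_preimage[of _ euclidean])
      (auto simp: continuous_map_Euclidean_space_iff intro: continuous_intros)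
  then have "openin (Euclidean_space d) (topspace (Euclidean_space d) \<inter> (\<Inter>i\<in>{..<d}. ?U i))"
    by (intro openin_Int_Inter) auto
  moreover have "x \<in> topspace (Euclidean_space d) \<inter> (\<Inter>i\<in>{..<d}. ?U i)"
    using assms by (auto simp: supp_def)
  ultimately have "0 < emeasure \<mu> (topspace (Euclidean_space d) \<inter> (\<Inter>i\<in>{..<d}. ?U i))"
    using assms(2) unfolding supp_def by blast
  also have "\<dots> \<le> emeasure \<mu> (closed_ball d x r)"
  proof (rule emeasure_mono)
    show "topspace (Euclidean_space d) \<inter> (\<Inter>i\<in>{..<d}. ?U i) \<subseteq> closed_ball d x r"
    proof
      fix y assume y: "y \<in> topspace (Euclidean_space d) \<inter> (\<Inter>i\<in>{..<d}. ?U i)"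
      have "\<bar>y i - x i\<bar> \<le> r" if "i < d" for i
      proof -
        have "y \<in> ?U i" using y that by blast
        then show ?thesis by auto
      qed
      then show "y \<in> closed_ball d x r" using y by (simp add: closed_ball_def)
    qed
  qed (simp add: radon_sets[OF assms(1)])
  finally show ?thesis .
qed

lemma measurable_star_measure_closed_ball:
  "(\<lambda>\<mu>. measure \<mu> (closed_ball d x r)) \<in> borel_measurable (borel_of (star_topology d))"
proof (rule measurable_cong[THEN iffD1])
  show "(\<lambda>\<mu>. \<integral>y. indicator (closed_ball d x r) y * (\<lambda>_. 1 :: real) y \<partial>\<mu>) \<in> borel_measurable (borel_of (star_topology d))"
    by (intro measurable_star_integral_compact compact_closed_ball closed_ball_subset continuous_intros)
  show "(\<integral>y. indicator (closed_ball d x r) y * (\<lambda>_. 1 :: real) y \<partial>\<mu>) = measure \<mu> (closed_ball d x r)"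
    if "\<mu> \<in> space (borel_of (star_topology d))" for \<mu>
    using that closed_ball_subset[of d x r] by (auto simp: star_measures_def radon_space Int_absorb2)
qed

text \<open>\<open>emeasure\<close> of a non-measurable set is 0 by convention, so
  \<open>scale_invariant\<close> can be checked only after this. The normalising constant is
  decoupled from the measure by rational bounds.\<close>

lemma scaling_preimage_sets:
  assumes A: "A \<in> sets (borel_of (star_topology d))"
  shows "{\<mu> \<in> flow_domain d. star d (dilate d t \<mu>) \<in> A} \<in> sets (borel_of (star_topology d))"
proof -
  let ?B = "borel_of (star_topology d)"
  let ?m = "\<lambda>\<mu>. 1 / measure \<mu> (closed_ball d origin (exp (- t)))"
  have flow: "\<mu> \<in> radon_measures (Euclidean_space d)" "?m \<mu> > 0"
      "star d (dilate d t \<mu>) = scale_measure (ennreal (?m \<mu>)) (dilate d t \<mu>)"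
      "star d (dilate d t \<mu>) \<in> star_measures d" if "\<mu> \<in> flow_domain d" for \<mu>
  proof -
    show \<mu>: "\<mu> \<in> radon_measures (Euclidean_space d)"
      using that by (simp add: flow_domain_def star_measures_def)
    have e: "emeasure (dilate d t \<mu>) (unit_ball d) = emeasure \<mu> (closed_ball d origin (exp (- t)))"
      using emeasure_dilate_closed_ball[OF radon_sets[OF \<mu>]] by simp
    also have "\<dots> > 0"
      using that by (intro supp_closed_ball_pos[OF \<mu>]) (auto simp: flow_domain_def)
    finally have pos: "emeasure (dilate d t \<mu>) (unit_ball d) > 0" .
    have "measure (dilate d t \<mu>) (unit_ball d) = measure \<mu> (closed_ball d origin (exp (- t)))"
      using e by (simp add: measure_def)
    then show "?m \<mu> > 0" "star d (dilate d t \<mu>) = scale_measure (ennreal (?m \<mu>)) (dilate d t \<mu>)"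
      "star d (dilate d t \<mu>) \<in> star_measures d"
      using star_eq_scale_measure[OF radon_dilate[OF \<mu>] pos] by auto
  qed
  have m: "(\<lambda>\<mu>. measure \<mu> (closed_ball d origin (exp (- t)))) \<in> borel_measurable ?B"
    by (rule measurable_star_measure_closed_ball)
  have flow_Int: "flow_domain d \<inter> space ?B \<in> sets ?B"
    by (intro sets.Int flow_domain_sets sets.top)
  have "(\<lambda>\<mu>. star d (dilate d t \<mu>)) \<in> measurable (restrict_space ?B (flow_domain d)) ?B"
  proof (rule measurable_borel_ofI)
    show "star d (dilate d t \<mu>) \<in> topspace (star_topology d)"
      if "\<mu> \<in> space (restrict_space ?B (flow_domain d))" for \<mu>
      using that flow(4) by (simp add: space_restrict_space)
    fix U assume "openin (star_topology d) U"
    then obtain W where W: "openin (weak_topology (Euclidean_space d)) W" "U = W \<inter> star_measures d"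
      by (auto simp: star_topology_def openin_subtopology)
    \<comment> \<open>The largest open set of measures whose dilation, scaled by any constant
      strictly between \<open>a\<close> and \<open>b\<close>, lies in \<open>W\<close>.\<close>
    define G where "G a b = \<Union>{G. openin (weak_topology (Euclidean_space d)) G \<and>
      (\<forall>\<nu>\<in>G. \<forall>s. of_rat a < s \<longrightarrow> s < of_rat b \<longrightarrow> scale_measure (ennreal s) (dilate d t \<nu>) \<in> W)}" for a b
    define S where "S a b = {\<mu> \<in> space ?B. of_rat a < ?m \<mu> \<and> ?m \<mu> < of_rat b}" for a b :: rat
    have "openin (weak_topology (Euclidean_space d)) (G a b)" for a b
      unfolding G_def by (rule openin_Union) auto
    then have "G a b \<inter> star_measures d \<in> sets ?B" for a b
      by (intro openin_sets_borel_of) (auto simp: star_topology_def openin_subtopology)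
    moreover have "S a b \<in> sets ?B" for a b
      unfolding S_def using m by measurable
    ultimately have "(G a b \<inter> star_measures d) \<inter> S a b \<in> sets ?B" for a b
      by (rule sets.Int)
    then have "(\<Union>a. \<Union>b. (G a b \<inter> star_measures d) \<inter> S a b) \<inter> flow_domain d \<in> sets ?B"
      by (intro sets.Int[OF _ flow_domain_sets] sets.countable_UN'' countableI_type)
    moreover have "(\<lambda>\<mu>. star d (dilate d t \<mu>)) -` U \<inter> space (restrict_space ?B (flow_domain d)) =
        (\<Union>a. \<Union>b. (G a b \<inter> star_measures d) \<inter> S a b) \<inter> flow_domain d" (is "?L = ?R")
    proof (intro equalityI subsetI)
      fix \<mu> assume "\<mu> \<in> ?L"
      then have \<mu>: "\<mu> \<in> flow_domain d" "\<mu> \<in> star_measures d" "star d (dilate d t \<mu>) \<in> W"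
        using W(2) by (auto simp: space_restrict_space)
      then have "scale_measure (ennreal (?m \<mu>)) (dilate d t \<mu>) \<in> W" using flow(3) by simp
      from weak_open_scale_dilate[OF W(1) flow(1,2)[OF \<mu>(1)] this] obtain a b H where
        H: "of_rat a < ?m \<mu>" "?m \<mu> < of_rat b" "openin (weak_topology (Euclidean_space d)) H" "\<mu> \<in> H"
          "\<forall>\<nu>\<in>H. \<forall>s. of_rat a < s \<longrightarrow> s < of_rat b \<longrightarrow> scale_measure (ennreal s) (dilate d t \<nu>) \<in> W"
        by blast
      then have "\<mu> \<in> G a b" unfolding G_def by blast
      moreover have "\<mu> \<in> S a b" using H \<mu>(2) by (simp add: S_def)
      ultimately show "\<mu> \<in> ?R" using \<mu> by blast
    next
      fix \<mu> assume "\<mu> \<in> ?R"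
      then obtain a b where ab: "\<mu> \<in> G a b" "\<mu> \<in> S a b" and \<mu>: "\<mu> \<in> flow_domain d" "\<mu> \<in> star_measures d" by blast
      then have "scale_measure (ennreal (?m \<mu>)) (dilate d t \<mu>) \<in> W"
        unfolding G_def S_def by blast
      then show "\<mu> \<in> ?L" using \<mu> flow(3,4) W(2) by (auto simp: space_restrict_space)
    qed
    ultimately show "(\<lambda>\<mu>. star d (dilate d t \<mu>)) -` U \<inter> space (restrict_space ?B (flow_domain d))
        \<in> sets (restrict_space ?B (flow_domain d))"
      unfolding sets_restrict_space_iff[OF flow_Int] by simp
  qed
  from measurable_sets[OF this A]
  have "(\<lambda>\<mu>. star d (dilate d t \<mu>)) -` A \<inter> space (restrict_space ?B (flow_domain d)) \<in> sets ?B"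
    unfolding sets_restrict_space_iff[OF flow_Int] by simp
  moreover have "(\<lambda>\<mu>. star d (dilate d t \<mu>)) -` A \<inter> space (restrict_space ?B (flow_domain d)) =
      {\<mu> \<in> flow_domain d. star d (dilate d t \<mu>) \<in> A}"
    by (auto simp: space_restrict_space flow_domain_def)
  ultimately show ?thesis by simp
qed

section \<open>Restriction to the unit ball\<close>

text \<open>Composing with this clamp extends a continuous function from the unit ball to all of
  d-space, so integrals over the ball become integrals of a globally continuous function times an
  indicator.\<close>

definition unit_retract :: "(nat \<Rightarrow> real) \<Rightarrow> nat \<Rightarrow> real" where
  "unit_retract x i = max (- 1) (min 1 (x i))"

lemma continuous_on_unit_retract: "continuous_on S unit_retract"
  unfolding unit_retract_def[abs_def]
  by (intro continuous_on_coordinatewise_then_product continuous_intros)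

lemma unit_retract_in: "x \<in> topspace (Euclidean_space d) \<Longrightarrow> unit_retract x \<in> unit_ball d"
  by (auto simp: unit_retract_def closed_ball_def topspace_Euclidean_space)

lemma unit_retract_eq: "x \<in> unit_ball d \<Longrightarrow> unit_retract x = x"
  by (rule ext, rename_tac i, case_tac "i < d")
    (auto simp: unit_retract_def closed_ball_def topspace_Euclidean_space)

lemma continuous_on_unit_retract_compose:
  fixes f :: "_ \<Rightarrow> real"
  assumes "continuous_on (unit_ball d) f"
  shows "continuous_on (topspace (Euclidean_space d)) (\<lambda>x. f (unit_retract x))"
  by (rule continuous_on_compose2[OF assms continuous_on_unit_retract]) (auto intro: unit_retract_in)

lemma subtopology_unit_ball: "subtopology (Euclidean_space d) (unit_ball d) = top_of_set (unit_ball d)"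
  using closed_ball_subset[of d origin 1] Euclidean_space_top_of_set[of d]
  by (metis inf.absorb2 subtopology_subtopology)

lemma sets_box:
  assumes "sets \<mu> = sets (borel_of (Euclidean_space d))"
  shows "sets (box d \<mu>) = sets (borel_of (top_of_set (unit_ball d)))"
proof -
  have "sets (box d \<mu>) = sets (restrict_space (restrict_space borel (topspace (Euclidean_space d))) (unit_ball d))"
    unfolding box_def
    by (rule restrict_space_sets_cong) (simp_all add: star_def assms sets_borel_of_Euclidean_space)
  also have "\<dots> = sets (restrict_space borel (topspace (Euclidean_space d) \<inter> unit_ball d))"
    by (simp add: sets_restrict_restrict_space)
  also have "topspace (Euclidean_space d) \<inter> unit_ball d = unit_ball d"
    using closed_ball_subset by blast
  finally show ?thesis
    by (simp add: sets_borel_of_top_of_set compact_closed_ball borel_compact)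
qed

lemma prob_space_radon:
  assumes "sets M = sets (borel_of X)" "prob_space M"
  shows "M \<in> radon_measures X"
proof -
  interpret prob_space M by fact
  show ?thesis using assms by (simp add: radon_measures_def less_top[symmetric])
qed

lemma box_prob:
  assumes \<mu>: "\<mu> \<in> radon_measures (Euclidean_space d)" "emeasure \<mu> (unit_ball d) > 0"
  shows "prob_space (box d \<mu>)" "box d \<mu> \<in> radon_measures (top_of_set (unit_ball d))"
proof -
  have star: "star d \<mu> \<in> star_measures d" by (rule star_eq_scale_measure(3)[OF assms])
  have B: "unit_ball d \<in> sets (star d \<mu>)" by (simp add: star_def radon_sets[OF \<mu>(1)])
  have sp: "space (box d \<mu>) = unit_ball d"
    using sets_eq_imp_space_eq[OF sets_box[OF radon_sets[OF \<mu>(1)]]] by simp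
  have "emeasure (box d \<mu>) (unit_ball d) = emeasure (star d \<mu>) (unit_ball d)"
    unfolding box_def using B by (subst emeasure_restrict_space) (auto dest: sets.sets_into_space)
  then show "prob_space (box d \<mu>)"
    using star sp by (intro prob_spaceI) (simp add: star_measures_def)
  then show "box d \<mu> \<in> radon_measures (top_of_set (unit_ball d))"
    by (intro prob_space_radon sets_box radon_sets[OF \<mu>(1)])
qed

lemma unit_retract_borel_measurable:
  fixes f :: "_ \<Rightarrow> real"
  assumes "continuous_on (unit_ball d) f" "sets \<mu> = sets (borel_of (Euclidean_space d))"
  shows "(\<lambda>x. indicator (unit_ball d) x * f (unit_retract x)) \<in> borel_measurable \<mu>"
proof (rule borel_measurable_times)
  show "(\<lambda>x. f (unit_retract x)) \<in> borel_measurable \<mu>"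
    unfolding measurable_cong_sets[OF assms(2) refl]
    by (intro continuous_map_borel_measurable)
      (simp add: continuous_map_Euclidean_space_iff continuous_on_unit_retract_compose assms(1))
qed (intro borel_measurable_indicator, simp add: assms(2))

text \<open>Expresses an integral on the restricted space through ambient quantities whose
  measurability in \<open>\<mu>\<close> is known.\<close>

lemma integral_box:
  fixes f :: "_ \<Rightarrow> real"
  assumes \<mu>: "\<mu> \<in> radon_measures (Euclidean_space d)" "emeasure \<mu> (unit_ball d) > 0"
    and f: "continuous_on (unit_ball d) f"
  shows "(\<integral>x. f x \<partial>box d \<mu>) = (\<integral>x. indicator (unit_ball d) x * f (unit_retract x) \<partial>\<mu>) / measure \<mu> (unit_ball d)"
proof -
  have B: "unit_ball d \<inter> space (star d \<mu>) \<in> sets (star d \<mu>)"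
    by (intro sets.Int sets.top) (simp add: star_def radon_sets[OF \<mu>(1)])
  have "(\<integral>x. f x \<partial>box d \<mu>) = (\<integral>x. indicator (unit_ball d) x *\<^sub>R f x \<partial>star d \<mu>)"
    unfolding box_def by (rule integral_restrict_space[OF B])
  also have "\<dots> = (\<integral>x. indicator (unit_ball d) x * f (unit_retract x) \<partial>star d \<mu>)"
    by (intro Bochner_Integration.integral_cong) (auto simp: unit_retract_eq split: split_indicator)
  also have "\<dots> = 1 / measure \<mu> (unit_ball d) * (\<integral>x. indicator (unit_ball d) x * f (unit_retract x) \<partial>\<mu>)"
    unfolding star_eq_scale_measure(1)[OF \<mu>]
    by (rule integral_scale_measure) (use f radon_sets[OF \<mu>(1)] in \<open>auto intro: unit_retract_borel_measurable\<close>)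
  finally show ?thesis by simp
qed

text \<open>\<open>box_distribution\<close> is a push-forward along this map. Integrals against the
  box are quotients of measurable functionals of the measure.\<close>

lemma box_measurable: "box d \<in> measurable (borel_of (star_topology d)) (borel_of (box_topology d))"
  unfolding box_topology_def subtopology_unit_ball
proof (rule measurable_prob_topologyI[OF compact_closed_ball])
  let ?S = "borel_of (star_topology d)"
  have star: "\<mu> \<in> radon_measures (Euclidean_space d)" "emeasure \<mu> (unit_ball d) > 0" if "\<mu> \<in> space ?S" for \<mu>
    using that by (auto simp: star_measures_def)
  then show "box d \<mu> \<in> radon_measures (top_of_set (unit_ball d))" "prob_space (box d \<mu>)" if "\<mu> \<in> space ?S" for \<mu>
    using that box_prob by auto
  fix f :: "_ \<Rightarrow> real" assume f: "continuous_on (unit_ball d) f"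
  show "(\<lambda>\<mu>. \<integral>x. f x \<partial>box d \<mu>) \<in> borel_measurable ?S"
  proof (rule measurable_cong[THEN iffD2])
    show "(\<integral>x. f x \<partial>box d \<mu>) = (\<integral>x. indicator (unit_ball d) x * f (unit_retract x) \<partial>\<mu>) / measure \<mu> (unit_ball d)"
      if "\<mu> \<in> space ?S" for \<mu>
      using that star f by (intro integral_box) auto
    show "(\<lambda>\<mu>. (\<integral>x. indicator (unit_ball d) x * f (unit_retract x) \<partial>\<mu>) / measure \<mu> (unit_ball d)) \<in> borel_measurable ?S"
      by (intro borel_measurable_divide measurable_star_measure_closed_ball measurable_star_integral_compact
          compact_closed_ball closed_ball_subset continuous_on_unit_retract_compose f)
  qed
qed

section \<open>Integrals against point masses and time averages\<close>

text \<open>\<open>f\<close> is not assumed measurable, which matters for integrands such as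
  dimensions. Every simple function below \<open>f\<close> integrates to its value at
  \<open>a\<close>, and \<open>f a\<close> times the indicator of \<open>{a}\<close> attains the
  bound.\<close>

lemma nn_integral_return_singleton:
  assumes "{a} \<in> sets M" shows "(\<integral>\<^sup>+x. f x \<partial>return M a) = f a"
proof (rule antisym)
  have a: "a \<in> space M" using sets.sets_into_space[OF assms] by auto
  show "(\<integral>\<^sup>+x. f x \<partial>return M a) \<le> f a"
    unfolding nn_integral_def
  proof (rule SUP_least)
    fix g assume g: "g \<in> {g. simple_function (return M a) g \<and> g \<le> f}"
    then have "integral\<^sup>S (return M a) g = g a"
      using nn_integral_return[OF a] borel_measurable_simple_function[of "return M a" g]
      by (simp add: nn_integral_eq_simple_integral[symmetric] measurable_return1 cong: measurable_cong_sets)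
    then show "integral\<^sup>S (return M a) g \<le> f a" using g by (simp add: le_fun_def)
  qed
  have "f a = (\<integral>\<^sup>+x. f a * indicator {a} x \<partial>return M a)"
    using a assms by (subst nn_integral_return) (auto intro!: borel_measurable_times_ennreal borel_measurable_indicator)
  also have "\<dots> \<le> (\<integral>\<^sup>+x. f x \<partial>return M a)"
    by (intro nn_integral_mono) (auto split: split_indicator)
  finally show "f a \<le> (\<integral>\<^sup>+x. f x \<partial>return M a)" .
qed

text \<open>Beyond \<open>t0\<close> the integrand is within e/2 of the limit; the initial segment
  has relative length at most \<open>t0 / T\<close>, and boundedness of \<open>g\<close> controls
  its contribution.\<close>

lemma cesaro_limit:
  fixes g :: "real \<Rightarrow> real"
  assumes g[measurable]: "g \<in> borel_measurable borel" and bound: "\<And>t. \<bar>g t\<bar> \<le> M" and lim: "(g \<longlongrightarrow> L) at_top"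
  shows "((\<lambda>T. \<integral>t. g t \<partial>uniform_measure lborel {0..T}) \<longlongrightarrow> L) at_top"
proof (rule tendstoI)
  fix e :: real assume "e > 0"
  then have "\<forall>\<^sub>F t in at_top. dist (g t) L < e/2" using lim tendstoD half_gt_zero by blast
  then obtain t0' where "\<And>t. t \<ge> t0' \<Longrightarrow> dist (g t) L < e/2" by (auto simp: eventually_at_top_linorder)
  then obtain t0 where t0: "t0 \<ge> 0" "\<And>t. t \<ge> t0 \<Longrightarrow> \<bar>g t - L\<bar> < e/2"
    by (metis dist_real_def linorder_linear order_trans)
  define K where "K = M + \<bar>L\<bar>"
  have K: "\<bar>g t - L\<bar> \<le> K" for t using bound[of t] unfolding K_def by linarith
  have "K \<ge> 0" using K[of 0] by linarith
  \<comment> \<open>The threshold makes \<open>K * t0 / T\<close> less than e/2; the added 1 makes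
    \<open>T\<close> positive.\<close>
  have "\<bar>(\<integral>t. g t \<partial>uniform_measure lborel {0..T}) - L\<bar> < e" if T: "T > 2 * K * t0 / e + 1" for T
  proof -
    have "T > 0" "T \<ge> t0 * 0" using T t0 \<open>K \<ge> 0\<close> \<open>e > 0\<close>
      by (auto intro: less_trans[of 0 1] le_less_trans[rotated])
         (smt (verit) divide_nonneg_pos mult_nonneg_nonneg)+
    let ?U = "uniform_measure lborel {0..T}"
    interpret U: prob_space ?U using \<open>T > 0\<close> by (intro prob_space_uniform_measure) auto
    have U1: "measure ?U UNIV = 1" using U.prob_space by simp
    have int: "integrable ?U g"
      by (rule U.integrable_const_bound[of _ M]) (auto simp: bound)
    have int': "integrable ?U (\<lambda>t. e/2 + K * indicator {..t0} t)"
      by (rule U.integrable_const_bound[of _ "\<bar>e/2\<bar> + K"]) (use \<open>K \<ge> 0\<close> \<open>e > 0\<close> in \<open>auto split: split_indicator\<close>)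
    have "\<bar>(\<integral>t. g t \<partial>?U) - L\<bar> = \<bar>\<integral>t. g t - L \<partial>?U\<bar>"
      using int by (simp add: U1)
    also have "\<dots> \<le> (\<integral>t. \<bar>g t - L\<bar> \<partial>?U)" by (rule integral_abs_bound)
    also have "\<dots> \<le> (\<integral>t. e/2 + K * indicator {..t0} t \<partial>?U)"
    proof (rule integral_mono)
      show "\<bar>g t - L\<bar> \<le> e/2 + K * indicator {..t0} t" for t
        using t0(2)[of t] K[of t] \<open>e > 0\<close> by (auto split: split_indicator)
    qed (use int int' in auto)
    also have "\<dots> = e/2 + K * measure ?U {..t0}"
    proof -
      have "integrable ?U (indicator {..t0} :: real \<Rightarrow> real)"
        by (rule U.integrable_const_bound[of _ 1]) (auto split: split_indicator)
      then show ?thesis by (simp add: U1)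
    qed
    also have "measure ?U {..t0} \<le> t0 / T"
    proof -
      have "measure ?U {..t0} = measure lborel ({0..T} \<inter> {..t0}) / measure lborel {0..T}"
        using \<open>T > 0\<close> by (intro measure_uniform_measure) auto
      also have "\<dots> \<le> t0 / T"
      proof -
        have "measure lborel ({0..T} \<inter> {..t0}) \<le> measure lborel {0..t0}"
          using t0(1) by (intro measure_mono_fmeasurable) (auto simp: fmeasurable_def)
        then show ?thesis using t0(1) \<open>T > 0\<close> by (simp add: divide_right_mono)
      qed
      finally show ?thesis .
    qed
    also have "e/2 + K * (t0 / T) < e"
    proof -
      have "2 * K * t0 / e < T" using T by simp
      then have "2 * K * t0 < T * e" using \<open>e > 0\<close> by (simp add: field_simps)
      then show ?thesis using \<open>T > 0\<close> by (simp add: field_simps)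
    qed
    finally show ?thesis using \<open>K \<ge> 0\<close> by (simp add: mult_left_mono)
  qed
  then show "\<forall>\<^sub>F T in at_top. dist (\<integral>t. g t \<partial>uniform_measure lborel {0..T}) L < e"
    unfolding dist_real_def using eventually_gt_at_top[of "2 * K * t0 / e + 1"] by (rule eventually_mono[rotated])
qed

section \<open>Length on a line as a fractal distribution\<close>

text \<open>All coordinates past index 1 vanish, so \<open>point u 0\<close> also stands for the
  point u of the line.\<close>

definition point :: "real \<Rightarrow> real \<Rightarrow> nat \<Rightarrow> real" where
  "point a b i = (if i = 0 then a else if i = 1 then b else 0)"

lemma point_simps [simp]: "point a b 0 = a" "point a b 1 = b" "point a b (Suc 0) = b"
  by (simp_all add: point_def)

lemma point_in_space [simp]: "point a b \<in> topspace (Euclidean_space 2)"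
  by (simp add: point_def topspace_Euclidean_space)

lemma origin_eq_point: "origin = point 0 0"
  by (auto simp: point_def)

lemma point_in_closed_ball:
  "point a b \<in> closed_ball 2 x r \<longleftrightarrow> \<bar>a - x 0\<bar> \<le> r \<and> \<bar>b - x 1\<bar> \<le> r"
  by (auto simp: closed_ball_def less_2_cases_iff)

lemma measurable_point:
  assumes "f \<in> borel_measurable M" "g \<in> borel_measurable M"
  shows "(\<lambda>x. point (f x) (g x)) \<in> measurable M (borel_of (Euclidean_space 2))"
  by (rule measurable_borel_of_Euclidean_space)
    (use assms in \<open>auto simp: point_def less_2_cases_iff\<close>)

definition axis_length :: "(nat \<Rightarrow> real) measure" where
  "axis_length = distr lborel (borel_of (Euclidean_space 2)) (point 0)"

lemma measurable_point_0 [measurable]: "point 0 \<in> measurable borel (borel_of (Euclidean_space 2))"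
  by (rule measurable_point) auto

lemma sets_axis_length [simp]: "sets axis_length = sets (borel_of (Euclidean_space 2))"
  by (simp add: axis_length_def)

lemma space_axis_length [simp]: "space axis_length = topspace (Euclidean_space 2)"
  by (simp add: axis_length_def)

lemma emeasure_axis_length:
  assumes "A \<in> sets (borel_of (Euclidean_space 2))"
  shows "emeasure axis_length A = emeasure lborel (point 0 -` A)"
  unfolding axis_length_def using assms by (subst emeasure_distr) auto

lemma emeasure_axis_length_closed_ball:
  "r \<ge> 0 \<Longrightarrow> emeasure axis_length (closed_ball 2 origin r) = ennreal (2 * r)"
proof -
  assume "r \<ge> 0"
  have "point 0 -` closed_ball 2 origin r = (if r \<ge> 0 then {-r..r} else {})"
    by (auto simp: point_in_closed_ball abs_le_iff)
  with \<open>r \<ge> 0\<close> show ?thesis by (simp add: emeasure_axis_length)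
qed

lemma radon_axis_length: "axis_length \<in> radon_measures (Euclidean_space 2)"
  unfolding radon_measures_def
proof (intro CollectI conjI allI impI)
  fix K assume "compactin (Euclidean_space 2) K"
  then have "compact K" "K \<subseteq> topspace (Euclidean_space 2)"
    by (simp_all add: compactin_Euclidean_space)
  from bounded_in_closed_ball[OF this] obtain R where R: "K \<subseteq> closed_ball 2 origin R" ..
  then have "K \<subseteq> closed_ball 2 origin \<bar>R\<bar>"
    by (force simp: closed_ball_def)
  then have "emeasure axis_length K \<le> emeasure axis_length (closed_ball 2 origin \<bar>R\<bar>)"
    by (rule emeasure_mono) simp
  also have "\<dots> < \<infinity>" by (simp add: emeasure_axis_length_closed_ball)
  finally show "emeasure axis_length K < \<infinity>" .
qed simp

text \<open>The unit ball meets the axis in a segment of length 2, whence the factor.\<close>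

definition axis_measure :: "(nat \<Rightarrow> real) measure" where
  "axis_measure = scale_measure (ennreal (1/2)) axis_length"

text \<open>Normalisation forgets positive factors. Dilating and recentring on the axis change the
  length measure by nothing else, so \<open>axis_measure\<close> is fixed by both.\<close>

lemma star_axis:
  assumes "c > 0" shows "star 2 (scale_measure (ennreal c) axis_length) = axis_measure"
proof -
  have e: "emeasure (scale_measure (ennreal c) axis_length) (unit_ball 2) = ennreal (c * 2)"
    using assms by (simp add: emeasure_axis_length_closed_ball ennreal_mult)
  have r: "scale_measure (ennreal c) axis_length \<in> radon_measures (Euclidean_space 2)"
    by (rule radon_scale_measure[OF radon_axis_length]) simp
  have "measure (scale_measure (ennreal c) axis_length) (unit_ball 2) = c * 2"
    unfolding measure_def e using assms by simp
  then have "star 2 (scale_measure (ennreal c) axis_length)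
      = scale_measure (ennreal (1 / (c * 2))) (scale_measure (ennreal c) axis_length)"
    using star_eq_scale_measure(1)[OF r] e assms by simp
  also have "\<dots> = axis_measure"
    using assms by (simp add: axis_measure_def ennreal_mult[symmetric])
  finally show ?thesis .
qed

lemma dilate_scale_measure:
  assumes "sets \<mu> = sets (borel_of (Euclidean_space d))"
  shows "dilate d t (scale_measure c \<mu>) = scale_measure c (dilate d t \<mu>)"
proof (rule measure_eqI)
  fix A assume A: "A \<in> sets (dilate d t (scale_measure c \<mu>))"
  have "(\<lambda>y i. exp t * y i) \<in> measurable \<mu> (borel_of (Euclidean_space d))"
      "(\<lambda>y i. exp t * y i) \<in> measurable (scale_measure c \<mu>) (borel_of (Euclidean_space d))"
    using dilation_measurable measurable_cong_sets[of _ "borel_of (Euclidean_space d)"] assms by auto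
  with A show "emeasure (dilate d t (scale_measure c \<mu>)) A = emeasure (scale_measure c (dilate d t \<mu>)) A"
    by (simp add: dilate_def emeasure_distr space_scale_measure)
qed simp

lemma translate_scale_measure:
  assumes "sets \<mu> = sets (borel_of (Euclidean_space d))" "x \<in> topspace (Euclidean_space d)"
  shows "translate d x (scale_measure c \<mu>) = scale_measure c (translate d x \<mu>)"
proof (rule measure_eqI)
  fix A assume A: "A \<in> sets (translate d x (scale_measure c \<mu>))"
  have "(\<lambda>y i. y i - x i) \<in> measurable \<mu> (borel_of (Euclidean_space d))"
      "(\<lambda>y i. y i - x i) \<in> measurable (scale_measure c \<mu>) (borel_of (Euclidean_space d))"
    using translation_measurable[OF assms(2)] measurable_cong_sets[of _ "borel_of (Euclidean_space d)"] assms by auto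
  with A show "emeasure (translate d x (scale_measure c \<mu>)) A = emeasure (scale_measure c (translate d x \<mu>)) A"
    by (simp add: translate_def emeasure_distr space_scale_measure)
qed simp

lemma dilate_axis_length: "dilate 2 t axis_length = scale_measure (ennreal (exp (- t))) axis_length"
proof (rule measure_eqI)
  fix A assume "A \<in> sets (dilate 2 t axis_length)"
  then have A: "A \<in> sets (borel_of (Euclidean_space 2))" by simp
  have m: "(\<lambda>y i. exp t * y i) \<in> measurable axis_length (borel_of (Euclidean_space 2))"
    using dilation_measurable measurable_cong_sets[OF sets_axis_length refl] by blast
  have pA: "point 0 -` A \<in> sets borel"
    using measurable_sets[OF measurable_point_0 A] by simp
  have "emeasure (dilate 2 t axis_length) A
      = emeasure axis_length ((\<lambda>y i. exp t * y i) -` A \<inter> topspace (Euclidean_space 2))"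
    using A m by (simp add: dilate_def emeasure_distr)
  also have "\<dots> = emeasure lborel (point 0 -` ((\<lambda>y i. exp t * y i) -` A \<inter> topspace (Euclidean_space 2)))"
    using measurable_sets[OF m A] by (intro emeasure_axis_length) simp
  also have "point 0 -` ((\<lambda>y i. exp t * y i) -` A \<inter> topspace (Euclidean_space 2))
      = (\<lambda>s. exp t * s) -` (point 0 -` A) \<inter> space lborel"
  proof -
    have "(\<lambda>i. exp t * point 0 s i) = point 0 (exp t * s)" for s by (auto simp: point_def)
    then show ?thesis by auto
  qed
  also have "emeasure lborel \<dots> = emeasure (distr lborel borel ((*) (exp t))) (point 0 -` A)"
    using pA by (subst emeasure_distr) auto
  also have "\<dots> = ennreal (exp (- t)) * emeasure lborel (point 0 -` A)"
    using pA by (subst lborel_distr_mult) (simp_all add: emeasure_density nn_integral_cmult_indicator exp_minus)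
  finally show "emeasure (dilate 2 t axis_length) A = emeasure (scale_measure (ennreal (exp (- t))) axis_length) A"
    using A by (simp add: emeasure_axis_length)
qed simp

lemma translate_axis_length: "translate 2 (point 0 y) axis_length = axis_length"
proof (rule measure_eqI)
  fix A assume "A \<in> sets (translate 2 (point 0 y) axis_length)"
  then have A: "A \<in> sets (borel_of (Euclidean_space 2))" by simp
  have m: "(\<lambda>z i. z i - point 0 y i) \<in> measurable axis_length (borel_of (Euclidean_space 2))"
    using translation_measurable[OF point_in_space] measurable_cong_sets[OF sets_axis_length refl] by blast
  have pA: "point 0 -` A \<in> sets borel"
    using measurable_sets[OF measurable_point_0 A] by simp
  have "emeasure (translate 2 (point 0 y) axis_length) A
      = emeasure axis_length ((\<lambda>z i. z i - point 0 y i) -` A \<inter> topspace (Euclidean_space 2))"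
    using A m by (simp add: translate_def emeasure_distr)
  also have "\<dots> = emeasure lborel (point 0 -` ((\<lambda>z i. z i - point 0 y i) -` A \<inter> topspace (Euclidean_space 2)))"
    using measurable_sets[OF m A] by (intro emeasure_axis_length) simp
  also have "point 0 -` ((\<lambda>z i. z i - point 0 y i) -` A \<inter> topspace (Euclidean_space 2))
      = (+) (- y) -` (point 0 -` A) \<inter> space lborel"
  proof -
    have "(\<lambda>i. point 0 s i - point 0 y i) = point 0 (- y + s)" for s by (auto simp: point_def)
    then show ?thesis by auto
  qed
  also have "emeasure lborel \<dots> = emeasure (distr lborel borel ((+) (- y))) (point 0 -` A)"
    using pA by (subst emeasure_distr) auto
  also have "\<dots> = emeasure lborel (point 0 -` A)"
    by (simp add: lborel_distr_plus)
  finally show "emeasure (translate 2 (point 0 y) axis_length) A = emeasure axis_length A"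
    using A by (simp add: emeasure_axis_length)
qed simp

lemma star_dilate_axis_measure: "star 2 (dilate 2 t axis_measure) = axis_measure"
proof -
  have "dilate 2 t axis_measure = scale_measure (ennreal (1/2 * exp (- t))) axis_length"
    unfolding axis_measure_def dilate_scale_measure[OF sets_axis_length] dilate_axis_length scale_scale_measure
    by (subst ennreal_mult) simp_all
  then show ?thesis by (simp add: star_axis)
qed

lemma star_translate_axis_measure: "star 2 (translate 2 (point 0 y) axis_measure) = axis_measure"
  unfolding axis_measure_def translate_scale_measure[OF sets_axis_length point_in_space] translate_axis_length
  by (rule star_axis[unfolded axis_measure_def]) simp

lemma axis_measure_star: "axis_measure \<in> star_measures 2"
proof -
  have "emeasure axis_length (unit_ball 2) > 0"
    by (simp add: emeasure_axis_length_closed_ball)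
  from star_eq_scale_measure(3)[OF radon_axis_length this] star_axis[of 1] show ?thesis
    by simp
qed

lemma axis_measure_radon: "axis_measure \<in> radon_measures (Euclidean_space 2)"
  using axis_measure_star by (simp add: star_measures_def)

lemma axis_measure_flow_domain: "axis_measure \<in> flow_domain 2"
  unfolding flow_domain_def supp_def
proof (intro CollectI conjI allI impI axis_measure_star)
  fix U assume U: "openin (Euclidean_space 2) U \<and> origin \<in> U"
  then obtain W where W: "open W" "U = topspace (Euclidean_space 2) \<inter> W"
    using Euclidean_space_top_of_set[of 2] by (metis openin_open)
  have "continuous_on UNIV (point 0)"
  proof (rule continuous_on_coordinatewise_then_product)
    show "continuous_on UNIV (\<lambda>s. point 0 s i)" for i
      by (cases "i = 1"; cases "i = 0") (auto simp: point_def intro!: continuous_intros)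
  qed
  then have "open (point 0 -` W)" using W(1) by (rule open_vimage[rotated])
  moreover have "0 \<in> point 0 -` W" using U W origin_eq_point by auto
  ultimately obtain e where e: "e > 0" "ball 0 e \<subseteq> point 0 -` W" using open_contains_ball by blast
  have U': "U \<in> sets (borel_of (Euclidean_space 2))" using U openin_sets_borel_of by blast
  have "0 < emeasure lborel (ball (0::real) e)" using e(1) by (simp add: ball_eq_greaterThanLessThan)
  also have "\<dots> \<le> emeasure lborel (point 0 -` U)"
    using e(2) W(2) measurable_sets[OF measurable_point_0 U'] by (intro emeasure_mono) auto
  finally have "emeasure lborel (point 0 -` U) > 0" .
  moreover have "ennreal (1/2) > 0" by (subst ennreal_less_zero_iff) simp
  ultimately show "emeasure axis_measure U > 0"
    unfolding axis_measure_def emeasure_scale_measure emeasure_axis_length[OF U'] ennreal_zero_less_mult_iff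
    by blast
qed (simp add: topspace_Euclidean_space)

lemma AE_axis_measure: "AE x in axis_measure. \<exists>y. x = point 0 y"
proof -
  have "{x \<in> topspace (Euclidean_space 2). x 0 = 0} \<in> sets (borel_of (Euclidean_space 2))"
    using measurable_sets[OF coordinate_measurable[of 0 2], of "{0}"]
    by (simp add: vimage_def Int_def conj_commute)
  then have "AE x in axis_length. x 0 = 0"
    unfolding axis_length_def by (subst AE_distr_iff) auto
  moreover have "AE x in axis_length. x \<in> topspace (Euclidean_space 2)"
    by (rule AE_I2) simp
  ultimately have "AE x in axis_length. \<exists>y. x = point 0 y"
  proof eventually_elim
    case (elim x)
    have "x i = point 0 (x 1) i" for i
      using elim by (cases "i = 0"; cases "i = 1") (auto simp: point_def topspace_Euclidean_space)
    then show ?case by blast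
  qed
  then show ?thesis
    unfolding axis_measure_def scale_measure_eq_density by (subst AE_density) auto
qed

definition axis_distribution :: "(nat \<Rightarrow> real) measure measure" where
  "axis_distribution = return (borel_of (star_topology 2)) axis_measure"

lemma sets_axis_distribution [simp]: "sets axis_distribution = sets (borel_of (star_topology 2))"
  by (simp add: axis_distribution_def)

lemma emeasure_axis_distribution:
  "A \<in> sets (borel_of (star_topology 2)) \<Longrightarrow> emeasure axis_distribution A = indicator A axis_measure"
  by (simp add: axis_distribution_def)

lemma nn_integral_axis_distribution: "(\<integral>\<^sup>+\<nu>. f \<nu> \<partial>axis_distribution) = f axis_measure"
  unfolding axis_distribution_def
  by (rule nn_integral_return_singleton[OF singleton_sets_star[OF axis_measure_star]])

lemma prob_space_axis_distribution: "prob_space axis_distribution"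
  unfolding axis_distribution_def by (rule prob_space_return) (simp add: axis_measure_star)

text \<open>The flow fixes the only measure charged, which gives invariance, and a point mass takes
  only the values 0 and 1, which gives ergodicity. Recentring at axis points fixes that measure too,
  so the mixture assigns to \<open>A\<close> its probability times the positive mass of
  \<open>U\<close>: the null sets agree.\<close>

lemma ergodic_fractal_axis_distribution: "ergodic_fractal_distribution 2 axis_distribution"
proof -
  have inv: "scale_invariant 2 axis_distribution"
    unfolding scale_invariant_def
  proof (intro conjI allI ballI)
    have "AE \<mu> in axis_distribution. \<mu> \<in> {axis_measure}"
      unfolding axis_distribution_def using singleton_sets_star[OF axis_measure_star]
      by (subst AE_return) (auto simp: axis_measure_star)
    then show "AE \<mu> in axis_distribution. \<mu> \<in> flow_domain 2"
      by eventually_elim (simp add: axis_measure_flow_domain)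
    fix t A assume "A \<in> sets axis_distribution"
    then have A: "A \<in> sets (borel_of (star_topology 2))" by simp
    show "emeasure axis_distribution {\<mu> \<in> flow_domain 2. star 2 (dilate 2 t \<mu>) \<in> A} = emeasure axis_distribution A"
      unfolding emeasure_axis_distribution[OF scaling_preimage_sets[OF A]] emeasure_axis_distribution[OF A]
      by (simp add: axis_measure_flow_domain star_dilate_axis_measure indicator_def)
  qed
  have "quasi_Palm 2 axis_distribution"
    unfolding quasi_Palm_def
  proof (intro allI impI ballI)
    fix U R A
    assume U: "openin (Euclidean_space 2) U \<and> origin \<in> U \<and> U \<subseteq> closed_ball 2 origin R"
      and "A \<in> sets axis_distribution"
    then have A: "A \<in> sets (borel_of (star_topology 2))" by simp
    have Us: "U \<in> sets axis_measure"
      using U openin_sets_borel_of radon_sets[OF axis_measure_radon] by auto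
    have "(\<integral>\<^sup>+ x \<in> U. indicator A (star 2 (translate 2 x axis_measure)) \<partial>axis_measure)
        = (\<integral>\<^sup>+ x \<in> U. indicator A axis_measure \<partial>axis_measure)"
      using AE_axis_measure
      by (intro nn_integral_cong_AE, eventually_elim) (auto simp: star_translate_axis_measure)
    also have "\<dots> = indicator A axis_measure * emeasure axis_measure U"
      using Us by (rule nn_integral_cmult_indicator)
    finally have "(\<integral>\<^sup>+ \<mu>. (\<integral>\<^sup>+ x \<in> U. indicator A (star 2 (translate 2 x \<mu>)) \<partial>\<mu>) \<partial>axis_distribution)
        = emeasure axis_distribution A * emeasure axis_measure U"
      by (simp add: nn_integral_axis_distribution emeasure_axis_distribution[OF A])
    moreover have "emeasure axis_measure U > 0"
      using axis_measure_flow_domain U by (auto simp: flow_domain_def supp_def)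
    ultimately show "emeasure axis_distribution A = 0 \<longleftrightarrow>
        (\<integral>\<^sup>+ \<mu>. (\<integral>\<^sup>+ x \<in> U. indicator A (star 2 (translate 2 x \<mu>)) \<partial>\<mu>) \<partial>axis_distribution) = 0"
      by auto
  qed
  with inv show ?thesis
    by (auto simp: ergodic_fractal_distribution_def fractal_distribution_def star_distribution_def
        scale_ergodic_def prob_space_axis_distribution emeasure_axis_distribution split: split_indicator)
qed

lemma box_distribution_axis:
  "box_distribution 2 axis_distribution = return (borel_of (box_topology 2)) (box 2 axis_measure)"
  unfolding box_distribution_def axis_distribution_def
  by (intro distr_return box_measurable) (simp add: axis_measure_star)

section \<open>Zooming into the graph of a function\<close>

text \<open>The parameter is the second coordinate: the graph stands over the vertical axis, and the
  first coordinate of its points is distributed as the image under \<open>g\<close> of Lebesgue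
  measure on \<open>{a..b}\<close>.\<close>

definition graph_measure :: "real \<Rightarrow> real \<Rightarrow> (real \<Rightarrow> real) \<Rightarrow> (nat \<Rightarrow> real) measure" where
  "graph_measure a b g =
     distr (restrict_space lborel {a..b}) (borel_of (Euclidean_space 2)) (\<lambda>y. point (g y) y)"

lemma sets_graph_measure [simp]: "sets (graph_measure a b g) = sets (borel_of (Euclidean_space 2))"
  by (simp add: graph_measure_def)

lemma space_graph_measure [simp]: "space (graph_measure a b g) = topspace (Euclidean_space 2)"
  by (simp add: graph_measure_def)

lemma measurable_graph:
  assumes "g \<in> borel_measurable borel"
  shows "(\<lambda>y. point (g y) y) \<in> measurable (restrict_space lborel {a..b}) (borel_of (Euclidean_space 2))"
  using assms by (intro measurable_restrict_space1 measurable_point) auto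

lemma finite_measure_graph:
  assumes "g \<in> borel_measurable borel"
  shows "finite_measure (graph_measure a b g)"
  unfolding graph_measure_def
  by (intro finite_measure.finite_measure_distr measurable_graph[OF assms] finite_measure_restrict_space finite_measureI)
    (auto simp: emeasure_restrict_space space_restrict_space emeasure_lborel_Icc_eq)

lemma finite_measure_radon:
  assumes "sets M = sets (borel_of X)" "finite_measure M"
  shows "M \<in> radon_measures X"
proof -
  interpret finite_measure M by fact
  show ?thesis using assms by (simp add: radon_measures_def less_top[symmetric])
qed

lemma radon_graph_measure:
  "g \<in> borel_measurable borel \<Longrightarrow> graph_measure a b g \<in> radon_measures (Euclidean_space 2)"
  by (intro finite_measure_radon finite_measure_graph) simp_all

lemma emeasure_graph_measure:
  assumes "g \<in> borel_measurable borel" "A \<in> sets (borel_of (Euclidean_space 2))"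
  shows "emeasure (graph_measure a b g) A = emeasure lborel {y \<in> {a..b}. point (g y) y \<in> A}"
proof -
  have "emeasure (graph_measure a b g) A
      = emeasure (restrict_space lborel {a..b}) ((\<lambda>y. point (g y) y) -` A \<inter> space (restrict_space lborel {a..b}))"
    unfolding graph_measure_def using assms by (intro emeasure_distr measurable_graph)
  also have "\<dots> = emeasure lborel ((\<lambda>y. point (g y) y) -` A \<inter> space (restrict_space lborel {a..b}))"
    by (rule emeasure_restrict_space) (auto simp: space_restrict_space)
  also have "(\<lambda>y. point (g y) y) -` A \<inter> space (restrict_space lborel {a..b}) = {y \<in> {a..b}. point (g y) y \<in> A}"
    by (auto simp: space_restrict_space)
  finally show ?thesis .
qed

lemma integral_graph_measure:
  fixes h :: "_ \<Rightarrow> real"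
  assumes "g \<in> borel_measurable borel" "h \<in> borel_measurable (borel_of (Euclidean_space 2))"
  shows "(\<integral>x. h x \<partial>graph_measure a b g) = (\<integral>y. indicator {a..b} y * h (point (g y) y) \<partial>lborel)"
  unfolding graph_measure_def
  by (subst integral_distr[OF measurable_graph[OF assms(1)] assms(2)])
    (simp add: integral_restrict_space)

text \<open>\<open>P\<close> need not be measurable, so it is reached through the measurable
  property \<open>?Q\<close>: the second coordinate avoids a null set and determines the first
  through \<open>g\<close>.\<close>

lemma AE_graph_measure:
  assumes g: "g \<in> borel_measurable borel"
    and P: "AE y in lborel. y \<in> {a..b} \<longrightarrow> P (point (g y) y)"
  shows "AE x in graph_measure a b g. P x"
proof -
  obtain N where N: "{y. \<not> (y \<in> {a..b} \<longrightarrow> P (point (g y) y))} \<subseteq> N" "N \<in> null_sets lborel"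
    using P unfolding eventually_ae_filter by auto
  let ?E = "borel_of (Euclidean_space 2)"
  let ?Q = "\<lambda>x::nat \<Rightarrow> real. x 1 \<notin> N \<and> x 1 \<in> {a..b} \<and> x 0 = g (x 1)"
  have "{a..b} - N \<in> sets borel" using N(2) by (auto simp: null_sets_def)
  from measurable_sets[OF coordinate_measurable[of 1 2] this]
  have "{x \<in> space ?E. x 1 \<in> {a..b} - N} \<in> sets ?E"
    by (simp add: vimage_def Int_def conj_commute)
  moreover have "{x \<in> space ?E. x 0 = g (x 1)} \<in> sets ?E"
    by (rule borel_measurable_eq[OF coordinate_measurable measurable_compose[OF coordinate_measurable g]])
  ultimately have "{x \<in> space ?E. x 1 \<in> {a..b} - N} \<inter> {x \<in> space ?E. x 0 = g (x 1)} \<in> sets ?E"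
    by (rule sets.Int)
  moreover have "{x \<in> space ?E. x 1 \<in> {a..b} - N} \<inter> {x \<in> space ?E. x 0 = g (x 1)} = {x \<in> space ?E. ?Q x}"
    by auto
  ultimately have "{x \<in> space ?E. ?Q x} \<in> sets ?E" by simp
  then have "(AE x in graph_measure a b g. ?Q x)
      \<longleftrightarrow> (AE y in restrict_space lborel {a..b}. ?Q (point (g y) y))"
    unfolding graph_measure_def by (rule AE_distr_iff[OF measurable_graph[OF g]])
  moreover have "AE y in restrict_space lborel {a..b}. ?Q (point (g y) y)"
    using AE_not_in[OF N(2)] by (subst AE_restrict_space_iff) auto
  ultimately have "AE x in graph_measure a b g. ?Q x" by blast
  moreover have "AE x in graph_measure a b g. x \<in> topspace (Euclidean_space 2)"
    by (rule AE_I2) simp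
  ultimately show ?thesis
  proof eventually_elim
    case (elim x)
    have "x i = point (g (x 1)) (x 1) i" for i
      using elim by (cases "i = 0"; cases "i = 1") (auto simp: point_def topspace_Euclidean_space)
    then have "x = point (g (x 1)) (x 1)" by blast
    then show ?case using elim(1) N(1) by auto
  qed
qed

lemma finite_measure_translate_dilate:
  assumes "finite_measure \<mu>" "sets \<mu> = sets (borel_of (Euclidean_space d))" "x \<in> topspace (Euclidean_space d)"
  shows "dilate d t (translate d x \<mu>) \<in> radon_measures (Euclidean_space d)"
proof -
  have "(\<lambda>y i. y i - x i) \<in> measurable \<mu> (borel_of (Euclidean_space d))"
    using translation_measurable[OF assms(3)] measurable_cong_sets[OF assms(2) refl] by blast
  then have "finite_measure (translate d x \<mu>)"
    unfolding translate_def by (rule finite_measure.finite_measure_distr[OF assms(1)])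
  then show ?thesis by (intro radon_dilate finite_measure_radon) simp_all
qed

lemma emeasure_translate_closed_ball:
  assumes "sets \<mu> = sets (borel_of (Euclidean_space d))" "x \<in> topspace (Euclidean_space d)"
  shows "emeasure (translate d x \<mu>) (closed_ball d origin r) = emeasure \<mu> (closed_ball d x r)"
proof -
  have m: "(\<lambda>y i. y i - x i) \<in> measurable \<mu> (borel_of (Euclidean_space d))"
    using translation_measurable[OF assms(2)] measurable_cong_sets[OF assms(1) refl] by blast
  have "(\<lambda>y i. y i - x i) -` closed_ball d origin r \<inter> space \<mu> = closed_ball d x r"
    using sets_eq_imp_space_eq[OF assms(1)] assms(2)
    by (auto simp: closed_ball_def topspace_Euclidean_space)
  then show ?thesis unfolding translate_def by (subst emeasure_distr[OF m]) auto
qed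

lemma integral_translate:
  fixes f :: "_ \<Rightarrow> real"
  assumes \<mu>: "sets \<mu> = sets (borel_of (Euclidean_space d))" "x \<in> topspace (Euclidean_space d)"
    and f: "f \<in> borel_measurable (borel_of (Euclidean_space d))"
  shows "(\<integral>y. f y \<partial>translate d x \<mu>) = (\<integral>y. f (\<lambda>i. y i - x i) \<partial>\<mu>)"
  unfolding translate_def
  using translation_measurable[OF \<mu>(2)] measurable_cong_sets[OF \<mu>(1) refl] f by (intro integral_distr) blast

lemma integral_scenery:
  fixes f :: "_ \<Rightarrow> real"
  assumes g: "g \<in> borel_measurable borel" and f: "f \<in> borel_measurable (borel_of (Euclidean_space 2))"
  shows "(\<integral>x. f x \<partial>dilate 2 t (translate 2 (point (g y) y) (graph_measure a b g)))
    = (\<integral>z. indicator {a..b} z * f (point (exp t * (g z - g y)) (exp t * (z - y))) \<partial>lborel)"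
proof -
  have eq: "(\<lambda>i. exp t * (point (g z) z i - point (g y) y i)) = point (exp t * (g z - g y)) (exp t * (z - y))" for z
    by (auto simp: point_def)
  have "(\<lambda>x. f (\<lambda>i. exp t * x i)) \<in> borel_measurable (borel_of (Euclidean_space 2))"
    by (rule measurable_compose[OF dilation_measurable f])
  moreover have "(\<lambda>x. f (\<lambda>i. exp t * (x i - point (g y) y i))) \<in> borel_measurable (borel_of (Euclidean_space 2))"
    using measurable_compose[OF translation_measurable[OF point_in_space] calculation] .
  ultimately show ?thesis
    by (simp add: integral_dilate[OF sets_translate f] integral_translate integral_graph_measure[OF g] eq)
qed

text \<open>At a centre in the support every ball of positive radius has positive mass, so all zooms
  can be normalised.\<close>

context
  fixes a b y :: real and g :: "real \<Rightarrow> real"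
  assumes g: "g \<in> borel_measurable borel"
    and supp: "point (g y) y \<in> supp (Euclidean_space 2) (graph_measure a b g)"
begin

abbreviation (input) "zoom t \<equiv> dilate 2 t (translate 2 (point (g y) y) (graph_measure a b g))"

lemma zoom_radon: "zoom t \<in> radon_measures (Euclidean_space 2)"
  by (intro finite_measure_translate_dilate finite_measure_graph[OF g]) simp_all

lemma zoom_pos: "emeasure (zoom t) (unit_ball 2) > 0"
proof -
  have "emeasure (zoom t) (unit_ball 2) = emeasure (graph_measure a b g) (closed_ball 2 (point (g y) y) (exp (- t)))"
    by (simp add: emeasure_dilate_closed_ball emeasure_translate_closed_ball)
  also have "\<dots> > 0"
    by (intro supp_closed_ball_pos[OF radon_graph_measure[OF g] supp]) simp
  finally show ?thesis .
qed

text \<open>A quotient of two integrals with respect to Lebesgue measure in which \<open>t\<close>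
  is a mere parameter; measurability and the limit in \<open>t\<close> are both read off this
  form.\<close>

lemma integral_box_zoom:
  fixes f :: "_ \<Rightarrow> real"
  assumes f: "continuous_on (unit_ball 2) f"
  defines "J \<equiv> \<lambda>f t. \<integral>z. indicator {a..b} z * (indicator (unit_ball 2) (point (exp t * (g z - g y)) (exp t * (z - y)))
      * f (unit_retract (point (exp t * (g z - g y)) (exp t * (z - y))))) \<partial>lborel"
  shows "(\<integral>x. f x \<partial>box 2 (zoom t)) = J f t / J (\<lambda>_. 1) t"
proof -
  have J: "(\<integral>x. indicator (unit_ball 2) x * f (unit_retract x) \<partial>zoom t) = J f t"
    if "continuous_on (unit_ball 2) f" for f :: "_ \<Rightarrow> real"
    unfolding J_def using integral_scenery[OF g unit_retract_borel_measurable[OF that refl]] by simp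
  have "measure (zoom t) (unit_ball 2) = (\<integral>x. indicator (unit_ball 2) x * (\<lambda>_. 1 :: real) (unit_retract x) \<partial>zoom t)"
    using closed_ball_subset[of 2 origin 1] radon_space[OF zoom_radon] by (simp add: Int_absorb2)
  then show ?thesis
    using integral_box[OF zoom_radon zoom_pos f] J[OF f] J[of "\<lambda>_. 1"] by simp
qed

text \<open>\<open>scenery\<close> is a push-forward along this map. Its test integrals are
  quotients of parameter integrals of jointly measurable functions.\<close>

lemma box_zoom_measurable:
  "(\<lambda>t. box 2 (zoom t)) \<in> measurable lborel (borel_of (box_topology 2))"
  unfolding box_topology_def subtopology_unit_ball
proof (rule measurable_prob_topologyI[OF compact_closed_ball])
  show "box 2 (zoom t) \<in> radon_measures (top_of_set (unit_ball 2))" "prob_space (box 2 (zoom t))" for t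
    using box_prob[OF zoom_radon zoom_pos] by auto
  fix f :: "_ \<Rightarrow> real" assume f: "continuous_on (unit_ball 2) f"
  have J: "(\<lambda>t. \<integral>z. indicator {a..b} z * (indicator (unit_ball 2) (point (exp t * (g z - g y)) (exp t * (z - y)))
      * f (unit_retract (point (exp t * (g z - g y)) (exp t * (z - y))))) \<partial>lborel) \<in> borel_measurable lborel"
    if f: "continuous_on (unit_ball 2) f" for f :: "_ \<Rightarrow> real"
  proof (rule lborel.borel_measurable_lebesgue_integral, unfold split_beta')
    note g [measurable]
    have "(\<lambda>p. point (exp (fst p) * (g (snd p) - g y)) (exp (fst p) * (snd p - y)))
        \<in> measurable (lborel \<Otimes>\<^sub>M lborel) (borel_of (Euclidean_space 2))"
      by (rule measurable_point) measurable
    note F = measurable_compose[OF this unit_retract_borel_measurable[OF f refl]]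
    have "(\<lambda>p. indicator {a..b} (snd p) :: real) \<in> borel_measurable (lborel \<Otimes>\<^sub>M lborel)"
      by measurable
    from borel_measurable_times[OF this F]
    show "(\<lambda>p. indicator {a..b} (snd p) * (indicator (unit_ball 2) (point (exp (fst p) * (g (snd p) - g y)) (exp (fst p) * (snd p - y)))
      * f (unit_retract (point (exp (fst p) * (g (snd p) - g y)) (exp (fst p) * (snd p - y)))))) \<in> borel_measurable (lborel \<Otimes>\<^sub>M lborel)" .
  qed
  show "(\<lambda>t. \<integral>x. f x \<partial>box 2 (zoom t)) \<in> borel_measurable lborel"
    unfolding integral_box_zoom[OF f]
    by (intro borel_measurable_divide J f continuous_intros)
qed

text \<open>Substituting z = y + exp (-t) s makes the vertical coordinate independent of t, and the
  factor exp (-t) cancels in the quotient. The horizontal coordinate is 0 for s = 0 and otherwise s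
  times a difference quotient of \<open>g\<close>, so it tends to 0; dominated convergence
  finishes.\<close>

lemma integral_box_zoom_limit:
  fixes f :: "_ \<Rightarrow> real"
  assumes y: "a < y" "y < b" and deriv: "(g has_real_derivative 0) (at y)"
    and f: "continuous_on (unit_ball 2) f"
  shows "((\<lambda>t. \<integral>x. f x \<partial>box 2 (zoom t)) \<longlongrightarrow> (\<integral>x. f x \<partial>box 2 axis_measure)) at_top"
proof -
  define F where "F f x = indicator (unit_ball 2) x * f (unit_retract x)" for f :: "(nat \<Rightarrow> real) \<Rightarrow> real" and x
  define I where "I f t = (\<integral>s. indicator {a..b} (y + exp (- t) * s) * F f (point (exp t * (g (y + exp (- t) * s) - g y)) s) \<partial>lborel)" for f t
  have J: "(\<integral>z. indicator {a..b} z * (indicator (unit_ball 2) (point (exp t * (g z - g y)) (exp t * (z - y)))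
      * f (unit_retract (point (exp t * (g z - g y)) (exp t * (z - y))))) \<partial>lborel) = exp (- t) * I f t" for f t
    by (subst lborel_integral_real_affine[where c="exp (- t)" and t=y])
      (simp_all add: I_def F_def exp_minus mult.assoc[symmetric])
  have ratio: "(\<integral>x. f x \<partial>box 2 (zoom t)) = I f t / I (\<lambda>_. 1) t" for t
  proof -
    have "(\<integral>x. f x \<partial>box 2 (zoom t)) = exp (- t) * I f t / (exp (- t) * I (\<lambda>_. 1) t)"
      using integral_box_zoom[OF f, of t] unfolding J[of t f] J[of t "\<lambda>_. 1"] .
    then show ?thesis by simp
  qed
  have quot: "((\<lambda>t. exp t * (g (y + exp (- t) * s) - g y)) \<longlongrightarrow> 0) at_top" for s
  proof (cases "s = 0")
    case False
    have "((\<lambda>t. exp (- t) * s) \<longlongrightarrow> 0) at_top"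
      by (intro tendsto_mult_left_zero filterlim_compose[OF exp_at_bot] filterlim_uminus_at_bot_at_top)
    then have "filterlim (\<lambda>t. exp (- t) * s) (at 0) at_top"
      using False by (simp add: filterlim_at)
    moreover have "((\<lambda>h. (g (y + h) - g y) / h) \<longlongrightarrow> 0) (at 0)"
      using deriv by (simp add: DERIV_def)
    ultimately have "((\<lambda>t. s * ((g (y + exp (- t) * s) - g y) / (exp (- t) * s))) \<longlongrightarrow> s * 0) at_top"
      by (intro tendsto_mult tendsto_const) (rule filterlim_compose)
    moreover have "s * ((g (y + exp (- t) * s) - g y) / (exp (- t) * s)) = exp t * (g (y + exp (- t) * s) - g y)" for t
      using False by (simp add: exp_minus field_simps)
    ultimately show ?thesis by simp
  qed simp
  have I: "(I f \<longlongrightarrow> (\<integral>x. F f x \<partial>axis_length)) at_top" if f: "continuous_on (unit_ball 2) f" for f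
  proof -
    have Fm: "F f \<in> borel_measurable (borel_of (Euclidean_space 2))"
      unfolding F_def[abs_def] by (rule unit_retract_borel_measurable[OF f refl])
    have "bounded (f ` unit_ball 2)"
      by (intro compact_imp_bounded compact_continuous_image f compact_closed_ball)
    then obtain C where C: "\<And>x. x \<in> unit_ball 2 \<Longrightarrow> \<bar>f x\<bar> \<le> C"
      unfolding bounded_iff by auto
    have C0: "C \<ge> 0" using C[of "point 0 0"] by (simp add: point_in_closed_ball)
    have FC: "\<bar>F f (point u s)\<bar> \<le> C * indicator {-1..1} s" for u s
    proof (cases "point u s \<in> unit_ball 2")
      case True
      then show ?thesis using C[of "point u s"] by (simp add: F_def unit_retract_eq[OF True] point_in_closed_ball abs_le_iff)
    qed (simp add: F_def C0)
    have "(\<integral>x. F f x \<partial>axis_length) = (\<integral>s. F f (point 0 s) \<partial>lborel)"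
      unfolding axis_length_def using Fm by (intro integral_distr) simp_all
    moreover have "((\<lambda>t. I f t) \<longlongrightarrow> (\<integral>s. F f (point 0 s) \<partial>lborel)) at_top"
      unfolding I_def
    proof (rule integral_dominated_convergence_at_top[where w="\<lambda>s. C * indicator {-1..1} s"])
      show "(\<lambda>s. F f (point 0 s)) \<in> borel_measurable lborel"
        using measurable_compose[OF measurable_point_0 Fm] by simp
      note g [measurable]
      have "(\<lambda>s. point (exp t * (g (y + exp (- t) * s) - g y)) s) \<in> measurable lborel (borel_of (Euclidean_space 2))" for t
        by (rule measurable_point) measurable
      note Fm' = measurable_compose[OF this Fm]
      have "(\<lambda>s. indicator {a..b} (y + exp (- t) * s) :: real) \<in> borel_measurable lborel" for t
        by measurable
      from borel_measurable_times[OF this Fm']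
      show "(\<lambda>s. indicator {a..b} (y + exp (- t) * s) * F f (point (exp t * (g (y + exp (- t) * s) - g y)) s))
          \<in> borel_measurable lborel" for t .
      show "integrable lborel (\<lambda>s. C * indicator {-1..1::real} s)" by simp
      show "\<forall>\<^sub>F t in at_top. AE s in lborel.
          norm (indicator {a..b} (y + exp (- t) * s) * F f (point (exp t * (g (y + exp (- t) * s) - g y)) s)) \<le> C * indicator {-1..1} s"
      proof (intro always_eventually allI AE_I2)
        show "norm (indicator {a..b} (y + exp (- t) * s) * F f (point (exp t * (g (y + exp (- t) * s) - g y)) s)) \<le> C * indicator {-1..1} s" for t s
          using FC[of "exp t * (g (y + exp (- t) * s) - g y)" s]
          by (cases "y + exp (- t) * s \<in> {a..b}") (simp_all add: C0)
      qed
      show "AE s in lborel. ((\<lambda>t. indicator {a..b} (y + exp (- t) * s) * F f (point (exp t * (g (y + exp (- t) * s) - g y)) s))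
          \<longlongrightarrow> F f (point 0 s)) at_top"
      proof (rule AE_I2)
        fix s :: real
        show "((\<lambda>t. indicator {a..b} (y + exp (- t) * s) * F f (point (exp t * (g (y + exp (- t) * s) - g y)) s))
          \<longlongrightarrow> F f (point 0 s)) at_top"
        proof (cases "\<bar>s\<bar> \<le> 1")
          case False
          then show ?thesis by (simp add: F_def point_in_closed_ball)
        next
          \<comment> \<open>For fixed \<open>s\<close> the vertical condition does not depend on
            \<open>t\<close>, and horizontally the point is eventually interior, so the jump of the
            ball's indicator does no harm.\<close>
          case True
          let ?u = "\<lambda>t. exp t * (g (y + exp (- t) * s) - g y)"
          have "((\<lambda>t. y + exp (- t) * s) \<longlongrightarrow> y + 0) at_top"
            by (intro tendsto_add tendsto_const tendsto_mult_left_zero filterlim_compose[OF exp_at_bot] filterlim_uminus_at_bot_at_top)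
          then have "\<forall>\<^sub>F t in at_top. y + exp (- t) * s \<in> {a<..<b}"
            using y by (intro topological_tendstoD) auto
          moreover have "\<forall>\<^sub>F t in at_top. ?u t \<in> {-1<..<1}"
            using quot[of s] by (intro topological_tendstoD) auto
          ultimately have ev: "\<forall>\<^sub>F t in at_top. f (unit_retract (point (?u t) s))
              = indicator {a..b} (y + exp (- t) * s) * F f (point (?u t) s)"
            by eventually_elim (use True in \<open>auto simp: F_def point_in_closed_ball\<close>)
          have "continuous_on UNIV (\<lambda>u. f (unit_retract (point u s)))"
          proof (rule continuous_on_compose2[OF continuous_on_unit_retract_compose[OF f]])
            show "continuous_on UNIV (\<lambda>u. point u s)"
            proof (rule continuous_on_coordinatewise_then_product)
              show "continuous_on UNIV (\<lambda>u. point u s i)" for i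
                by (cases "i = 1"; cases "i = 0") (auto simp: point_def intro!: continuous_intros)
            qed
          qed auto
          then have "isCont (\<lambda>u. f (unit_retract (point u s))) 0"
            by (simp add: continuous_on_eq_continuous_at)
          from isCont_tendsto_compose[OF this quot[of s]]
          have "((\<lambda>t. f (unit_retract (point (?u t) s))) \<longlongrightarrow> f (unit_retract (point 0 s))) at_top" .
          moreover have "f (unit_retract (point 0 s)) = F f (point 0 s)"
            using True by (simp add: F_def point_in_closed_ball)
          ultimately show ?thesis using Lim_transform_eventually[OF _ ev] by simp
        qed
      qed
    qed
    ultimately show ?thesis by simp
  qed
  \<comment> \<open>The normalising constants tend to the length 2 of the axis in the unit ball,
    matching the factor 1/2 in \<open>axis_measure\<close>.\<close>
  have I1: "(I (\<lambda>_. 1) \<longlongrightarrow> 2) at_top"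
  proof -
    have "(\<integral>x. F (\<lambda>_. 1) x \<partial>axis_length) = measure axis_length (unit_ball 2)"
      unfolding F_def using closed_ball_subset[of 2 origin 1] by (simp add: Int_absorb2)
    also have "\<dots> = 2"
      unfolding measure_def by (simp add: emeasure_axis_length_closed_ball)
    finally show ?thesis using I[of "\<lambda>_. 1"] by simp
  qed
  have "(\<integral>x. f x \<partial>box 2 axis_measure) = (\<integral>x. F f x \<partial>axis_measure) / measure axis_measure (unit_ball 2)"
    unfolding F_def using axis_measure_star by (intro integral_box f) (auto simp: star_measures_def)
  also have "measure axis_measure (unit_ball 2) = 1"
    using axis_measure_star by (simp add: star_measures_def measure_def)
  also have "(\<integral>x. F f x \<partial>axis_measure) = 1/2 * (\<integral>x. F f x \<partial>axis_length)"
    unfolding axis_measure_def F_def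
    by (rule integral_scale_measure) (auto intro!: unit_retract_borel_measurable f)
  finally have "(\<integral>x. f x \<partial>box 2 axis_measure) = (\<integral>x. F f x \<partial>axis_length) / 2" by simp
  then show ?thesis unfolding ratio by (simp only:) (intro tendsto_divide I[OF f] I1, simp)
qed

end

section \<open>A staircase function with derivative zero almost everywhere\<close>

lemma topspace_box_topology:
  "topspace (box_topology d) = {\<mu> \<in> radon_measures (top_of_set (unit_ball d)). prob_space \<mu>}"
  by (auto simp: box_topology_def prob_topology_def subtopology_unit_ball)

text \<open>Two weak topologies are stacked: integrals of continuous functions give convergence in
  \<open>box_topology\<close>, a test function \<open>F\<close> on that space then converges along
  the orbit, and Cesaro averaging yields convergence of the scenery to a point mass.\<close>

lemma scenery_limit:
  assumes b: "(\<lambda>t. box d (dilate d t (translate d x \<mu>))) \<in> measurable lborel (borel_of (box_topology d))"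
    and l: "l \<in> topspace (box_topology d)"
    and lim: "\<And>f :: _ \<Rightarrow> real. continuous_on (unit_ball d) f \<Longrightarrow>
      ((\<lambda>t. \<integral>y. f y \<partial>box d (dilate d t (translate d x \<mu>))) \<longlongrightarrow> (\<integral>y. f y \<partial>l)) at_top"
  shows "limitin (prob_topology (box_topology d)) (scenery d \<mu> x) (return (borel_of (box_topology d)) l) at_top"
proof (rule limitin_prob_topologyI)
  let ?X = "box_topology d"
  let ?b = "\<lambda>t. box d (dilate d t (translate d x \<mu>))"
  have bX: "?b t \<in> topspace ?X" for t
    using measurable_space[OF b, of t] by simp
  have bl: "limitin ?X ?b l at_top"
    unfolding box_topology_def subtopology_unit_ball
    using l bX lim by (intro limitin_prob_topologyI always_eventually)
      (auto simp: topspace_box_topology compactly_supported_compact compact_closed_ball)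
  show "prob_space (return (borel_of ?X) l)"
    using l by (intro prob_space_return) simp
  then show "return (borel_of ?X) l \<in> radon_measures ?X"
    by (intro prob_space_radon) simp_all
  have bU: "?b \<in> measurable (uniform_measure lborel {0..T}) (borel_of ?X)" for T
    using b measurable_cong_sets[OF sets_uniform_measure refl] by blast
  have "prob_space (scenery d \<mu> x T)" if "T > 0" for T
  proof -
    have "prob_space (uniform_measure lborel {0..T})"
      using that by (intro prob_space_uniform_measure) auto
    then show ?thesis unfolding scenery_def by (rule prob_space.prob_space_distr[OF _ bU])
  qed
  moreover have "scenery d \<mu> x T \<in> radon_measures ?X" if "prob_space (scenery d \<mu> x T)" for T
    using that by (intro prob_space_radon) (simp_all add: scenery_def)
  ultimately show "\<forall>\<^sub>F T in at_top. scenery d \<mu> x T \<in> radon_measures ?X \<and> prob_space (scenery d \<mu> x T)"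
    by (intro eventually_mono[OF eventually_gt_at_top[of 0]]) blast
  fix F assume F: "F \<in> compactly_supported ?X"
  then obtain K where K: "compactin ?X K" "\<And>y. y \<in> topspace ?X - K \<Longrightarrow> F y = 0"
    and Fc: "continuous_map ?X euclideanreal F"
    by (auto simp: compactly_supported_def)
  have Fm: "F \<in> borel_measurable (borel_of ?X)"
    by (rule continuous_map_borel_measurable[OF Fc])
  have "compact (F ` K)" using image_compactin[OF K(1) Fc] by simp
  then obtain C where C: "\<forall>z\<in>F ` K. norm z \<le> C"
    using compact_imp_bounded bounded_iff by metis
  have "\<bar>F (?b t)\<bar> \<le> max C 0" for t
    using C K(2)[of "?b t"] bX[of t] by (cases "?b t \<in> K") (auto simp: le_max_iff_disj)
  moreover have "((\<lambda>t. F (?b t)) \<longlongrightarrow> F l) at_top"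
    using continuous_map_limit[OF Fc bl] by (simp add: o_def)
  moreover have "(\<lambda>t. F (?b t)) \<in> borel_measurable borel"
    using measurable_compose[OF b Fm] by simp
  ultimately have "((\<lambda>T. \<integral>t. F (?b t) \<partial>uniform_measure lborel {0..T}) \<longlongrightarrow> F l) at_top"
    by (intro cesaro_limit)
  moreover have "(\<integral>y. F y \<partial>scenery d \<mu> x T) = (\<integral>t. F (?b t) \<partial>uniform_measure lborel {0..T})" for T
    unfolding scenery_def by (rule integral_distr[OF bU Fm])
  moreover have "(\<integral>y. F y \<partial>return (borel_of ?X) l) = F l"
    using l by (intro integral_return Fm) simp
  ultimately show "((\<lambda>T. \<integral>y. F y \<partial>scenery d \<mu> x T) \<longlongrightarrow> (\<integral>y. F y \<partial>return (borel_of ?X) l)) at_top"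
    by simp
qed

text \<open>\<open>scenery_limit\<close> applies at each interior parameter with vanishing
  derivative whose graph point lies in the support; the two endpoints are null.\<close>

lemma uniformly_scaling_graph_measure:
  assumes g: "g \<in> borel_measurable borel" and "a < b"
    and deriv: "AE y in lborel. y \<in> {a..b} \<longrightarrow> (g has_real_derivative 0) (at y)"
  shows "uniformly_scaling 2 (graph_measure a b g) axis_distribution"
  unfolding uniformly_scaling_def
proof (intro conjI)
  show "graph_measure a b g \<in> radon_measures (Euclidean_space 2)"
    by (rule radon_graph_measure[OF g])
  have "topspace (Euclidean_space 2) \<in> sets (borel_of (Euclidean_space 2))"
    using sets.top[of "borel_of (Euclidean_space 2)"] by simp
  moreover have "{y. a \<le> y \<and> y \<le> b} = {a..b}" by auto
  ultimately have "emeasure (graph_measure a b g) (space (graph_measure a b g)) = emeasure lborel {a..b}"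
    by (simp add: emeasure_graph_measure[OF g])
  then show "emeasure (graph_measure a b g) (space (graph_measure a b g)) > 0"
    using \<open>a < b\<close> by simp
  show "fractal_distribution 2 axis_distribution"
    using ergodic_fractal_axis_distribution by (simp add: ergodic_fractal_distribution_def)
  show "AE x in graph_measure a b g. x \<in> supp (Euclidean_space 2) (graph_measure a b g) \<longrightarrow>
      limitin (prob_topology (box_topology 2)) (scenery 2 (graph_measure a b g) x)
        (box_distribution 2 axis_distribution) at_top"
  proof (rule AE_graph_measure[OF g])
    have "AE y in lborel. y \<noteq> a" "AE y in lborel. y \<noteq> b"
      by (rule AE_lborel_singleton)+
    then show "AE y in lborel. y \<in> {a..b} \<longrightarrow>
      point (g y) y \<in> supp (Euclidean_space 2) (graph_measure a b g) \<longrightarrow>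
      limitin (prob_topology (box_topology 2)) (scenery 2 (graph_measure a b g) (point (g y) y))
        (box_distribution 2 axis_distribution) at_top"
      using deriv
    proof eventually_elim
      case (elim y)
      have "box 2 axis_measure \<in> topspace (box_topology 2)"
        using axis_measure_star box_prob[of axis_measure 2]
        by (simp add: topspace_box_topology star_measures_def)
      then show ?case
        unfolding box_distribution_axis using elim
        by (intro impI scenery_limit box_zoom_measurable integral_box_zoom_limit g) auto
    qed
  qed
qed

section \<open>The staircase: gaps, oscillation and derivative\<close>

definition staircase :: "real \<Rightarrow> real" where
  "staircase y = (\<Sum>n. (1/16)^n * of_int \<lfloor>2^n * y\<rfloor>)"

lemma summable_staircase:
  fixes y :: real
  shows "summable (\<lambda>n. (1/16)^n * real_of_int \<lfloor>2^n * y\<rfloor>)"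
proof (rule summable_comparison_test')
  show "summable (\<lambda>n. (\<bar>y\<bar> + 1) * (1/8::real)^n)"
    by (intro summable_mult summable_geometric) simp
  show "norm ((1/16)^n * real_of_int \<lfloor>2^n * y\<rfloor>) \<le> (\<bar>y\<bar> + 1) * (1/8)^n" for n
  proof -
    have "\<bar>real_of_int \<lfloor>2^n * y\<rfloor>\<bar> \<le> \<bar>2^n * y\<bar> + 1" by linarith
    also have "\<dots> \<le> 2^n * (\<bar>y\<bar> + 1)" by (simp add: abs_mult distrib_left)
    finally have "(1/16)^n * \<bar>real_of_int \<lfloor>2^n * y\<rfloor>\<bar> \<le> (1/16)^n * (2^n * (\<bar>y\<bar> + 1))"
      by (intro mult_left_mono) auto
    also have "\<dots> = (\<bar>y\<bar> + 1) * (1/8)^n"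
      by (simp add: power_mult_distrib[symmetric] mult.assoc[symmetric])
    finally show ?thesis by (simp add: abs_mult)
  qed
qed

lemma staircase_0 [simp]: "staircase 0 = 0"
  by (simp add: staircase_def)

lemma staircase_diff:
  "staircase y - staircase x = (\<Sum>n. (1/16)^n * of_int (\<lfloor>2^n * y\<rfloor> - \<lfloor>2^n * x\<rfloor>))"
  unfolding staircase_def
  by (subst suminf_diff[OF summable_staircase summable_staircase]) (simp add: algebra_simps)

lemma summable_staircase_diff:
  fixes x y :: real
  shows "summable (\<lambda>n. (1/16)^n * real_of_int (\<lfloor>2^n * y\<rfloor> - \<lfloor>2^n * x\<rfloor>))"
  using summable_diff[OF summable_staircase[of y] summable_staircase[of x]] by (simp add: algebra_simps)

text \<open>All terms of the difference series are nonnegative because the floors are monotone, and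
  term \<open>N\<close> alone is at least 16^-N.\<close>

lemma staircase_gap:
  fixes x y :: real
  assumes "x \<le> y" "\<lfloor>2^N * x\<rfloor> < \<lfloor>2^N * y\<rfloor>"
  shows "(1/16)^N \<le> staircase y - staircase x"
proof -
  have "(1/16)^N * 1 \<le> (1/16)^N * real_of_int (\<lfloor>2^N * y\<rfloor> - \<lfloor>2^N * x\<rfloor>)"
  proof (rule mult_left_mono)
    show "1 \<le> real_of_int (\<lfloor>2^N * y\<rfloor> - \<lfloor>2^N * x\<rfloor>)" using assms(2) by linarith
  qed simp
  also have "\<dots> = (\<Sum>n\<in>{N}. (1/16)^n * real_of_int (\<lfloor>2^n * y\<rfloor> - \<lfloor>2^n * x\<rfloor>))" by simp
  also have "\<dots> \<le> staircase y - staircase x"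
    unfolding staircase_diff using assms(1)
    by (intro sum_le_suminf summable_staircase_diff) (auto intro!: mult_nonneg_nonneg floor_mono)
  finally show ?thesis by simp
qed

lemma mono_staircase: "mono staircase"
proof
  fix x y :: real assume "x \<le> y"
  then have "0 \<le> staircase y - staircase x"
    unfolding staircase_diff
    by (intro suminf_nonneg summable_staircase_diff) (auto intro!: mult_nonneg_nonneg floor_mono)
  then show "staircase x \<le> staircase y" by simp
qed

text \<open>At a fine enough level 0 and \<open>y\<close> lie in different dyadic intervals.
  Positivity later keeps these values away from the atom at 0.\<close>

lemma staircase_pos: "0 < y \<Longrightarrow> 0 < staircase y"
proof -
  assume y: "0 < y"
  obtain N where "1 / y < 2 ^ N" using real_arch_pow[of 2 "1/y"] by auto
  then have "1 \<le> 2^N * y" using y by (simp add: field_simps less_imp_le)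
  then have "\<lfloor>2^N * 0\<rfloor> < \<lfloor>2^N * y\<rfloor>" using floor_le_iff[of "2^N * y" 0] by simp
  from staircase_gap[OF _ this] y show ?thesis
    by (smt (verit) staircase_0 zero_less_power divide_pos_pos)
qed

text \<open>The value at 1 is 8/7; the round bound serves to place the graph inside a ball.\<close>

lemma staircase_le_2:
  assumes "y \<le> 1" shows "staircase y \<le> 2"
proof -
  have "staircase y \<le> staircase 1" using mono_staircase assms by (auto dest: monoD)
  also have "staircase 1 = (\<Sum>n. (1/8)^n)"
  proof -
    have "\<lfloor>2 ^ n :: real\<rfloor> = 2 ^ n" for n using floor_of_int[of "2^n"] by simp
    then show ?thesis by (simp add: staircase_def power_mult_distrib[symmetric])
  qed
  also have "\<dots> = 8/7" by (subst suminf_geometric) auto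
  finally show ?thesis by simp
qed

text \<open>Dyadic intervals are nested: the coarser floor is an integer quotient of the finer
  one.\<close>

lemma floor_eq_lower_level:
  fixes x y :: real
  assumes "\<lfloor>2^N * x :: real\<rfloor> = \<lfloor>2^N * y\<rfloor>" "n \<le> N"
  shows "\<lfloor>2^n * x\<rfloor> = \<lfloor>2^n * y\<rfloor>"
proof -
  have "\<lfloor>2^n * z\<rfloor> = \<lfloor>2^N * z\<rfloor> div 2^(N - n)" for z :: real
  proof -
    have "(2::real)^N = 2^n * 2^(N - n)" using assms(2) by (simp add: power_add[symmetric])
    then have "2^n * z = 2^N * z / real_of_int (2^(N - n))" by simp
    then show ?thesis using floor_divide_real_eq_div[of "2^(N - n)" "2^N * z"] by simp
  qed
  then show ?thesis using assms(1) by simp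
qed

text \<open>Terms up to level \<open>N\<close> cancel. As \<open>x\<close> and \<open>y\<close>
  differ by at most 1, term n is at most 2 * 8^-n, and the tail from N + 1 on sums to (2/7) *
  8^-N.\<close>

lemma staircase_close:
  fixes x y :: real
  assumes "\<lfloor>2^N * x\<rfloor> = \<lfloor>2^N * y\<rfloor>" "\<bar>y - x\<bar> \<le> 1"
  shows "\<bar>staircase y - staircase x\<bar> \<le> (1/8)^N"
proof -
  let ?c = "\<lambda>n. (1/16)^n * real_of_int (\<lfloor>2^n * y\<rfloor> - \<lfloor>2^n * x\<rfloor>)"
  have "staircase y - staircase x = (\<Sum>n. ?c (n + Suc N)) + (\<Sum>n<Suc N. ?c n)"
    unfolding staircase_diff by (rule suminf_split_initial_segment[OF summable_staircase_diff])
  also have "(\<Sum>n<Suc N. ?c n) = 0"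
    using floor_eq_lower_level[OF assms(1)] by (intro sum.neutral) auto
  finally have eq: "staircase y - staircase x = (\<Sum>n. ?c (n + Suc N))" by simp
  have bound: "norm (?c n) \<le> 2 * (1/8)^n" for n
  proof -
    have "\<bar>2^n * y - 2^n * x\<bar> = 2^n * \<bar>y - x\<bar>"
      by (simp add: right_diff_distrib[symmetric] abs_mult)
    also have "\<dots> \<le> 2^n * 1" using assms(2) by (intro mult_left_mono) auto
    finally have "\<bar>real_of_int (\<lfloor>2^n * y\<rfloor> - \<lfloor>2^n * x\<rfloor>)\<bar> \<le> 2^n + 1" by linarith
    also have "\<dots> \<le> 2 * 2^n" by simp
    finally have "(1/16)^n * \<bar>real_of_int (\<lfloor>2^n * y\<rfloor> - \<lfloor>2^n * x\<rfloor>)\<bar> \<le> (1/16)^n * (2 * 2^n)"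
      by (intro mult_left_mono) auto
    also have "\<dots> = 2 * (1/8)^n" by (simp add: power_mult_distrib[symmetric])
    finally show ?thesis by (simp add: abs_mult)
  qed
  have geo: "summable (\<lambda>n. 2 * (1/8)^Suc N * (1/8::real)^n)"
    by (intro summable_mult summable_geometric) simp
  have "norm (\<Sum>n. ?c (n + Suc N)) \<le> (\<Sum>n. 2 * (1/8)^Suc N * (1/8)^n)"
  proof (rule norm_suminf_le[OF _ geo])
    fix n
    have "2 * (1/8)^(n + Suc N) = 2 * (1/8)^Suc N * (1/8::real)^n" by (simp add: power_add)
    then show "norm (?c (n + Suc N)) \<le> 2 * (1/8)^Suc N * (1/8)^n"
      using bound[of "n + Suc N"] by (simp only:)
  qed
  also have "\<dots> = 2 * (1/8)^Suc N * (8/7)"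
    by (subst suminf_mult) (auto simp: suminf_geometric)
  also have "\<dots> \<le> (1/8)^N" by simp
  finally show ?thesis by (simp add: eq)
qed

text \<open>Borel--Cantelli: the \<open>4^-N\<close>-neighbourhoods of the dyadic points of level \<open>N\<close> have summable measure.\<close>

lemma AE_far_from_dyadics:
  "AE y :: real in lborel. y \<in> {0<..<1} \<longrightarrow>
     (\<forall>\<^sub>F N in sequentially. \<forall>z. \<bar>z - y\<bar> < (1/4)^N \<longrightarrow> \<lfloor>2^N * z\<rfloor> = \<lfloor>2^N * y\<rfloor>)"
proof -
  define I where "I N m = {real m / 2^N - (1/4)^N <..< real m / 2^N + (1/4)^N}" for N m
  \<comment> \<open>Both ends 0 and 1 are included: 2^N + 1 intervals of length 2 * 4^-N, of total
    length at most 4 * 2^-N.\<close>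
  define A where "A N = (\<Union>m\<in>{..2^N}. I N m)" for N
  have A_le: "emeasure lborel (A N) \<le> ennreal (4 * (1/2)^N)" for N
  proof -
    have "emeasure lborel (A N) \<le> (\<Sum>m\<in>{..2^N}. emeasure lborel (I N m))"
      unfolding A_def by (rule emeasure_subadditive_finite) (auto simp: I_def)
    also have "\<dots> = (\<Sum>m\<in>{..2^N::nat}. ennreal (2 * (1/4)^N))"
      by (simp add: I_def)
    also have "\<dots> = ennreal ((2^N + 1) * (2 * (1/4)^N))"
      by (simp add: sum_constant ennreal_mult ennreal_of_nat_eq_real_of_nat add.commute)
    also have "\<dots> \<le> ennreal (4 * (1/2)^N)"
    proof (rule ennreal_leI)
      have "(2^N + 1) * (2 * (1/4)^N) \<le> (2 * 2^N) * (2 * (1/4::real)^N)"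
        by (intro mult_right_mono) auto
      also have "\<dots> = 4 * (1/2)^N" by (simp add: power_mult_distrib[symmetric])
      finally show "(2^N + 1) * (2 * (1/4)^N) \<le> 4 * (1/2::real)^N" .
    qed
    finally show ?thesis .
  qed
  have "AE y in lborel. \<forall>\<^sub>F N in sequentially. y \<in> space lborel - A N"
  proof (rule borel_cantelli_AE1)
    show "A N \<in> sets lborel" for N unfolding A_def by (intro sets.finite_UN) (auto simp: I_def)
    show "emeasure lborel (A N) < \<infinity>" for N using A_le[of N] by (rule le_less_trans) simp
    show "summable (\<lambda>N. measure lborel (A N))"
    proof (rule summable_comparison_test')
      show "summable (\<lambda>N. 4 * (1/2::real)^N)" by (intro summable_mult summable_geometric) simp
      show "norm (measure lborel (A N)) \<le> 4 * (1/2)^N" for N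
        using A_le[of N] unfolding measure_def by (simp add: enn2real_leI)
    qed
  qed
  then show ?thesis
  proof eventually_elim
    case y: (elim y)
    show ?case
    proof
      assume "y \<in> {0<..<1}"
      from y show "\<forall>\<^sub>F N in sequentially. \<forall>z. \<bar>z - y\<bar> < (1/4)^N \<longrightarrow> \<lfloor>2^N * z\<rfloor> = \<lfloor>2^N * y\<rfloor>"
      proof eventually_elim
        case (elim N)
        show ?case
        proof (intro allI impI, rule ccontr)
          fix z :: real assume z: "\<bar>z - y\<bar> < (1/4)^N" and ne: "\<lfloor>2^N * z\<rfloor> \<noteq> \<lfloor>2^N * y\<rfloor>"
          \<comment> \<open>The numerator of a dyadic point separating \<open>z\<close> from
            \<open>y\<close>: the left end of the interval of \<open>y\<close> if \<open>z\<close>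
            lies below that interval, otherwise its right end.\<close>
          define m where "m = (if \<lfloor>2^N * z\<rfloor> < \<lfloor>2^N * y\<rfloor> then \<lfloor>2^N * y\<rfloor> else \<lfloor>2^N * y\<rfloor> + 1)"
          have "2^N * y < 2^N" "0 \<le> 2^N * y" using \<open>y \<in> {0<..<1}\<close> by auto
          then have "\<lfloor>2^N * y\<rfloor> < 2^N" "0 \<le> \<lfloor>2^N * y\<rfloor>" by (auto simp: floor_less_iff)
          then have m: "0 \<le> m" "m \<le> 2^N" by (auto simp: m_def)
          have "(2^N * z \<le> m \<and> m \<le> 2^N * y) \<or> (2^N * y \<le> m \<and> m \<le> 2^N * z)"
            using ne unfolding m_def by (auto split: if_splits) linarith+
          then have "(z \<le> m / 2^N \<and> m / 2^N \<le> y) \<or> (y \<le> m / 2^N \<and> m / 2^N \<le> z)"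
            by (simp add: field_simps)
          then have "\<bar>y - m / 2^N\<bar> < (1/4)^N" using z by linarith
          then have "y \<in> I N (nat m)" using m by (auto simp: I_def abs_less_iff)
          moreover have "nat m \<le> 2^N" using m by (simp add: nat_le_iff)
          ultimately show False using elim by (auto simp: A_def)
        qed
      qed
    qed
  qed
qed

text \<open>If 4^-(N+1) < |h| < 4^-N with N large, then y and y + h share an interval of level N, so
  the increment is at most 8^-N = 4 * 2^-N * 4^-(N+1), hence at most 4 * 2^-N * |h|.\<close>

lemma staircase_deriv_0:
  fixes y :: real
  assumes "\<forall>\<^sub>F N in sequentially. \<forall>z. \<bar>z - y\<bar> < (1/4)^N \<longrightarrow> \<lfloor>2^N * z\<rfloor> = \<lfloor>2^N * y\<rfloor>"
  shows "(staircase has_real_derivative 0) (at y)"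
  unfolding DERIV_def
proof (rule LIM_I)
  fix e :: real assume "e > 0"
  obtain N0 where N0: "\<And>N z. N \<ge> N0 \<Longrightarrow> \<bar>z - y\<bar> < (1/4)^N \<Longrightarrow> \<lfloor>2^N * z\<rfloor> = \<lfloor>2^N * y\<rfloor>"
    using assms by (auto simp: eventually_sequentially)
  obtain N2 where N2: "(1/2)^N2 < e/4" using real_arch_pow_inv[of "e/4" "1/2"] \<open>e > 0\<close> by auto
  define N1 where "N1 = max N0 N2"
  have "norm ((staircase (y + h) - staircase y) / h - 0) < e" if h: "h \<noteq> 0" "norm (h - 0) < (1/4)^N1" for h
  proof -
    obtain M where M: "(1/4)^M < \<bar>h\<bar>" using real_arch_pow_inv[of "\<bar>h\<bar>" "1/4"] h by auto
    define N where "N = (LEAST n. (1/4)^n < \<bar>h\<bar>) - 1"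
    have least: "(1/4)^(LEAST n. (1/4)^n < \<bar>h\<bar>) < \<bar>h\<bar>" using M by (rule LeastI)
    have "(LEAST n. (1/4)^n < \<bar>h\<bar>) > N1"
    proof (rule ccontr)
      assume "\<not> (LEAST n. (1/4)^n < \<bar>h\<bar>) > N1"
      then have "(1/4::real)^N1 \<le> (1/4)^(LEAST n. (1/4)^n < \<bar>h\<bar>)" by (intro power_decreasing) auto
      with least h(2) show False by simp
    qed
    then have N: "(LEAST n. (1/4)^n < \<bar>h\<bar>) = Suc N" "N \<ge> N1" by (auto simp: N_def)
    have lower: "(1/4)^Suc N < \<bar>h\<bar>" using least N(1) by simp
    have upper: "\<bar>h\<bar> \<le> (1/4)^N" using not_less_Least[of N "\<lambda>n. (1/4)^n < \<bar>h\<bar>"] N(1) by simp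
    show ?thesis
    \<comment> \<open>The hypothesis needs a strict bound. If |h| equals 4^-N with N > N1, one level
      is given up, and 8^-(N-1) is still 4 * 2^-(N-1) * |h|.\<close>
    proof (cases "N = N1 \<or> \<bar>h\<bar> < (1/4)^N")
      case True
      then have "\<bar>h\<bar> < (1/4)^N" using h(2) by auto
      then have "\<lfloor>2^N * y\<rfloor> = \<lfloor>2^N * (y + h)\<rfloor>" using N0[of N "y + h"] N(2) by (simp add: N1_def)
      moreover have "(1/4::real)^N \<le> 1" by (simp add: power_le_one)
      ultimately have "\<bar>staircase (y + h) - staircase y\<bar> \<le> (1/8)^N"
        using upper by (intro staircase_close) auto
      also have "\<dots> = 4 * (1/2)^N * (1/4)^Suc N" by (simp add: power_mult_distrib[symmetric])
      also have "\<dots> \<le> 4 * (1/2)^N * \<bar>h\<bar>" using lower by (intro mult_left_mono) auto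
      also have "\<dots> \<le> 4 * (1/2)^N2 * \<bar>h\<bar>"
        using N(2) by (intro mult_right_mono mult_left_mono power_decreasing) (auto simp: N1_def)
      also have "\<dots> < e * \<bar>h\<bar>" using N2 h by (intro mult_strict_right_mono) auto
      finally show ?thesis using h by (simp add: abs_divide divide_less_eq)
    next
      case False
      define N' where "N' = N - 1"
      have N': "N = Suc N'" "N' \<ge> N1" using False N(2) by (auto simp: N'_def)
      have hN: "\<bar>h\<bar> = (1/4)^N" using False upper by simp
      then have "\<bar>h\<bar> * 4 = (1/4)^N'" "\<bar>h\<bar> > 0" using N'(1) h by simp_all
      then have "\<bar>h\<bar> < (1/4)^N'" by linarith
      then have "\<lfloor>2^N' * y\<rfloor> = \<lfloor>2^N' * (y + h)\<rfloor>" using N0[of N' "y + h"] N' by (simp add: N1_def)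
      moreover have "(1/4::real)^N \<le> 1" by (simp add: power_le_one)
      ultimately have "\<bar>staircase (y + h) - staircase y\<bar> \<le> (1/8)^N'"
        using upper by (intro staircase_close) auto
      also have "\<dots> = 4 * (1/2)^N' * \<bar>h\<bar>" by (simp add: hN N'(1) power_mult_distrib[symmetric])
      also have "\<dots> \<le> 4 * (1/2)^N2 * \<bar>h\<bar>"
        using N'(2) by (intro mult_right_mono mult_left_mono power_decreasing) (auto simp: N1_def)
      also have "\<dots> < e * \<bar>h\<bar>" using N2 h by (intro mult_strict_right_mono) auto
      finally show ?thesis using h by (simp add: abs_divide divide_less_eq)
    qed
  qed
  then show "\<exists>s>0. \<forall>h. h \<noteq> 0 \<and> norm (h - 0) < s \<longrightarrow> norm ((staircase (y + h) - staircase y) / h - 0) < e"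
    by (intro exI[of _ "(1/4)^N1"]) auto
qed

text \<open>One function for both claims: over \<open>{0..1}\<close> it is the staircase, and over
  \<open>{-1..1}\<close> the flat half contributes an atom of mass 1 at 0.\<close>

definition half_staircase :: "real \<Rightarrow> real" where
  "half_staircase y = staircase (max 0 y)"

lemma half_staircase_measurable: "half_staircase \<in> borel_measurable borel"
  by (intro borel_measurable_mono monoI)
    (auto simp: half_staircase_def intro!: monoD[OF mono_staircase])

lemma half_staircase_deriv_0:
  "AE y in lborel. y \<in> {-1..1} \<longrightarrow> (half_staircase has_real_derivative 0) (at y)"
proof -
  have "AE y in lborel. y \<noteq> (0::real)" "AE y in lborel. y \<noteq> (1::real)"
    by (rule AE_lborel_singleton)+
  then show ?thesis using AE_far_from_dyadics
  proof eventually_elim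
    case (elim y)
    have "(half_staircase has_real_derivative 0) (at y)" if "y \<in> {-1..1}"
    proof (cases "y < 0")
      case True
      have "((\<lambda>_. 0) has_real_derivative 0) (at y)" by simp
      then show ?thesis
        by (rule has_field_derivative_transform_within_open[of _ _ _ "{..<0}"])
          (use True in \<open>auto simp: half_staircase_def\<close>)
    next
      case False
      then have y: "y \<in> {0<..<1}" using elim that by auto
      then have "(staircase has_real_derivative 0) (at y)" using elim(3) by (intro staircase_deriv_0) blast
      then show ?thesis
        by (rule has_field_derivative_transform_within_open[of _ _ _ "{0<..}"])
          (use y in \<open>auto simp: half_staircase_def\<close>)
    qed
    then show ?case by blast
  qed
qed

text \<open>Take N with 16^-(N+1) <= 2 r < 16^-N. By \<open>staircase_gap\<close>, values within 2 r
  of each other come from one dyadic interval of level N, so the preimage has length at most 2 *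
  2^-N. The power 8, rather than 4, leaves a spare factor 16^-N that beats the constants once N >=
  4.\<close>

lemma staircase_preimage_small:
  assumes "0 < r" "2 * r < (1/16)^4"
  shows "measure lborel {y \<in> {0..1}. \<bar>half_staircase y - c\<bar> \<le> r} ^ 8 \<le> r"
proof -
  obtain M where M: "(1/16)^M < 2 * r" using real_arch_pow_inv[of "2 * r" "1/16"] assms by auto
  define N where "N = (LEAST n. (1/16)^n \<le> 2 * r) - 1"
  have least: "(1/16)^(LEAST n. (1/16)^n \<le> 2 * r) \<le> 2 * r" using M by (intro LeastI) (rule less_imp_le)
  have "(LEAST n. (1/16)^n \<le> 2 * r) > 4"
  proof (rule ccontr)
    assume "\<not> (LEAST n. (1/16)^n \<le> 2 * r) > 4"
    then have "(1/16::real)^4 \<le> (1/16)^(LEAST n. (1/16)^n \<le> 2 * r)" by (intro power_decreasing) auto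
    with least assms(2) show False by linarith
  qed
  then have N: "(LEAST n. (1/16)^n \<le> 2 * r) = Suc N" "N \<ge> 4" by (auto simp: N_def)
  have lower: "(1/16)^Suc N \<le> 2 * r" using least N(1) by simp
  have upper: "2 * r < (1/16)^N" using not_less_Least[of N "\<lambda>n. (1/16)^n \<le> 2 * r"] N(1) by simp
  let ?S = "{y \<in> {0..1}. \<bar>half_staircase y - c\<bar> \<le> r}"
  have close: "y - x \<le> (1/2)^N" if "x \<in> ?S" "y \<in> ?S" "x \<le> y" for x y
  proof -
    have "staircase y - staircase x < (1/16)^N"
      using that upper by (auto simp: half_staircase_def max_absorb2)
    then have "\<not> \<lfloor>2^N * x\<rfloor> < \<lfloor>2^N * y\<rfloor>" using staircase_gap[OF that(3), of N] by linarith
    then have "2^N * y - 2^N * x \<le> 1" by linarith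
    then show ?thesis by (simp add: field_simps power_divide)
  qed
  have "measure lborel ?S \<le> 2 * (1/2)^N"
  proof (cases "?S = {}")
    case False
    then obtain x where x: "x \<in> ?S" by blast
    have "?S \<subseteq> {x - (1/2)^N..x + (1/2)^N}"
    proof
      fix y assume "y \<in> ?S"
      then show "y \<in> {x - (1/2)^N..x + (1/2)^N}"
        using close[OF x, of y] close[OF _ x, of y] by (cases "x \<le> y") auto
    qed
    moreover have "?S \<in> sets borel" using half_staircase_measurable by measurable
    ultimately have "measure lborel ?S \<le> measure lborel {x - (1/2)^N..x + (1/2)^N}"
      by (intro measure_mono_fmeasurable) (auto simp: fmeasurable_def)
    then show ?thesis by simp
  next
    case True
    show ?thesis unfolding True by simp
  qed
  then have "measure lborel ?S ^ 8 \<le> (2 * (1/2)^N) ^ 8" by (intro power_mono) auto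
  also have "\<dots> = (1/16)^N * (256 * (1/16)^N)"
  proof -
    have "(2 * (1/2)^N) ^ 8 = 256 * ((1/2::real)^N)^8" by (simp add: power_mult_distrib)
    also have "((1/2::real)^N)^8 = ((1/2)^8)^N" by (metis power_mult mult.commute)
    also have "(1/2::real)^8 = (1/16) * (1/16)" by (simp add: power_divide)
    finally show ?thesis by (simp only: power_mult_distrib mult_ac)
  qed
  \<comment> \<open>With N >= 4 the second factor drops to 1/256, while 16^-N is at most 32
    r.\<close>
  also have "\<dots> \<le> (1/16)^N * (256 * (1/16)^4)"
    using N(2) by (intro mult_left_mono power_decreasing) auto
  also have "256 * (1/16)^4 = (1/256 :: real)" by (simp add: power_divide)
  also have "(1/16)^N * (1/256) \<le> r" using lower assms(1) unfolding power_Suc by linarith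
  finally show ?thesis .
qed

section \<open>Dimensions of the projections\<close>

declare One_nat_def [simp del]

definition first_coordinate :: "(nat \<Rightarrow> real) \<Rightarrow> nat \<Rightarrow> real" where
  "first_coordinate x = point (x 0) 0"

lemma first_coordinate_linear: "first_coordinate \<in> linear_maps 2 1"
  by (auto simp: linear_maps_def first_coordinate_def point_def topspace_Euclidean_space)

lemma first_coordinate_measurable:
  "first_coordinate \<in> measurable (borel_of (Euclidean_space 2)) (borel_of (Euclidean_space 1))"
  by (rule measurable_borel_of_Euclidean_space)
    (auto simp: first_coordinate_def point_def coordinate_measurable)

lemma first_coordinate_in_closed_ball:
  "first_coordinate x \<in> closed_ball 1 c r \<longleftrightarrow> \<bar>x 0 - c 0\<bar> \<le> r"
  by (auto simp: first_coordinate_def closed_ball_def topspace_Euclidean_space point_def)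

lemma emeasure_image_restrict:
  assumes \<mu>: "sets \<mu> = sets (borel_of (Euclidean_space 2))" and A: "A \<in> sets (borel_of (Euclidean_space 1))"
    and \<Omega>: "\<Omega> \<in> sets (borel_of (Euclidean_space 2))"
  shows "emeasure (image_measure 1 first_coordinate (restrict_space \<mu> \<Omega>)) A
    = emeasure \<mu> {x \<in> \<Omega>. first_coordinate x \<in> A}"
proof -
  have m: "first_coordinate \<in> measurable \<mu> (borel_of (Euclidean_space 1))"
    using first_coordinate_measurable measurable_cong_sets[OF \<mu> refl] by blast
  have \<Omega>s: "\<Omega> \<in> sets \<mu>" "\<Omega> \<subseteq> space \<mu>" using \<Omega> \<mu> sets.sets_into_space[of \<Omega> \<mu>] by auto
  then have "emeasure (image_measure 1 first_coordinate (restrict_space \<mu> \<Omega>)) A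
      = emeasure \<mu> (first_coordinate -` A \<inter> space (restrict_space \<mu> \<Omega>))"
    unfolding image_measure_def using A m
    by (subst emeasure_distr) (auto simp: measurable_restrict_space1 emeasure_restrict_space space_restrict_space Int_absorb2)
  also have "first_coordinate -` A \<inter> space (restrict_space \<mu> \<Omega>) = {x \<in> \<Omega>. first_coordinate x \<in> A}"
    using \<Omega>s by (auto simp: space_restrict_space)
  finally show ?thesis .
qed

lemma emeasure_image_graph_measure:
  assumes g: "g \<in> borel_measurable borel" and A: "A \<in> sets (borel_of (Euclidean_space 1))"
  shows "emeasure (image_measure 1 first_coordinate (graph_measure a b g)) A
    = emeasure lborel {y \<in> {a..b}. point (g y) 0 \<in> A}"
proof -
  have m: "first_coordinate \<in> measurable (graph_measure a b g) (borel_of (Euclidean_space 1))"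
    using first_coordinate_measurable measurable_cong_sets[OF sets_graph_measure refl] by blast
  have "first_coordinate -` A \<inter> topspace (Euclidean_space 2) \<in> sets (borel_of (Euclidean_space 2))"
    using measurable_sets[OF first_coordinate_measurable A] by simp
  then show ?thesis
    unfolding image_measure_def using A m
    by (simp add: emeasure_distr emeasure_graph_measure[OF g]) (simp add: first_coordinate_def)
qed

lemma finite_measure_image_graph_measure:
  assumes g: "g \<in> borel_measurable borel"
  shows "finite_measure (image_measure 1 first_coordinate (graph_measure a b g))"
  unfolding image_measure_def
  using first_coordinate_measurable measurable_cong_sets[OF sets_graph_measure refl]
  by (intro finite_measure.finite_measure_distr[OF finite_measure_graph[OF g]]) blast

lemma measure_image_graph_measure_closed_ball:
  assumes g: "g \<in> borel_measurable borel"
  shows "measure (image_measure 1 first_coordinate (graph_measure a b g)) (closed_ball 1 c r)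
    = measure lborel {y \<in> {a..b}. \<bar>g y - c 0\<bar> \<le> r}"
proof -
  have "point (g y) 0 \<in> closed_ball 1 c r \<longleftrightarrow> \<bar>g y - c 0\<bar> \<le> r" for y
    using first_coordinate_in_closed_ball[of "point (g y) 0" c r] by (simp add: first_coordinate_def)
  then show ?thesis unfolding measure_def by (simp add: emeasure_image_graph_measure[OF g])
qed

text \<open>Stated with an integer power to avoid real exponents; dividing by the negative number
  \<open>ln r\<close> reverses the inequality of logarithms, and null balls have infinite
  ratio.\<close>

lemma dim_ratio_ge:
  assumes r: "0 < r" "r < 1" and m: "measure \<nu> (closed_ball k y r) ^ 8 \<le> r"
  shows "dim_ratio k \<nu> y r \<ge> ereal (1/8)"
proof (cases "measure \<nu> (closed_ball k y r) = 0")
  case False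
  let ?m = "measure \<nu> (closed_ball k y r)"
  have pos: "?m > 0" using False measure_nonneg[of \<nu> "closed_ball k y r"] by linarith
  have "8 * ln ?m = ln (?m ^ 8)" using pos by (simp add: ln_realpow)
  also have "\<dots> \<le> ln r" using m pos r by (intro ln_mono) auto
  finally have "8 * ln ?m \<le> ln r" .
  moreover have "ln r < 0" using r by simp
  ultimately have "1/8 \<le> ln ?m / ln r" by (simp add: le_divide_eq)
  then show ?thesis using False by (simp add: dim_ratio_def)
qed (simp add: dim_ratio_def)

text \<open>The estimate holds at every point and for all radii below one threshold, so it survives
  both limits inferior.\<close>

lemma half_staircase_image_lower_dim:
  "ereal (1/8) \<le> lower_dim 1 (image_measure 1 first_coordinate (graph_measure 0 1 half_staircase))"
    (is "_ \<le> lower_dim 1 ?\<nu>")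
proof -
  have "ereal (1/8) \<le> lower_local_dim 1 ?\<nu> y" for y
    unfolding lower_local_dim_def
  proof (rule Liminf_bounded)
    have "\<forall>\<^sub>F r::real in at_right 0. r \<in> {0<..<(1/16)^4 / 2}"
      by (intro eventually_at_right_real) simp
    then show "\<forall>\<^sub>F r in at_right 0. ereal (1/8) \<le> dim_ratio 1 ?\<nu> y r"
    proof eventually_elim
      case (elim r)
      have "(1/16::real)^4 / 2 < 1" by (simp add: power_divide)
      with elim show ?case
        by (intro dim_ratio_ge)
          (auto simp: measure_image_graph_measure_closed_ball[OF half_staircase_measurable]
            simp del: atLeastAtMost_iff intro!: staircase_preimage_small)
    qed
  qed
  then show ?thesis unfolding lower_dim_def by (intro Liminf_bounded always_eventually) auto
qed

text \<open>The values over \<open>{0..1}\<close> lie between 0 and 2, so the exhaustion by balls is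
  constant from radius 2 on.\<close>

lemma half_staircase_image_lower_dim_pos:
  "ereal (1/8) \<le> image_lower_dim 2 1 first_coordinate (graph_measure 0 1 half_staircase)"
proof -
  let ?\<mu> = "graph_measure 0 1 half_staircase"
  have eq: "image_measure 1 first_coordinate (restrict_space ?\<mu> (closed_ball 2 origin R)) = image_measure 1 first_coordinate ?\<mu>"
    if "R \<ge> 2" for R
  proof (rule measure_eqI)
    fix A assume "A \<in> sets (image_measure 1 first_coordinate (restrict_space ?\<mu> (closed_ball 2 origin R)))"
    then have A: "A \<in> sets (borel_of (Euclidean_space 1))" by (simp add: image_measure_def)
    have "first_coordinate -` A \<inter> topspace (Euclidean_space 2) \<in> sets (borel_of (Euclidean_space 2))"
      using measurable_sets[OF first_coordinate_measurable A] by simp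
    from sets.Int[OF closed_ball_sets this]
    have "closed_ball 2 origin R \<inter> (first_coordinate -` A \<inter> topspace (Euclidean_space 2)) \<in> sets (borel_of (Euclidean_space 2))" .
    moreover have "closed_ball 2 origin R \<inter> (first_coordinate -` A \<inter> topspace (Euclidean_space 2))
        = {x \<in> closed_ball 2 origin R. first_coordinate x \<in> A}"
      using closed_ball_subset by blast
    ultimately have S: "{x \<in> closed_ball 2 origin R. first_coordinate x \<in> A} \<in> sets (borel_of (Euclidean_space 2))"
      by simp
    have "point (half_staircase y) y \<in> closed_ball 2 origin R" if "y \<in> {0..1}" for y
    proof -
      have "0 \<le> half_staircase y" "half_staircase y \<le> 2"
        using that monoD[OF mono_staircase, of 0 y] staircase_le_2[of y]
        by (auto simp: half_staircase_def max_absorb2)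
      then show ?thesis using that \<open>R \<ge> 2\<close> by (auto simp: point_in_closed_ball)
    qed
    then have "{y \<in> {0..1}. point (half_staircase y) y \<in> {x \<in> closed_ball 2 origin R. first_coordinate x \<in> A}}
        = {y \<in> {0..1}. point (half_staircase y) 0 \<in> A}"
      by (auto simp: first_coordinate_def)
    then show "emeasure (image_measure 1 first_coordinate (restrict_space ?\<mu> (closed_ball 2 origin R))) A
        = emeasure (image_measure 1 first_coordinate ?\<mu>) A"
      unfolding emeasure_image_restrict[OF sets_graph_measure A closed_ball_sets]
        emeasure_graph_measure[OF half_staircase_measurable S] emeasure_image_graph_measure[OF half_staircase_measurable A]
      by simp
  qed (simp add: image_measure_def)
  have "image_lower_dim 2 1 first_coordinate ?\<mu> = lower_dim 1 (image_measure 1 first_coordinate ?\<mu>)"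
    unfolding image_lower_dim_def
    by (rule tendsto_Lim)
      (auto intro!: tendsto_eventually eventually_mono[OF eventually_ge_at_top[of 2]] simp: eq)
  then show ?thesis using half_staircase_image_lower_dim by simp
qed

text \<open>The axis is the kernel of the projection: its mass R inside radius \<open>R\<close>
  lands on the origin, and ln R / ln r tends to 0.\<close>

lemma axis_image_lower_dim: "image_lower_dim 2 1 first_coordinate axis_measure = 0"
proof -
  have "lower_dim 1 (image_measure 1 first_coordinate (restrict_space axis_measure (closed_ball 2 origin R))) = 0"
    (is "lower_dim 1 ?\<nu> = 0") if R: "R > 0" for R
  proof -
    have m: "emeasure ?\<nu> A = ennreal R * indicator A origin" if A: "A \<in> sets (borel_of (Euclidean_space 1))" for A
    proof -
      have e: "emeasure ?\<nu> A = emeasure axis_measure {x \<in> closed_ball 2 origin R. first_coordinate x \<in> A}"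
        by (rule emeasure_image_restrict[OF radon_sets[OF axis_measure_radon] A]) simp
      have "AE x in axis_measure. (x \<in> {x \<in> closed_ball 2 origin R. first_coordinate x \<in> A})
          \<longleftrightarrow> x \<in> (if origin \<in> A then closed_ball 2 origin R else {})"
        using AE_axis_measure
        by eventually_elim (auto simp: first_coordinate_def origin_eq_point[symmetric])
      moreover have "{x \<in> closed_ball 2 origin R. first_coordinate x \<in> A} \<in> sets axis_measure"
      proof -
        have "closed_ball 2 origin R \<inter> (first_coordinate -` A \<inter> topspace (Euclidean_space 2)) \<in> sets (borel_of (Euclidean_space 2))"
          using sets.Int[OF closed_ball_sets measurable_sets[OF first_coordinate_measurable A]] by simp
        moreover have "closed_ball 2 origin R \<inter> (first_coordinate -` A \<inter> topspace (Euclidean_space 2))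
            = {x \<in> closed_ball 2 origin R. first_coordinate x \<in> A}"
          using closed_ball_subset by blast
        ultimately show ?thesis using radon_sets[OF axis_measure_radon] by simp
      qed
      ultimately have "emeasure ?\<nu> A = emeasure axis_measure (if origin \<in> A then closed_ball 2 origin R else {})"
        unfolding e by (intro emeasure_eq_AE) (auto simp: radon_sets[OF axis_measure_radon])
      moreover have "emeasure axis_measure (closed_ball 2 origin R) = ennreal R"
      proof -
        have "emeasure axis_measure (closed_ball 2 origin R) = ennreal (1/2 * (2 * R))"
          unfolding axis_measure_def emeasure_scale_measure using R
          by (subst ennreal_mult) (simp_all add: emeasure_axis_length_closed_ball)
        then show ?thesis by simp
      qed
      ultimately show ?thesis by simp
    qed
    have sp: "space ?\<nu> = topspace (Euclidean_space 1)" and se: "sets ?\<nu> = sets (borel_of (Euclidean_space 1))"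
      by (simp_all add: image_measure_def)
    have o: "origin \<in> topspace (Euclidean_space 1)" by (simp add: topspace_Euclidean_space)
    have "compactin (Euclidean_space 1) {origin}" using o by simp
    then have "{origin} \<in> sets (borel_of (Euclidean_space 1))"
      by (rule compactin_sets_borel_of[OF Hausdorff_Euclidean_space])
    then have "space ?\<nu> - {origin} \<in> null_sets ?\<nu>"
      using m[of "topspace (Euclidean_space 1) - {origin}"] sets.top[of ?\<nu>]
      by (auto simp: null_sets_def sp se intro!: sets.Diff)
    then have ae: "AE y in ?\<nu>. y = origin"
      by (auto dest!: AE_not_in elim: AE_mp)
    \<comment> \<open>Along the trivial filter the limit inferior of the constant 0 would be
      infinite.\<close>
    have ntriv: "ae_filter ?\<nu> \<noteq> bot"
    proof -
      have "emeasure ?\<nu> (space ?\<nu>) \<noteq> 0"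
        using m[of "topspace (Euclidean_space 1)"] sets.top[of ?\<nu>] R o by (simp add: sp se)
      then show ?thesis by (simp add: ae_filter_eq_bot_iff)
    qed
    have "measure ?\<nu> (closed_ball 1 origin r) = R" if "r > 0" for r
    proof -
      have "origin \<in> closed_ball 1 origin r" using that o by (simp add: closed_ball_def)
      then show ?thesis using m[OF closed_ball_sets, of origin r] R by (simp add: measure_def)
    qed
    then have ratio: "dim_ratio 1 ?\<nu> origin r = ereal (ln R / ln r)" if "r > 0" for r
      using that R by (simp add: dim_ratio_def)
    have "((\<lambda>r. ln R / ln r) \<longlongrightarrow> 0) (at_right 0)"
      by (rule tendsto_divide_0[OF tendsto_const filterlim_mono[OF ln_at_0 at_bot_le_at_infinity order_refl]])
    then have "((\<lambda>r. ereal (ln R / ln r)) \<longlongrightarrow> ereal 0) (at_right 0)" by simp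
    then have "(dim_ratio 1 ?\<nu> origin \<longlongrightarrow> ereal 0) (at_right 0)"
      by (rule Lim_transform_eventually)
        (use ratio in \<open>auto simp: eventually_at_right_less intro!: eventually_mono[OF eventually_at_right_less[of 0]]\<close>)
    then have "lower_local_dim 1 ?\<nu> origin = 0"
      unfolding lower_local_dim_def zero_ereal_def by (intro lim_imp_Liminf) auto
    then have "lower_dim 1 ?\<nu> = Liminf (ae_filter ?\<nu>) (\<lambda>_. 0)"
      unfolding lower_dim_def using ae by (intro Liminf_eq) (auto elim: eventually_mono)
    then show ?thesis using ntriv by (simp add: Liminf_const)
  qed
  then show ?thesis
    unfolding image_lower_dim_def
    by (intro tendsto_Lim tendsto_eventually eventually_mono[OF eventually_gt_at_top[of 0]]) auto
qed

text \<open>A null exceptional set cannot cover \<open>S\<close>. As \<open>S\<close> is not assumed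
  measurable, positivity is asked of its measurable supersets.\<close>

lemma AE_imp_of_not_null:
  assumes "AE x in M. P x" "\<And>N. N \<in> sets M \<Longrightarrow> S \<subseteq> N \<Longrightarrow> emeasure M N > 0" "S \<subseteq> space M"
  shows "\<exists>x\<in>S. P x"
proof (rule ccontr)
  assume neg: "\<not> (\<exists>x\<in>S. P x)"
  obtain N where N: "{x \<in> space M. \<not> P x} \<subseteq> N" "emeasure M N = 0" "N \<in> sets M"
    using AE_E[OF assms(1)] by blast
  then have "S \<subseteq> N" using neg assms(3) by auto
  with assms(2)[OF N(3)] N(2) show False by simp
qed

text \<open>One exponent would have to serve two kinds of points: the atom at 0 forces it to be at
  most 0, a positive value of the staircase forces it to be at least 1/8.\<close>

lemma half_staircase_image_not_exact_dimensional:
  "\<not> exact_dimensional 1 (image_measure 1 first_coordinate (graph_measure (- 1) 1 half_staircase))"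
    (is "\<not> exact_dimensional 1 ?\<nu>")
proof
  assume "exact_dimensional 1 ?\<nu>"
  then obtain \<alpha> :: real where ae: "AE y in ?\<nu>. (dim_ratio 1 ?\<nu> y \<longlongrightarrow> ereal \<alpha>) (at_right 0)"
    by (auto simp: exact_dimensional_def)
  have sp: "space ?\<nu> = topspace (Euclidean_space 1)" and se: "sets ?\<nu> = sets (borel_of (Euclidean_space 1))"
    by (simp_all add: image_measure_def)
  have pt: "point u 0 \<in> topspace (Euclidean_space 1)" for u by (simp add: point_def topspace_Euclidean_space)
  have m: "emeasure ?\<nu> A = emeasure lborel {y \<in> {-1..1}. point (half_staircase y) 0 \<in> A}" if "A \<in> sets ?\<nu>" for A
    using that unfolding se by (rule emeasure_image_graph_measure[OF half_staircase_measurable])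
  have meas: "{y \<in> {-1..1}. point (half_staircase y) 0 \<in> A} \<in> sets lborel" if "A \<in> sets ?\<nu>" for A
  proof -
    have "(\<lambda>y. point (half_staircase y) 0) \<in> measurable borel (borel_of (Euclidean_space 1))"
      by (rule measurable_borel_of_Euclidean_space) (auto simp: point_def half_staircase_measurable)
    from measurable_sets[OF this] that have "(\<lambda>y. point (half_staircase y) 0) -` A \<in> sets borel"
      by (simp add: se)
    then have "{-1..1} \<inter> (\<lambda>y. point (half_staircase y) 0) -` A \<in> sets borel" by (intro sets.Int) auto
    moreover have "{-1..1} \<inter> (\<lambda>y. point (half_staircase y) 0) -` A = {y \<in> {-1..1}. point (half_staircase y) 0 \<in> A}"
      by auto
    ultimately show ?thesis by simp
  qed
  interpret finite_measure ?\<nu>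
    by (rule finite_measure_image_graph_measure[OF half_staircase_measurable])
  have atom: "emeasure ?\<nu> N \<ge> 1" if "N \<in> sets ?\<nu>" "{point 0 0} \<subseteq> N" for N
  proof -
    have "emeasure lborel {-1..0::real} \<le> emeasure lborel {y \<in> {-1..1}. point (half_staircase y) 0 \<in> N}"
      using meas[OF that(1)] that(2) by (intro emeasure_mono) (auto simp: half_staircase_def max_absorb1)
    then show ?thesis using m[OF that(1)] by simp
  qed
  have "\<exists>y\<in>{point 0 0}. (dim_ratio 1 ?\<nu> y \<longlongrightarrow> ereal \<alpha>) (at_right 0)"
    using ae
  proof (rule AE_imp_of_not_null)
    show "emeasure ?\<nu> N > 0" if "N \<in> sets ?\<nu>" "{point 0 0} \<subseteq> N" for N
      using atom[OF that] by (rule less_le_trans[rotated]) simp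
  qed (simp add: sp pt)
  then have lim0: "(dim_ratio 1 ?\<nu> (point 0 0) \<longlongrightarrow> ereal \<alpha>) (at_right 0)" by simp
  \<comment> \<open>Balls around the atom have mass at least 1, so the numerator of the ratio is
    nonnegative while \<open>ln r\<close> is negative.\<close>
  have "\<alpha> \<le> 0"
  proof -
    have "dim_ratio 1 ?\<nu> (point 0 0) r \<le> ereal 0" if "r \<in> {0<..<1}" for r
    proof -
      have "{point 0 0} \<subseteq> closed_ball 1 (point 0 0) r"
        using that by (auto simp: closed_ball_def pt)
      then have "emeasure ?\<nu> (closed_ball 1 (point 0 0) r) \<ge> 1" by (intro atom) (simp_all add: se)
      then have "measure ?\<nu> (closed_ball 1 (point 0 0) r) \<ge> 1"
        by (simp add: emeasure_eq_measure)
      moreover have "ln r < 0" using that by simp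
      ultimately show ?thesis
        by (auto simp: dim_ratio_def intro!: divide_nonneg_neg)
    qed
    moreover have "\<forall>\<^sub>F r::real in at_right 0. r \<in> {0<..<1}" by (intro eventually_at_right_real) simp
    ultimately have "\<forall>\<^sub>F r in at_right 0. dim_ratio 1 ?\<nu> (point 0 0) r \<le> ereal 0"
      by (auto elim: eventually_mono)
    from tendsto_upperbound[OF lim0 this] show ?thesis by simp
  qed
  have "\<exists>y\<in>{point (half_staircase y) 0 | y. y \<in> {0<..1}}. (dim_ratio 1 ?\<nu> y \<longlongrightarrow> ereal \<alpha>) (at_right 0)"
    using ae
  proof (rule AE_imp_of_not_null)
    fix N assume N: "N \<in> sets ?\<nu>" "{point (half_staircase y) 0 | y. y \<in> {0<..1}} \<subseteq> N"
    have "point (half_staircase y) 0 \<in> N" if "y \<in> {0<..1}" for y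
      using N(2) that by blast
    then have "emeasure lborel {0<..1::real} \<le> emeasure lborel {y \<in> {-1..1}. point (half_staircase y) 0 \<in> N}"
      using meas[OF N(1)] by (intro emeasure_mono) auto
    then have "1 \<le> emeasure ?\<nu> N" using m[OF N(1)] by simp
    then show "emeasure ?\<nu> N > 0" by (rule less_le_trans[rotated]) simp
  qed (auto simp: sp pt)
  then obtain z where z: "z \<in> {0<..1}"
    and lim: "(dim_ratio 1 ?\<nu> (point (half_staircase z) 0) \<longlongrightarrow> ereal \<alpha>) (at_right 0)" by blast
  let ?h = "half_staircase z"
  have h: "?h > 0" using staircase_pos[of z] z by (simp add: half_staircase_def)
  \<comment> \<open>For \<open>r\<close> below \<open>?h\<close> the ball misses the atom, so only
    parameters in \<open>{0..1}\<close> contribute and the estimate for the staircase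
    applies.\<close>
  have "dim_ratio 1 ?\<nu> (point ?h 0) r \<ge> ereal (1/8)" if r: "r \<in> {0<..<min ?h ((1/16)^4 / 2)}" for r
  proof (rule dim_ratio_ge)
    have "(1/16::real)^4 / 2 < 1" by (simp add: power_divide)
    then show "0 < r" "r < 1" using r by auto
    have "{y \<in> {-1..1}. \<bar>half_staircase y - ?h\<bar> \<le> r} = {y \<in> {0..1}. \<bar>half_staircase y - ?h\<bar> \<le> r}"
    proof -
      have "y \<ge> 0" if "\<bar>half_staircase y - ?h\<bar> \<le> r" for y
      proof (rule ccontr)
        assume "\<not> y \<ge> 0"
        then have "half_staircase y = 0" by (simp add: half_staircase_def max_absorb1)
        then show False using that r by auto
      qed
      then show ?thesis by (auto intro: order_trans[of "- 1" 0])
    qed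
    then show "measure ?\<nu> (closed_ball 1 (point ?h 0) r) ^ 8 \<le> r"
      unfolding measure_image_graph_measure_closed_ball[OF half_staircase_measurable]
      using staircase_preimage_small[of r ?h] r by simp
  qed
  moreover have "\<forall>\<^sub>F r in at_right 0. r \<in> {0<..<min ?h ((1/16)^4 / 2)}"
    using h by (intro eventually_at_right_real) simp
  ultimately have "\<forall>\<^sub>F r in at_right 0. ereal (1/8) \<le> dim_ratio 1 ?\<nu> (point ?h 0) r"
    by (auto elim: eventually_mono)
  from tendsto_lowerbound[OF lim this] have "1/8 \<le> \<alpha>" by simp
  with \<open>\<alpha> \<le> 0\<close> show False by simp
qed

theorem proposition1p24:
  shows "(\<exists>d k \<mu> P \<pi>.
            1 \<le> d \<and> 1 \<le> k \<and>
            ergodic_fractal_distribution d P \<and> uniformly_scaling d \<mu> P \<and>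
            \<pi> \<in> linear_maps d k \<and>
            finite_measure \<mu> \<and> \<not> exact_dimensional k (image_measure k \<pi> \<mu>))
       \<and> (\<exists>d k \<mu> P \<pi>.
            1 \<le> d \<and> 1 \<le> k \<and>
            ergodic_fractal_distribution d P \<and> uniformly_scaling d \<mu> P \<and>
            \<pi> \<in> linear_maps d k \<and>
            image_lower_dim d k \<pi> \<mu> > enn2ereal (expected_dim d k \<pi> P))"
proof -
  \<comment> \<open>Vanishing of the derivative almost everywhere on \<open>{-1..1}\<close>
    restricts to \<open>{0..1}\<close>, so both claims use the same distribution and differ only in
    the interval.\<close>
  have usm: "uniformly_scaling 2 (graph_measure a 1 half_staircase) axis_distribution" if "a \<in> {-1, 0}" for a
    using that half_staircase_deriv_0
    by (intro uniformly_scaling_graph_measure half_staircase_measurable) (auto elim!: eventually_mono)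
  have "expected_dim 2 1 first_coordinate axis_distribution = 0"
    by (simp add: expected_dim_def nn_integral_axis_distribution axis_image_lower_dim)
  then have "enn2ereal (expected_dim 2 1 first_coordinate axis_distribution) < ereal (1/8)"
    by (simp add: zero_ennreal.rep_eq)
  also have "\<dots> \<le> image_lower_dim 2 1 first_coordinate (graph_measure 0 1 half_staircase)"
    by (rule half_staircase_image_lower_dim_pos)
  finally have dim: "enn2ereal (expected_dim 2 1 first_coordinate axis_distribution)
      < image_lower_dim 2 1 first_coordinate (graph_measure 0 1 half_staircase)" .
  have fst: "(1::nat) \<le> 2" "(1::nat) \<le> 1" by simp_all
  show ?thesis
  proof (rule conjI, goal_cases)
    case 1
    show ?case
      using fst ergodic_fractal_axis_distribution usm[of "- 1"] first_coordinate_linear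
        finite_measure_graph[OF half_staircase_measurable] half_staircase_image_not_exact_dimensional
      by blast
  next
    case 2
    show ?case
      using fst ergodic_fractal_axis_distribution usm[of 0] first_coordinate_linear dim by blast
  qed
qed

end
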